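(* Assume $N\ge2$. Let $\chi$ be a bi-homomorphism on $\Pi$ such that $\chi\approx\chi'$ for some bi-homomorphism $\chi'$ of Cartan type. Let $\Lambda\in\mathrm{Ch}(U^0(\chi))$. Then $\dim\mathcal{L}_\chi(\Lambda)<\infty$ if and only if for every $i\in I$ there exists an integer $r_i\ge0$ with $\Lambda(K_{\alpha_i}L_{-\alpha_i})=\chi(\alpha_i,\alpha_i)^{r_i}$.
   Context: $\mathbb{K}$ is a field of characteristic $0$, $\mathbb{K}^\times=\mathbb{K}\setminus\{0\}$, and $\mathbb{K}^\times_\infty$ is the set of elements of $\mathbb{K}^\times$ that are not roots of unity. $N\ge1$ is an integer, $I=\{1,\dots,N\}$, $\Pi=\{\alpha_i\mid i\in I\}$, $\mathbb{Z}\Pi=\bigoplus_{i\in I}\mathbb{Z}\alpha_i$ (free $\mathbb{Z}$-module), $\mathbb{Z}_{\ge0}\Pi=\bigoplus_{i\in I}\mathbb{Z}_{\ge0}\alpha_i$. A bi-homomorphism on $\Pi$ is a map $\chi:\mathbb{Z}\Pi\times\mathbb{Z}\Pi\to\mathbb{K}^\times$ with $\chi(\alpha,\beta+\gamma)=\chi(\alpha,\beta)\chi(\alpha,\gamma)$ and $\chi(\alpha+\beta,\gamma)=\chi(\alpha,\gamma)\chi(\beta,\gamma)$. Relations between bi-homomorphisms. For $t,t_1,t_2\in\mathbb{K}$ and $m\ge0$: $(m)_t=\sum_{j=0}^{m-1}t^j$, $(m)_t!=\prod_{j=1}^m(j)_t$, $(m;t_1,t_2)!=\prod_{j=1}^m(1-t_1^{j-1}t_2)$.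 For a bi-homomorphism $\chi$ with $q_{ij}=\chi(\alpha_i,\alpha_j)$ put $c^\chi_{ii}=2$ and, for $i\ne j$, $c^\chi_{ij}=-\max\{m\ge0\mid (m)_{q_{ii}}!\,(m;q_{ii},q_{ij}q_{ji})!\ne0\}$ (with $c^\chi_{ij}=-\infty$ if this set is all of $\mathbb{Z}_{\ge0}$). If $c^\chi_{ij}\neq-\infty$ for all $j\in I$, let $s^\chi_i(\alpha_j)=\alpha_j-c^\chi_{ij}\alpha_i$ and $\tau_i\chi(\alpha,\beta)=\chi(s_i^\chi(\alpha),s_i^\chi(\beta))$. Write $\chi\sim\chi'$ if $\chi'$ is obtained from $\chi$ by finitely many (possibly zero) successive operations $\tau_i$, each being defined at the bi-homomorphism to which it is applied. Write $\chi\equiv\chi'$ if $\chi(\alpha_i,\alpha_i)=\chi'(\alpha_i,\alpha_i)$ and $\chi(\alpha_i,\alpha_j)\chi(\alpha_j,\alpha_i)=\chi'(\alpha_i,\alpha_j)\chi'(\alpha_j,\alpha_i)$ for all $i,j$. Write $\chi\approx\chi'$ if there are bi-homomorphisms $\chi_1,\chi_2$ and a bijection $g:I\to I$ with $\chi\sim\chi_1\equiv\chi_2$ and $\chi'(\alpha_i,\alpha_j)=\chi_2(\alpha_{g(i)},\alpha_{g(j)})$ for all $i,j\in I$. Cartan type: $\chi'$ is of Cartan type if there are $\hat q\in\mathbb{K}^\times_\infty$ and an irreducible finite crystallographic reduced root system of rank $N$ with simple roots $\hat\alpha_1,\dots,\hat\alpha_N$ (Bourbaki numbering, except that in type $F_4$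 the long simple roots are $\hat\alpha_1,\hat\alpha_2$ and the short ones $\hat\alpha_3,\hat\alpha_4$), of type $A_N$ ($N\ge1$), $B_N$ ($N\ge2$), $C_N$ ($N\ge3$), $D_N$ ($N\ge4$), $E_6,E_7,E_8,F_4$ or $G_2$, with invariant form $(\,,\,)$ normalized so that $(\hat\alpha,\hat\alpha)=2$ for all roots in types $A,D,E$, and $(\hat\alpha,\hat\alpha)$ for short/long roots equals $1/2$ in the sense of values $1$ and $2$ for $B_N$ and $F_4$, values $2$ and $4$ for $C_N$, values $2$ and $6$ for $G_2$, such that $\chi'(\alpha_i,\alpha_i)=\hat q^{(\hat\alpha_i,\hat\alpha_i)}$ and $\chi'(\alpha_i,\alpha_j)\chi'(\alpha_j,\alpha_i)=\hat q^{2(\hat\alpha_i,\hat\alpha_j)}$ for all $i\neq j$. Generalized quantum group $U(\chi)$: $\tilde U=\tilde U(\chi)$ is the unital associative $\mathbb{K}$-algebra with generators $\tilde K_\alpha,\tilde L_\alpha$ ($\alpha\in\mathbb{Z}\Pi$), $\tilde E_i,\tilde F_i$ ($i\in I$) and relations $\tilde K_0=\tilde L_0=1$, $\tilde K_\alpha\tilde K_\beta=\tilde K_{\alpha+\beta}$, $\tilde L_\alpha\tilde L_\beta=\tilde L_{\alpha+\beta}$, $\tilde K_\alpha\tilde L_\beta=\tilde L_\beta\tilde K_\alpha$, $\tilde K_\alpha\tilde E_i=\chi(\alpha,\alpha_i)\tilde E_i\tilde K_\alpha$, $\tilde L_\alpha\tilde E_i=\chi(-\alpha_i,\alpha)\tilde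 E_i\tilde L_\alpha$, $\tilde K_\alpha\tilde F_i=\chi(\alpha,-\alpha_i)\tilde F_i\tilde K_\alpha$, $\tilde L_\alpha\tilde F_i=\chi(\alpha_i,\alpha)\tilde F_i\tilde L_\alpha$, $\tilde E_i\tilde F_j-\tilde F_j\tilde E_i=\delta_{ij}(-\tilde K_{\alpha_i}+\tilde L_{\alpha_i})$. It is $\mathbb{Z}\Pi$-graded with $\tilde K_\alpha,\tilde L_\alpha$ in degree $0$, $\tilde E_i$ in degree $\alpha_i$, $\tilde F_i$ in degree $-\alpha_i$. $\tilde U^0,\tilde U^+,\tilde U^-$ are the unital subalgebras generated by the $\tilde K_\alpha,\tilde L_\alpha$, by the $\tilde E_i$, and by the $\tilde F_i$. Define subspaces $\tilde{\mathcal I}^-_{-\alpha}\subseteq\tilde U^-_{-\alpha}$ ($\alpha\in\mathbb{Z}_{\ge0}\Pi$) inductively: $\tilde{\mathcal I}^-_0=0$ and, for $\alpha\ne0$, $\tilde{\mathcal I}^-_{-\alpha}$ is the set of $Y\in\tilde U^-_{-\alpha}$ with $[\tilde E_i,Y]\in\tilde{\mathcal I}^-_{-\alpha+\alpha_i}\tilde K_{\alpha_i}+\tilde{\mathcal I}^-_{-\alpha+\alpha_i}\tilde L_{\alpha_i}$ for all $i$ with $\alpha-\alpha_i\in\mathbb{Z}_{\ge0}\Pi$. Put $\tilde{\mathcal I}^-=\bigoplus_\alpha\tilde{\mathcal I}^-_{-\alpha}$ and $\tilde{\mathcal J}^-=\mathrm{Span}_{\mathbb{K}}(\tilde{\mathcal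 I}^-\tilde U^0\tilde U^+)$ (an ideal). Let $\tilde\Omega$ be the algebra automorphism of $\tilde U$ with $\tilde K_\alpha\mapsto\tilde K_{-\alpha}$, $\tilde L_\alpha\mapsto\tilde L_{-\alpha}$, $\tilde E_i\mapsto\tilde F_i\tilde L_{-\alpha_i}$, $\tilde F_i\mapsto\tilde K_{-\alpha_i}\tilde E_i$. Then $U(\chi)=\tilde U/(\tilde{\mathcal J}^-+\tilde\Omega(\tilde{\mathcal J}^-))$. Images of generators are written $K_\alpha,L_\alpha,E_i,F_i$; $U^0(\chi),U^\pm(\chi)$ are the images of $\tilde U^0,\tilde U^\pm$. Multiplication $U^-\otimes U^0\otimes U^+\to U$ is a linear isomorphism and the $K_\alpha L_\beta$ form a basis of $U^0$. Highest weight modules: $\mathrm{Ch}(U^0(\chi))$ is the set of unital $\mathbb{K}$-algebra homomorphisms $U^0(\chi)\to\mathbb{K}$. For $\Lambda\in\mathrm{Ch}(U^0(\chi))$, $\mathcal{M}_\chi(\Lambda)$ is the Verma module: generated by $\tilde v_\Lambda\neq0$ with $Z\tilde v_\Lambda=\Lambda(Z)\tilde v_\Lambda$ ($Z\in U^0$), $E_i\tilde v_\Lambda=0$ ($i\in I$), and $U^-\to\mathcal{M}_\chi(\Lambda)$, $Y\mapsto Y\tilde v_\Lambda$ bijective; it is graded by $\mathcal{M}_\chi(\Lambda)_\alpha=U^-_\alpha\tilde v_\Lambda$. $\mathcal{L}_\chi(\Lambda)$ is the quotient of $\mathcal{M}_\chi(\Lambda)$ by its maximal proper $\mathbb{Z}\Pi$-graded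 submodule. *)

theory Defs
  imports
    "HOL-Library.Poly_Mapping"
    "HOL-Library.Cardinality"
    "HOL-Analysis.Finite_Cartesian_Product"
    "HOL-Algebra.QuotRing"
    "HOL-Algebra.Module"
    "HOL-Algebra.Generated_Rings"
begin

text \<open>
  The index set \<open>I = {1, ..., N}\<close> is a finite linearly ordered type \<open>'n\<close> with \<open>N = CARD('n)\<close>;
  \<open>index_of i\<close> below is the position of \<open>i\<close>, and is only used to fix the numbering of Dynkin
  diagrams. The lattice spanned by \<open>\<Pi>\<close> is \<open>'n \<Rightarrow>\<^sub>0 int\<close>.
\<close>


section \<open>Bi-homomorphisms\<close>

type_synonym 'n lattice = "'n \<Rightarrow>\<^sub>0 int"
type_synonym ('k, 'n) bichar = "'n lattice \<Rightarrow> 'n lattice \<Rightarrow> 'k"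

definition alpha :: "'n \<Rightarrow> 'n lattice" (\<open>\<alpha>\<close>)
  where "\<alpha> i = Poly_Mapping.single i 1"

definition nonneg :: "'n lattice \<Rightarrow> bool"
  where "nonneg a \<longleftrightarrow> (\<forall>i. 0 \<le> Poly_Mapping.lookup a i)"

definition bihom :: "('k::field, 'n) bichar \<Rightarrow> bool"
  where "bihom chi \<longleftrightarrow>
    (\<forall>a b. chi a b \<noteq> 0) \<and>
    (\<forall>a b c. chi a (b + c) = chi a b * chi a c) \<and>
    (\<forall>a b c. chi (a + b) c = chi a c * chi b c)"

definition qnum :: "nat \<Rightarrow> 'k::field \<Rightarrow> 'k"
  where "qnum m t = (\<Sum>j<m. t ^ j)"

definition qfact :: "nat \<Rightarrow> 'k::field \<Rightarrow> 'k"
  where "qfact m t = (\<Prod>j=1..m. qnum j t)"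

definition qpoch :: "nat \<Rightarrow> 'k::field \<Rightarrow> 'k \<Rightarrow> 'k"
  where "qpoch m t1 t2 = (\<Prod>j=1..m. 1 - t1 ^ (j - 1) * t2)"

definition c_set :: "('k::field, 'n) bichar \<Rightarrow> 'n \<Rightarrow> 'n \<Rightarrow> nat set"
  where "c_set chi i j =
    {m. qfact m (chi (\<alpha> i) (\<alpha> i)) *
        qpoch m (chi (\<alpha> i) (\<alpha> i)) (chi (\<alpha> i) (\<alpha> j) * chi (\<alpha> j) (\<alpha> i)) \<noteq> 0}"

text \<open>
  \<open>c_set chi i j\<close> contains \<open>0\<close> and is closed downwards, so it is either everything (the case
  \<open>c = -\<infinity>\<close>) or finite. \<open>c_entry\<close> is only meaningful if \<open>c_finite\<close> holds.
\<close>

definition c_finite :: "('k::field, 'n) bichar \<Rightarrow> 'n \<Rightarrow> 'n \<Rightarrow> bool"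
  where "c_finite chi i j \<longleftrightarrow> i = j \<or> c_set chi i j \<noteq> UNIV"

definition c_entry :: "('k::field, 'n) bichar \<Rightarrow> 'n \<Rightarrow> 'n \<Rightarrow> int"
  where "c_entry chi i j = (if i = j then 2 else - int (Max (c_set chi i j)))"

text \<open>The \<open>\<int>\<close>-linear map with \<open>\<alpha> j \<mapsto> \<alpha> j - c i j \<alpha> i\<close>.\<close>

definition s_map :: "('k::field, 'n::finite) bichar \<Rightarrow> 'n \<Rightarrow> 'n lattice \<Rightarrow> 'n lattice"
  where "s_map chi i a =
    (\<Sum>j\<in>UNIV. Poly_Mapping.single j (Poly_Mapping.lookup a j)
             - Poly_Mapping.single i (Poly_Mapping.lookup a j * c_entry chi i j))"

definition tau :: "'n \<Rightarrow> ('k::field, 'n::finite) bichar \<Rightarrow> ('k, 'n) bichar"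
  where "tau i chi = (\<lambda>a b. chi (s_map chi i a) (s_map chi i b))"

definition tau_defined :: "'n \<Rightarrow> ('k::field, 'n) bichar \<Rightarrow> bool"
  where "tau_defined i chi \<longleftrightarrow> (\<forall>j. c_finite chi i j)"

inductive weyl_rel :: "('k::field, 'n::finite) bichar \<Rightarrow> ('k, 'n) bichar \<Rightarrow> bool" for chi
  where
    refl: "weyl_rel chi chi"
  | step: "weyl_rel chi chi' \<Longrightarrow> tau_defined i chi' \<Longrightarrow> weyl_rel chi (tau i chi')"

definition twist_rel :: "('k::field, 'n) bichar \<Rightarrow> ('k, 'n) bichar \<Rightarrow> bool"
  where "twist_rel chi chi' \<longleftrightarrow>
    (\<forall>i. chi (\<alpha> i) (\<alpha> i) = chi' (\<alpha> i) (\<alpha> i)) \<and>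
    (\<forall>i j. chi (\<alpha> i) (\<alpha> j) * chi (\<alpha> j) (\<alpha> i) = chi' (\<alpha> i) (\<alpha> j) * chi' (\<alpha> j) (\<alpha> i))"

definition approx_rel :: "('k::field, 'n::finite) bichar \<Rightarrow> ('k, 'n) bichar \<Rightarrow> bool"
  where "approx_rel chi chi' \<longleftrightarrow>
    (\<exists>chi1 chi2 g. bihom chi1 \<and> bihom chi2 \<and> bij g \<and>
      weyl_rel chi chi1 \<and> twist_rel chi1 chi2 \<and>
      (\<forall>i j. chi' (\<alpha> i) (\<alpha> j) = chi2 (\<alpha> (g i)) (\<alpha> (g j))))"


section \<open>Root systems and Cartan type\<close>

text \<open>
  A root system of rank \<open>N\<close> is placed in \<open>real ^ 'n\<close>, whose standard inner product is the
  invariant form: for an irreducible root system an invariant form with positive root norms is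
  positive definite, so this loses no generality.
\<close>

definition coroot_pairing :: "real ^ 'n \<Rightarrow> real ^ 'n \<Rightarrow> real"
  where "coroot_pairing x a = 2 * inner x a / inner a a"

definition root_system :: "(real ^ 'n) set \<Rightarrow> bool"
  where "root_system R \<longleftrightarrow>
    finite R \<and> 0 \<notin> R \<and> span R = UNIV \<and>
    (\<forall>a\<in>R. \<forall>b\<in>R. b - coroot_pairing b a *\<^sub>R a \<in> R)"

definition crystallographic :: "(real ^ 'n) set \<Rightarrow> bool"
  where "crystallographic R \<longleftrightarrow> (\<forall>a\<in>R. \<forall>b\<in>R. coroot_pairing b a \<in> \<int>)"

definition reduced :: "(real ^ 'n) set \<Rightarrow> bool"
  where "reduced R \<longleftrightarrow> (\<forall>a\<in>R. \<forall>c. c *\<^sub>R a \<in> R \<longrightarrow> c = 1 \<or> c = -1)"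

definition irreducible_roots :: "(real ^ 'n) set \<Rightarrow> bool"
  where "irreducible_roots R \<longleftrightarrow> R \<noteq> {} \<and>
    \<not> (\<exists>R1 R2. R1 \<noteq> {} \<and> R2 \<noteq> {} \<and> R1 \<union> R2 = R \<and> R1 \<inter> R2 = {} \<and>
        (\<forall>a\<in>R1. \<forall>b\<in>R2. inner a b = 0))"

definition simple_roots :: "(real ^ 'n) set \<Rightarrow> ('n \<Rightarrow> real ^ 'n) \<Rightarrow> bool"
  where "simple_roots R s \<longleftrightarrow>
    inj s \<and> range s \<subseteq> R \<and> independent (range s) \<and>
    (\<forall>a\<in>R. \<exists>m :: 'n \<Rightarrow> int. ((\<forall>i. 0 \<le> m i) \<or> (\<forall>i. m i \<le> 0)) \<and>
      a = (\<Sum>i\<in>UNIV. of_int (m i) *\<^sub>R s i))"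

datatype dynkin = Type_A | Type_B | Type_C | Type_D | Type_E | Type_F | Type_G

fun valid_rank :: "dynkin \<Rightarrow> nat \<Rightarrow> bool"
  where
    "valid_rank Type_A N \<longleftrightarrow> 1 \<le> N"
  | "valid_rank Type_B N \<longleftrightarrow> 2 \<le> N"
  | "valid_rank Type_C N \<longleftrightarrow> 3 \<le> N"
  | "valid_rank Type_D N \<longleftrightarrow> 4 \<le> N"
  | "valid_rank Type_E N \<longleftrightarrow> 6 \<le> N \<and> N \<le> 8"
  | "valid_rank Type_F N \<longleftrightarrow> N = 4"
  | "valid_rank Type_G N \<longleftrightarrow> N = 2"

text \<open>Edges \<open>{k, l}\<close>, \<open>k < l\<close>, of the Dynkin diagram on \<open>{1..N}\<close> in Bourbaki's numbering.\<close>

fun dynkin_edge :: "dynkin \<Rightarrow> nat \<Rightarrow> nat \<Rightarrow> nat \<Rightarrow> bool"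
  where
    "dynkin_edge Type_D N k l \<longleftrightarrow> (l = k + 1 \<and> l < N) \<or> (k + 2 = N \<and> l = N)"
  | "dynkin_edge Type_E N k l \<longleftrightarrow>
      (k = 1 \<and> l = 3) \<or> (k = 2 \<and> l = 4) \<or> (3 \<le> k \<and> l = k + 1)"
  | "dynkin_edge T N k l \<longleftrightarrow> l = k + 1"

text \<open>
  \<open>cartan_integer T N k l\<close> is the value of \<open>2 (\<alpha>\<^sub>k, \<alpha>\<^sub>l) / (\<alpha>\<^sub>l, \<alpha>\<^sub>l)\<close>. The entries \<open>-2\<close>, \<open>-3\<close> have
  \<open>\<alpha>\<^sub>k\<close> long and \<open>\<alpha>\<^sub>l\<close> short: \<open>\<alpha>\<^sub>N\<close> is the short simple root in type \<open>B\<close> and the long one in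
  type \<open>C\<close>, in type \<open>F\<close> the first two are long, in type \<open>G\<close> the first one is short.
\<close>

definition cartan_integer :: "dynkin \<Rightarrow> nat \<Rightarrow> nat \<Rightarrow> nat \<Rightarrow> int"
  where "cartan_integer T N k l =
    (if k = l then 2
     else if \<not> dynkin_edge T N k l \<and> \<not> dynkin_edge T N l k then 0
     else if T = Type_B \<and> k + 1 = N \<and> l = N then -2
     else if T = Type_C \<and> k = N \<and> l + 1 = N then -2
     else if T = Type_F \<and> k = 2 \<and> l = 3 then -2
     else if T = Type_G \<and> k = 2 \<and> l = 1 then -3
     else -1)"

fun root_norms :: "dynkin \<Rightarrow> real set"
  where
    "root_norms Type_A = {2}"
  | "root_norms Type_B = {1, 2}"
  | "root_norms Type_C = {2, 4}"
  | "root_norms Type_D = {2}"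
  | "root_norms Type_E = {2}"
  | "root_norms Type_F = {1, 2}"
  | "root_norms Type_G = {2, 6}"

definition index_of :: "'n::{finite,linorder} \<Rightarrow> nat"
  where "index_of i = card {j. j \<le> i}"

definition normalized_root_system ::
    "dynkin \<Rightarrow> (real, 'n::{finite,linorder}) vec set \<Rightarrow> ('n \<Rightarrow> (real, 'n) vec) \<Rightarrow> bool"
  where "normalized_root_system T R s \<longleftrightarrow>
    root_system R \<and> crystallographic R \<and> reduced R \<and> irreducible_roots R \<and>
    simple_roots R s \<and>
    valid_rank T CARD('n) \<and>
    (\<forall>i j. coroot_pairing (s i) (s j) =
       of_int (cartan_integer T CARD('n) (index_of i) (index_of j))) \<and>
    (\<forall>a\<in>R. inner a a \<in> root_norms T)"

definition root_of_unity :: "'k::field \<Rightarrow> bool"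
  where "root_of_unity q \<longleftrightarrow> (\<exists>n>0. q ^ n = 1)"

text \<open>The floors below are taken of integers.\<close>

definition cartan_type :: "('k::field, 'n::{finite,linorder}) bichar \<Rightarrow> bool"
  where "cartan_type chi \<longleftrightarrow>
    (\<exists>q T R (s :: 'n \<Rightarrow> (real, 'n) vec).
      q \<noteq> 0 \<and> \<not> root_of_unity q \<and> normalized_root_system T R s \<and>
      (\<forall>i. chi (\<alpha> i) (\<alpha> i) = q powi \<lfloor>inner (s i) (s i)\<rfloor>) \<and>
      (\<forall>i j. i \<noteq> j \<longrightarrow>
        chi (\<alpha> i) (\<alpha> j) * chi (\<alpha> j) (\<alpha> i) = q powi \<lfloor>2 * inner (s i) (s j)\<rfloor>))"


section \<open>Free algebras\<close>

text \<open>
  The free unital algebra on \<open>'g\<close> is the monoid algebra of the monoid of words.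
\<close>

datatype 'a free_monoid = Word (letters: "'a list")

instantiation free_monoid :: (type) monoid_add
begin

definition zero_free_monoid :: "'a free_monoid"
  where "0 = Word []"

definition plus_free_monoid :: "'a free_monoid \<Rightarrow> 'a free_monoid \<Rightarrow> 'a free_monoid"
  where "u + v = Word (letters u @ letters v)"

instance
  by standard (simp_all add: zero_free_monoid_def plus_free_monoid_def)

end

type_synonym ('k, 'g) free_algebra = "'g free_monoid \<Rightarrow>\<^sub>0 'k"

definition var :: "'g \<Rightarrow> ('k::field, 'g) free_algebra"
  where "var g = Poly_Mapping.single (Word [g]) 1"

definition const :: "'k \<Rightarrow> ('k::field, 'g) free_algebra"
  where "const c = Poly_Mapping.single 0 c"

definition ring_of_type :: "'a::ring_1 ring"
  where "ring_of_type = \<lparr>carrier = UNIV, mult = (*), one = 1, zero = 0, add = (+)\<rparr>"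


section \<open>Linear spans and quotient modules\<close>

text \<open>\<open>act c\<close> is the multiplication by the scalar \<open>c\<close>.\<close>

inductive_set lin_span :: "('v, 'm) ring_scheme \<Rightarrow> ('k \<Rightarrow> 'v \<Rightarrow> 'v) \<Rightarrow> 'v set \<Rightarrow> 'v set"
  for V act S
  where
    zero: "\<zero>\<^bsub>V\<^esub> \<in> lin_span V act S"
  | add: "x \<in> lin_span V act S \<Longrightarrow> y \<in> S \<Longrightarrow> x \<oplus>\<^bsub>V\<^esub> act c y \<in> lin_span V act S"

text \<open>
  Left modules over a possibly noncommutative ring are \<open>module\<close> records; their multiplicative
  ring part carries no information. The library's \<open>submodule\<close> does not require commutativity.
\<close>

definition regular_module :: "('a, 'b) ring_scheme \<Rightarrow> ('a, 'a) module"
  where "regular_module A =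
    \<lparr>carrier = carrier A, mult = undefined, one = undefined, zero = \<zero>\<^bsub>A\<^esub>, add = add A,
     smult = mult A\<rparr>"

definition generated_submodule ::
    "('a, 'b) ring_scheme \<Rightarrow> ('a, 'v, 'm) module_scheme \<Rightarrow> 'v set \<Rightarrow> 'v set"
  where "generated_submodule A M S = \<Inter>{H. submodule H A M \<and> S \<subseteq> H}"

definition quotient_module ::
    "('a, 'v, 'm) module_scheme \<Rightarrow> 'v set \<Rightarrow> ('a, 'v set) module"
  where "quotient_module M H =
    \<lparr>carrier = a_rcosets\<^bsub>M\<^esub> H, mult = undefined, one = undefined, zero = H, add = set_add M,
     smult = (\<lambda>a X. \<Union>x\<in>X. H +>\<^bsub>M\<^esub> (a \<odot>\<^bsub>M\<^esub> x))\<rparr>"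


section \<open>The algebra before factoring out the radicals\<close>

datatype 'n generator =
  Gen_K "'n lattice" | Gen_L "'n lattice" | Gen_E 'n | Gen_F 'n

type_synonym ('k, 'n) free_gen = "('k, 'n generator) free_algebra"

definition relators :: "('k::field, 'n) bichar \<Rightarrow> ('k, 'n) free_gen set"
  where "relators chi =
    {var (Gen_K 0) - 1, var (Gen_L 0) - 1}
    \<union> {var (Gen_K a) * var (Gen_K b) - var (Gen_K (a + b)) | a b. True}
    \<union> {var (Gen_L a) * var (Gen_L b) - var (Gen_L (a + b)) | a b. True}
    \<union> {var (Gen_K a) * var (Gen_L b) - var (Gen_L b) * var (Gen_K a) | a b. True}
    \<union> {var (Gen_K a) * var (Gen_E i)
         - const (chi a (\<alpha> i)) * var (Gen_E i) * var (Gen_K a) | a i. True}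
    \<union> {var (Gen_L a) * var (Gen_E i)
         - const (chi (- \<alpha> i) a) * var (Gen_E i) * var (Gen_L a) | a i. True}
    \<union> {var (Gen_K a) * var (Gen_F i)
         - const (chi a (- \<alpha> i)) * var (Gen_F i) * var (Gen_K a) | a i. True}
    \<union> {var (Gen_L a) * var (Gen_F i)
         - const (chi (\<alpha> i) a) * var (Gen_F i) * var (Gen_L a) | a i. True}
    \<union> {var (Gen_E i) * var (Gen_F j) - var (Gen_F j) * var (Gen_E i)
         - (if i = j then - var (Gen_K (\<alpha> i)) + var (Gen_L (\<alpha> i)) else 0) | i j. True}"

type_synonym ('k, 'n) Ut_elem = "('k, 'n) free_gen set"

definition Ut_ideal :: "('k::field, 'n) bichar \<Rightarrow> ('k, 'n) free_gen set"
  where "Ut_ideal chi = Idl\<^bsub>ring_of_type\<^esub> (relators chi)"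

definition Ut :: "('k::field, 'n) bichar \<Rightarrow> ('k, 'n) Ut_elem ring"
  where "Ut chi = ring_of_type Quot Ut_ideal chi"

definition Ut_class :: "('k::field, 'n) bichar \<Rightarrow> ('k, 'n) free_gen \<Rightarrow> ('k, 'n) Ut_elem"
  where "Ut_class chi x = Ut_ideal chi +>\<^bsub>ring_of_type\<^esub> x"

definition Kt :: "('k::field, 'n) bichar \<Rightarrow> 'n lattice \<Rightarrow> ('k, 'n) Ut_elem"
  where "Kt chi a = Ut_class chi (var (Gen_K a))"

definition Lt :: "('k::field, 'n) bichar \<Rightarrow> 'n lattice \<Rightarrow> ('k, 'n) Ut_elem"
  where "Lt chi a = Ut_class chi (var (Gen_L a))"

definition Et :: "('k::field, 'n) bichar \<Rightarrow> 'n \<Rightarrow> ('k, 'n) Ut_elem"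
  where "Et chi i = Ut_class chi (var (Gen_E i))"

definition Ft :: "('k::field, 'n) bichar \<Rightarrow> 'n \<Rightarrow> ('k, 'n) Ut_elem"
  where "Ft chi i = Ut_class chi (var (Gen_F i))"

definition Ut_const :: "('k::field, 'n) bichar \<Rightarrow> 'k \<Rightarrow> ('k, 'n) Ut_elem"
  where "Ut_const chi c = Ut_class chi (const c)"

definition Ut_span :: "('k::field, 'n) bichar \<Rightarrow> ('k, 'n) Ut_elem set \<Rightarrow> ('k, 'n) Ut_elem set"
  where "Ut_span chi = lin_span (Ut chi) (\<lambda>c x. Ut_const chi c \<otimes>\<^bsub>Ut chi\<^esub> x)"

text \<open>Unital subalgebras are the subrings containing the scalars.\<close>

definition Ut_subalgebra ::
    "('k::field, 'n) bichar \<Rightarrow> ('k, 'n) Ut_elem set \<Rightarrow> ('k, 'n) Ut_elem set"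
  where "Ut_subalgebra chi S = generate_ring (Ut chi) (range (Ut_const chi) \<union> S)"

definition Ut_zero :: "('k::field, 'n) bichar \<Rightarrow> ('k, 'n) Ut_elem set"
  where "Ut_zero chi = Ut_subalgebra chi (range (Kt chi) \<union> range (Lt chi))"

definition Ut_plus :: "('k::field, 'n) bichar \<Rightarrow> ('k, 'n) Ut_elem set"
  where "Ut_plus chi = Ut_subalgebra chi (range (Et chi))"

definition Ut_minus :: "('k::field, 'n) bichar \<Rightarrow> ('k, 'n) Ut_elem set"
  where "Ut_minus chi = Ut_subalgebra chi (range (Ft chi))"

fun gen_degree :: "'n generator \<Rightarrow> 'n lattice"
  where
    "gen_degree (Gen_K a) = 0"
  | "gen_degree (Gen_L a) = 0"
  | "gen_degree (Gen_E i) = \<alpha> i"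
  | "gen_degree (Gen_F i) = - \<alpha> i"

definition word_degree :: "'n generator free_monoid \<Rightarrow> 'n lattice"
  where "word_degree w = (\<Sum>g\<leftarrow>letters w. gen_degree g)"

definition Ut_degree :: "('k::field, 'n) bichar \<Rightarrow> 'n lattice \<Rightarrow> ('k, 'n) Ut_elem set"
  where "Ut_degree chi b =
    Ut_class chi ` {x. \<forall>w \<in> Poly_Mapping.keys x. word_degree w = b}"

text \<open>
  \<open>It_minus chi a\<close> is the component of degree \<open>-a\<close>. Outside the non-negative lattice, where it is
  not used, it is put to \<open>{0}\<close>.
\<close>

function It_minus :: "('k::field, 'n::finite) bichar \<Rightarrow> 'n lattice \<Rightarrow> ('k, 'n) Ut_elem set"
  where
    "It_minus chi a =
      (if a = 0 \<or> \<not> nonneg a then {\<zero>\<^bsub>Ut chi\<^esub>}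
       else {Y \<in> Ut_minus chi \<inter> Ut_degree chi (- a).
         \<forall>i. nonneg (a - \<alpha> i) \<longrightarrow>
           (Et chi i \<otimes>\<^bsub>Ut chi\<^esub> Y) \<ominus>\<^bsub>Ut chi\<^esub> (Y \<otimes>\<^bsub>Ut chi\<^esub> Et chi i) \<in>
             (\<lambda>Z. Z \<otimes>\<^bsub>Ut chi\<^esub> Kt chi (\<alpha> i)) ` It_minus chi (a - \<alpha> i)
             <+>\<^bsub>Ut chi\<^esub>
             (\<lambda>Z. Z \<otimes>\<^bsub>Ut chi\<^esub> Lt chi (\<alpha> i)) ` It_minus chi (a - \<alpha> i)})"
  by pat_completeness auto
termination
proof (relation "measure (\<lambda>(chi, a). nat (\<Sum>i\<in>UNIV. Poly_Mapping.lookup a i))", goal_cases)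
  case 1
  then show ?case by simp
next
  case (2 chi a Y i)
  then have "0 \<le> (\<Sum>j\<in>UNIV. Poly_Mapping.lookup (a - \<alpha> i) j)"
    by (intro sum_nonneg) (simp add: nonneg_def)
  moreover have "(\<Sum>j\<in>UNIV. Poly_Mapping.lookup (a - \<alpha> i) j)
      = (\<Sum>j\<in>UNIV. Poly_Mapping.lookup a j) - 1"
    by (simp add: alpha_def lookup_minus sum_subtractf lookup_single when_def)
  ultimately show ?case by simp
next
  case (3 chi a Y i)
  then have "0 \<le> (\<Sum>j\<in>UNIV. Poly_Mapping.lookup (a - \<alpha> i) j)"
    by (intro sum_nonneg) (simp add: nonneg_def)
  moreover have "(\<Sum>j\<in>UNIV. Poly_Mapping.lookup (a - \<alpha> i) j)
      = (\<Sum>j\<in>UNIV. Poly_Mapping.lookup a j) - 1"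
    by (simp add: alpha_def lookup_minus sum_subtractf lookup_single when_def)
  ultimately show ?case by simp
qed

declare It_minus.simps [simp del]

definition It_minus_total :: "('k::field, 'n::finite) bichar \<Rightarrow> ('k, 'n) Ut_elem set"
  where "It_minus_total chi = Ut_span chi (\<Union>a\<in>{a. nonneg a}. It_minus chi a)"

definition Jt_minus :: "('k::field, 'n::finite) bichar \<Rightarrow> ('k, 'n) Ut_elem set"
  where "Jt_minus chi = Ut_span chi
    {Y \<otimes>\<^bsub>Ut chi\<^esub> Z \<otimes>\<^bsub>Ut chi\<^esub> X | Y Z X.
      Y \<in> It_minus_total chi \<and> Z \<in> Ut_zero chi \<and> X \<in> Ut_plus chi}"

text \<open>On the carrier, the automorphism is unique because the generators determine it.\<close>

definition is_Omega :: "('k::field, 'n) bichar \<Rightarrow> (('k, 'n) Ut_elem \<Rightarrow> ('k, 'n) Ut_elem) \<Rightarrow> bool"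
  where "is_Omega chi f \<longleftrightarrow>
    f \<in> ring_iso (Ut chi) (Ut chi) \<and>
    (\<forall>c. f (Ut_const chi c) = Ut_const chi c) \<and>
    (\<forall>a. f (Kt chi a) = Kt chi (- a)) \<and>
    (\<forall>a. f (Lt chi a) = Lt chi (- a)) \<and>
    (\<forall>i. f (Et chi i) = Ft chi i \<otimes>\<^bsub>Ut chi\<^esub> Lt chi (- \<alpha> i)) \<and>
    (\<forall>i. f (Ft chi i) = Kt chi (- \<alpha> i) \<otimes>\<^bsub>Ut chi\<^esub> Et chi i)"

definition Omega :: "('k::field, 'n) bichar \<Rightarrow> ('k, 'n) Ut_elem \<Rightarrow> ('k, 'n) Ut_elem"
  where "Omega chi = (SOME f. is_Omega chi f)"


section \<open>The generalized quantum group\<close>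

type_synonym ('k, 'n) U_elem = "('k, 'n) Ut_elem set"

definition U_ideal :: "('k::field, 'n::finite) bichar \<Rightarrow> ('k, 'n) Ut_elem set"
  where "U_ideal chi = Jt_minus chi <+>\<^bsub>Ut chi\<^esub> (Omega chi ` Jt_minus chi)"

definition U :: "('k::field, 'n::finite) bichar \<Rightarrow> ('k, 'n) U_elem ring"
  where "U chi = Ut chi Quot U_ideal chi"

definition U_class :: "('k::field, 'n::finite) bichar \<Rightarrow> ('k, 'n) Ut_elem \<Rightarrow> ('k, 'n) U_elem"
  where "U_class chi x = U_ideal chi +>\<^bsub>Ut chi\<^esub> x"

definition U_K :: "('k::field, 'n::finite) bichar \<Rightarrow> 'n lattice \<Rightarrow> ('k, 'n) U_elem"
  where "U_K chi a = U_class chi (Kt chi a)"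

definition U_L :: "('k::field, 'n::finite) bichar \<Rightarrow> 'n lattice \<Rightarrow> ('k, 'n) U_elem"
  where "U_L chi a = U_class chi (Lt chi a)"

definition U_E :: "('k::field, 'n::finite) bichar \<Rightarrow> 'n \<Rightarrow> ('k, 'n) U_elem"
  where "U_E chi i = U_class chi (Et chi i)"

definition U_const :: "('k::field, 'n::finite) bichar \<Rightarrow> 'k \<Rightarrow> ('k, 'n) U_elem"
  where "U_const chi c = U_class chi (Ut_const chi c)"

definition U_zero :: "('k::field, 'n::finite) bichar \<Rightarrow> ('k, 'n) U_elem set"
  where "U_zero chi = U_class chi ` Ut_zero chi"

definition U_minus :: "('k::field, 'n::finite) bichar \<Rightarrow> ('k, 'n) U_elem set"
  where "U_minus chi = U_class chi ` Ut_minus chi"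

definition U_degree :: "('k::field, 'n::finite) bichar \<Rightarrow> 'n lattice \<Rightarrow> ('k, 'n) U_elem set"
  where "U_degree chi b = U_class chi ` Ut_degree chi b"

text \<open>Only the values of a character on \<open>U_zero chi\<close> are relevant.\<close>

definition Ch :: "('k::field, 'n::finite) bichar \<Rightarrow> (('k, 'n) U_elem \<Rightarrow> 'k) set"
  where "Ch chi =
    {\<Lambda> \<in> ring_hom ((U chi)\<lparr>carrier := U_zero chi\<rparr>) ring_of_type. \<forall>c. \<Lambda> (U_const chi c) = c}"


section \<open>Highest weight modules\<close>

type_synonym ('k, 'n) verma_elem = "('k, 'n) U_elem set"
type_synonym ('k, 'n) irr_elem = "('k, 'n) verma_elem set"

text \<open>
  The Verma module is realized as the quotient of \<open>U chi\<close> by the left ideal generated by the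
  \<open>E\<^sub>i\<close> and the \<open>Z - \<Lambda> Z\<close>; its highest weight vector is the class of \<open>1\<close>.
\<close>

definition verma_ideal ::
    "('k::field, 'n::finite) bichar \<Rightarrow> (('k, 'n) U_elem \<Rightarrow> 'k) \<Rightarrow> ('k, 'n) U_elem set"
  where "verma_ideal chi \<Lambda> = generated_submodule (U chi) (regular_module (U chi))
    ({Z \<ominus>\<^bsub>U chi\<^esub> U_const chi (\<Lambda> Z) | Z. Z \<in> U_zero chi} \<union> range (U_E chi))"

definition verma :: "('k::field, 'n::finite) bichar \<Rightarrow> (('k, 'n) U_elem \<Rightarrow> 'k) \<Rightarrow>
    (('k, 'n) U_elem, ('k, 'n) verma_elem) module"
  where "verma chi \<Lambda> = quotient_module (regular_module (U chi)) (verma_ideal chi \<Lambda>)"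

definition verma_vec ::
    "('k::field, 'n::finite) bichar \<Rightarrow> (('k, 'n) U_elem \<Rightarrow> 'k) \<Rightarrow> ('k, 'n) verma_elem"
  where "verma_vec chi \<Lambda> = verma_ideal chi \<Lambda> +>\<^bsub>regular_module (U chi)\<^esub> \<one>\<^bsub>U chi\<^esub>"

definition verma_degree :: "('k::field, 'n::finite) bichar \<Rightarrow> (('k, 'n) U_elem \<Rightarrow> 'k) \<Rightarrow>
    'n lattice \<Rightarrow> ('k, 'n) verma_elem set"
  where "verma_degree chi \<Lambda> b =
    (\<lambda>Y. Y \<odot>\<^bsub>verma chi \<Lambda>\<^esub> verma_vec chi \<Lambda>) ` (U_minus chi \<inter> U_degree chi b)"

definition verma_span :: "('k::field, 'n::finite) bichar \<Rightarrow> (('k, 'n) U_elem \<Rightarrow> 'k) \<Rightarrow>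
    ('k, 'n) verma_elem set \<Rightarrow> ('k, 'n) verma_elem set"
  where "verma_span chi \<Lambda> =
    lin_span (verma chi \<Lambda>) (\<lambda>c m. U_const chi c \<odot>\<^bsub>verma chi \<Lambda>\<^esub> m)"

definition proper_graded_submodule :: "('k::field, 'n::finite) bichar \<Rightarrow>
    (('k, 'n) U_elem \<Rightarrow> 'k) \<Rightarrow> ('k, 'n) verma_elem set \<Rightarrow> bool"
  where "proper_graded_submodule chi \<Lambda> P \<longleftrightarrow>
    submodule P (U chi) (verma chi \<Lambda>) \<and> P \<noteq> carrier (verma chi \<Lambda>) \<and>
    P = verma_span chi \<Lambda> (\<Union>b. P \<inter> verma_degree chi \<Lambda> b)"

text \<open>The largest proper graded submodule is the sum of all proper graded submodules.\<close>

definition max_graded_submodule :: "('k::field, 'n::finite) bichar \<Rightarrow>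
    (('k, 'n) U_elem \<Rightarrow> 'k) \<Rightarrow> ('k, 'n) verma_elem set"
  where "max_graded_submodule chi \<Lambda> =
    verma_span chi \<Lambda> (\<Union>{P. proper_graded_submodule chi \<Lambda> P})"

definition irr :: "('k::field, 'n::finite) bichar \<Rightarrow> (('k, 'n) U_elem \<Rightarrow> 'k) \<Rightarrow>
    (('k, 'n) U_elem, ('k, 'n) irr_elem) module"
  where "irr chi \<Lambda> = quotient_module (verma chi \<Lambda>) (max_graded_submodule chi \<Lambda>)"

definition finite_dimensional :: "('k::field, 'n::finite) bichar \<Rightarrow>
    (('k, 'n) U_elem, 'v) module \<Rightarrow> bool"
  where "finite_dimensional chi M \<longleftrightarrow>
    (\<exists>B. finite B \<and> B \<subseteq> carrier M \<and>
      lin_span M (\<lambda>c m. U_const chi c \<odot>\<^bsub>M\<^esub> m) B = carrier M)"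

end

theory Submission
  imports Defs "HOL-Analysis.Linear_Algebra"
begin

text \<open>
  Let \<open>M\<close> be the Verma module of the algebra \<open>Ut\<close> without radicals: a free module over the words in the
  \<open>F\<^sub>i\<close>, on which the relations can be checked by hand. Let \<open>eps m\<close> be the coefficient of the highest
  weight vector \<open>v\<close> in \<open>m\<close>, and \<open>rad\<close> the space of all \<open>m\<close> with \<open>eps (x m) = 0\<close> for every \<open>x\<close>. Both \<open>J\<^sup>-\<close> and
  \<open>\<Omega>(J\<^sup>-)\<close> are killed by \<open>x \<mapsto> eps (x v)\<close>, hence \<open>irr\<close> is \<open>M / rad\<close>, and no triangular decomposition of \<open>U\<close>
  is needed.

  If \<open>q\<^sub>i\<^sub>i\<close> is not a root of unity, then \<open>\<tau>\<^sub>i\<close> does not change the twist class, so \<open>chi\<close> itself satisfies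
  \<open>q\<^sub>i\<^sub>j q\<^sub>j\<^sub>i = q\<^sub>i\<^sub>i\<close> to the power \<open>a\<^sub>i\<^sub>j\<close> for a Cartan matrix \<open>a\<close> realized by independent vectors \<open>s\<^sub>i\<close> in
  Euclidean space. Necessity is the rank one computation of \<open>E\<^sub>i F\<^sub>i\<^sup>m v\<close>. For sufficiency, the \<open>q\<close>-Serre
  elements commute with all \<open>E\<^sub>k\<close> and hence map \<open>M\<close> into \<open>rad\<close>, which makes every \<open>F\<^sub>i\<close> locally nilpotent on
  \<open>M / rad\<close>. The set of weights \<open>\<lambda> - b\<close> is then stable under reflections, and reflecting a weight towards
  the dominant chamber shows \<open>|\<lambda> - b|\<^sup>2 \<le> |\<lambda>|\<^sup>2\<close>. Only finitely many \<open>b\<close> in the lattice satisfy this.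
\<close>

section \<open>Free algebras as vector spaces\<close>

text \<open>\<open>Ut\<close>, \<open>U\<close>, the Verma module and \<open>irr\<close> are all
  quotients of one free algebra, so each is handled through its kernel there:
  \<open>Ut_ideal\<close>, \<open>UA\<close>, \<open>V\<close>, \<open>N0\<close>. The ideal
  \<open>\<Omega>(J^-)\<close> needs a different argument from \<open>J^-\<close>: it kills
  \<open>v\<close> only after the factors of \<open>J^-\<close> have been reversed, because then the
  image of an element of \<open>I^-\<close> is the first to act on \<open>v\<close>, and it ends in
  some \<open>E_i\<close>. The comparison with Cartan type runs backwards along the chain of
  operations \<open>\<tau>_i\<close>. Only at its end are the diagonal values known not to be roots
  of unity. As \<open>\<tau>_i\<close> fixes \<open>q_ii\<close>, this makes the last step harmless
  and carries the property to the member before it. Reflections are needed in one direction only. A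
  weight on the negative side of a wall is followed down to the end of its
  \<open>F_i\<close>-string, which exists by local nilpotence, and the string is then climbed with
  \<open>E_i\<close>; nilpotence of \<open>E_i\<close> on the quotient is automatic from the
  grading.\<close>

definition fscale :: "'k \<Rightarrow> ('k::field, 'g) free_algebra \<Rightarrow> ('k, 'g) free_algebra"
  where "fscale c x = const c * x"

definition mon :: "'g list \<Rightarrow> ('k::field, 'g) free_algebra"
  where "mon w = Poly_Mapping.single (Word w) 1"

lemma mon_Nil [simp]: "mon [] = 1"
  by (simp add: mon_def flip: zero_free_monoid_def)

lemma mon_append: "mon (u @ w) = mon u * mon w"
  by (simp add: mon_def mult_single plus_free_monoid_def)

lemma mon_Cons: "mon (g # w) = var g * mon w"
  using mon_append[of "[g]" w] by (simp add: var_def mon_def)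

lemma const_0 [simp]: "const 0 = 0"
  by (simp add: const_def)

lemma const_1 [simp]: "const 1 = 1"
  by (simp add: const_def)

lemma const_add: "const (c + d) = const c + const d"
  by (simp add: const_def single_add)

lemma const_mult: "const (c * d) = const c * const d"
  by (simp add: const_def mult_single)

lemma lookup_const_mult:
  "Poly_Mapping.lookup (const c * x) w = c * Poly_Mapping.lookup x w"
  unfolding const_def mult_map_scale_conv_mult[symmetric] by (simp add: map.rep_eq when_def)

lemma poly_mapping_sum_single:
  "x = (\<Sum>w\<in>Poly_Mapping.keys x. Poly_Mapping.single w (Poly_Mapping.lookup x w))"
proof (rule poly_mapping_eqI)
  fix w
  show "Poly_Mapping.lookup x w =
      Poly_Mapping.lookup (\<Sum>w\<in>Poly_Mapping.keys x. Poly_Mapping.single w (Poly_Mapping.lookup x w)) w"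
    by (simp add: lookup_sum lookup_single when_def in_keys_iff)
qed

lemma const_central: "x * const c = const c * x"
proof -
  have "x * const c = (\<Sum>w\<in>Poly_Mapping.keys x. Poly_Mapping.single w (Poly_Mapping.lookup x w) * const c)"
    by (subst poly_mapping_sum_single[of x]) (simp add: sum_distrib_right)
  also have "\<dots> = (\<Sum>w\<in>Poly_Mapping.keys x. const c * Poly_Mapping.single w (Poly_Mapping.lookup x w))"
    by (simp add: const_def mult_single mult.commute)
  also have "\<dots> = const c * x"
    by (simp flip: sum_distrib_left poly_mapping_sum_single)
  finally show ?thesis .
qed

lemma fscale_zero_left [simp]: "fscale 0 x = 0"
  and fscale_zero_right [simp]: "fscale c 0 = 0"
  and fscale_one [simp]: "fscale 1 x = x"
  by (simp_all add: fscale_def)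

lemma fscale_add_right: "fscale c (x + y) = fscale c x + fscale c y"
  and fscale_add_left: "fscale (c + d) x = fscale c x + fscale d x"
  and fscale_scale [simp]: "fscale c (fscale d x) = fscale (c * d) x"
  by (simp_all add: fscale_def const_add const_mult algebra_simps)

lemma fscale_mult_left [simp]: "fscale c x * y = fscale c (x * y)"
  by (simp add: fscale_def mult.assoc)

lemma fscale_mult_right [simp]: "x * fscale c y = fscale c (x * y)"
  by (metis const_central mult.assoc fscale_def)

lemma const_eq_scale: "const c = fscale c 1"
  by (simp add: fscale_def)

lemma lookup_fscale [simp]: "Poly_Mapping.lookup (fscale c x) w = c * Poly_Mapping.lookup x w"
  by (simp add: fscale_def lookup_const_mult)

global_interpretation FA: vector_space "fscale :: 'k \<Rightarrow> ('k::field, 'g) free_algebra \<Rightarrow> _"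
  by unfold_locales (simp_all add: fscale_add_right fscale_add_left)

lemma span_mon: "FA.span (range mon) = UNIV"
proof -
  have "x \<in> FA.span (range mon)" for x :: "('k::field, 'g) free_algebra"
  proof -
    have "Poly_Mapping.single w c = fscale c (mon (letters w))" for w :: "'g free_monoid" and c :: 'k
      by (cases w) (simp add: fscale_def mon_def const_def mult_single)
    then show ?thesis
      by (subst poly_mapping_sum_single[of x], simp only:)
        (intro FA.span_sum FA.span_scale FA.span_base rangeI)
  qed
  then show ?thesis by auto
qed

lemma free_algebra_induct [case_names mon add scale]:
  assumes "\<And>w. P (mon w)" "\<And>x y. P x \<Longrightarrow> P y \<Longrightarrow> P (x + y)" "\<And>c x. P x \<Longrightarrow> P (fscale c x)"
  shows "P x"
proof (rule FA.span_induct[where S = "range mon" and P = P])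
  show "x \<in> FA.span (range mon)" by (simp add: span_mon)
  have "P 0" using assms(3)[of "mon []" 0] assms(1)[of "[]"] by (metis fscale_zero_left)
  then show "FA.subspace (Collect P)"
    using assms by (auto simp: FA.subspace_def)
qed (use assms in auto)

section \<open>Linear maps and module structures on free algebras\<close>

definition flin :: "(('k::field, 'g) free_algebra \<Rightarrow> ('k, 'h) free_algebra) \<Rightarrow> bool"
  where "flin f \<longleftrightarrow> (\<forall>x y. f (x + y) = f x + f y) \<and> (\<forall>c x. f (fscale c x) = fscale c (f x))"

lemma flinI: "(\<And>x y. f (x + y) = f x + f y) \<Longrightarrow> (\<And>c x. f (fscale c x) = fscale c (f x)) \<Longrightarrow> flin f"
  by (simp add: flin_def)

lemma flin_add: "flin f \<Longrightarrow> f (x + y) = f x + f y"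
  and flin_scale: "flin f \<Longrightarrow> f (fscale c x) = fscale c (f x)"
  by (simp_all add: flin_def)

lemma flin_0: "flin f \<Longrightarrow> f 0 = 0"
  using flin_scale[of f 0 0] by simp

lemma flin_uminus: "flin f \<Longrightarrow> f (- x) = - f x"
  using flin_add[of f x "- x"] flin_0[of f] by (simp add: eq_neg_iff_add_eq_0 add.commute)

lemma flin_diff: "flin f \<Longrightarrow> f (x - y) = f x - f y"
  using flin_add[of f x "- y"] by (simp add: flin_uminus)

lemma flin_sum: "flin f \<Longrightarrow> f (sum g S) = (\<Sum>a\<in>S. f (g a))"
  by (induction S rule: infinite_finite_induct) (simp_all add: flin_0 flin_add)

lemmas flin_simps = flin_add flin_scale flin_0 flin_uminus flin_diff

lemma flin_compose: "flin f \<Longrightarrow> flin g \<Longrightarrow> flin (\<lambda>x. f (g x))"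
  by (simp add: flin_def)

lemma flin_subspace: "flin f \<Longrightarrow> FA.subspace S \<Longrightarrow> FA.subspace {x. f x \<in> S}"
  by (auto simp: FA.subspace_def flin_simps)

lemma flin_span: "flin f \<Longrightarrow> f ` FA.span S = FA.span (f ` S)"
proof -
  assume f: "flin f"
  interpret module_hom fscale fscale f
    by unfold_locales (use f in \<open>simp_all add: flin_simps fscale_add_right fscale_add_left\<close>)
  show ?thesis by (simp add: span_image)
qed

text \<open>The linear extension of a map given on the basis of words.\<close>

definition lift :: "('g list \<Rightarrow> ('k::field, 'h) free_algebra) \<Rightarrow> ('k, 'g) free_algebra \<Rightarrow> ('k, 'h) free_algebra"
  where "lift f x = (\<Sum>w\<in>Poly_Mapping.keys x. fscale (Poly_Mapping.lookup x w) (f (letters w)))"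

lemma lift_superset:
  assumes "finite S" "Poly_Mapping.keys x \<subseteq> S"
  shows "lift f x = (\<Sum>w\<in>S. fscale (Poly_Mapping.lookup x w) (f (letters w)))"
  unfolding lift_def by (rule sum.mono_neutral_left) (use assms in \<open>auto simp: in_keys_iff\<close>)

lemma flin_lift:
  fixes f :: "'g list \<Rightarrow> ('k::field, 'h) free_algebra"
  shows "flin (lift f)"
proof (rule flinI)
  fix x y :: "('k, 'g) free_algebra"
  let ?S = "Poly_Mapping.keys x \<union> Poly_Mapping.keys y"
  have "lift f (x + y) = (\<Sum>w\<in>?S. fscale (Poly_Mapping.lookup (x + y) w) (f (letters w)))"
    by (rule lift_superset) (use keys_add[of x y] in auto)
  also have "\<dots> = (\<Sum>w\<in>?S. fscale (Poly_Mapping.lookup x w) (f (letters w)))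
      + (\<Sum>w\<in>?S. fscale (Poly_Mapping.lookup y w) (f (letters w)))"
    by (simp add: lookup_add fscale_add_left sum.distrib)
  also have "\<dots> = lift f x + lift f y"
    by (simp add: lift_superset[of ?S])
  finally show "lift f (x + y) = lift f x + lift f y" .
next
  fix c and x :: "('k, 'g) free_algebra"
  have "lift f (fscale c x) = (\<Sum>w\<in>Poly_Mapping.keys x. fscale (Poly_Mapping.lookup (fscale c x) w) (f (letters w)))"
    by (rule lift_superset) (auto simp: in_keys_iff)
  then show "lift f (fscale c x) = fscale c (lift f x)"
    by (simp add: lift_def FA.scale_sum_right)
qed

lemma lift_mon [simp]: "lift f (mon w) = f w"
  by (simp add: lift_def mon_def)

text \<open>The universal property of the free algebra: one linear operator per generator gives a
  left module. With \<open>foldr\<close> the last letter of a word acts first, as in a product of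
  operators.\<close>

definition act :: "('g \<Rightarrow> ('k::field, 'h) free_algebra \<Rightarrow> ('k, 'h) free_algebra) \<Rightarrow>
    ('k, 'g) free_algebra \<Rightarrow> ('k, 'h) free_algebra \<Rightarrow> ('k, 'h) free_algebra"
  where "act G x m = lift (\<lambda>w. foldr G w m) x"

lemma flin_act1: "flin (\<lambda>x. act G x m)"
  using flin_lift by (simp add: act_def flin_def)

lemmas act_simps = flin_simps[OF flin_act1]

lemma act_mon [simp]: "act G (mon w) m = foldr G w m"
  by (simp add: act_def)

lemma act_1 [simp]: "act G 1 m = m"
  using act_mon[of G "[]" m] by simp

lemma act_var [simp]: "act G (var g) m = G g m"
  using act_mon[of G "[g]" m] by (simp add: mon_Cons)

lemma act_const [simp]: "act G (const c) m = fscale c m"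
  by (simp add: const_eq_scale act_simps)

lemma flin_foldr: "(\<And>g. flin (G g)) \<Longrightarrow> flin (foldr G w)"
  by (induction w) (auto simp: flin_def)

lemma flin_act2:
  assumes "\<And>g. flin (G g)"
  shows "flin (act G x)"
  by (induction x rule: free_algebra_induct)
    (auto simp: flin_def act_simps flin_foldr[OF assms, unfolded flin_def] fscale_add_right
      mult.commute algebra_simps)

lemma act_mult:
  assumes "\<And>g. flin (G g)"
  shows "act G (x * y) m = act G x (act G y m)"
proof (induction x rule: free_algebra_induct)
  case (mon u)
  show ?case
  proof (induction y rule: free_algebra_induct)
    case (mon w)
    show ?case by (simp flip: mon_append)
  qed (simp_all add: distrib_left act_simps flin_simps[OF flin_foldr[OF assms]])
qed (simp_all add: distrib_right act_simps)

section \<open>Presentations of quotients\<close>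

text \<open>The additive structure of \<open>M\<close> is that of the type \<open>'a\<close> modulo \<open>K\<close>, via the projection \<open>p\<close>.\<close>

definition pres :: "('b, 'm) ring_scheme \<Rightarrow> ('a::ab_group_add \<Rightarrow> 'b) \<Rightarrow> 'a set \<Rightarrow> bool"
  where "pres M p K \<longleftrightarrow> carrier M = range p \<and> \<zero>\<^bsub>M\<^esub> = p 0 \<and>
    (\<forall>x y. p x \<oplus>\<^bsub>M\<^esub> p y = p (x + y)) \<and> (\<forall>x y. p x = p y \<longleftrightarrow> x - y \<in> K)"

definition pres_ring :: "('b, 'm) ring_scheme \<Rightarrow> ('a::ring_1 \<Rightarrow> 'b) \<Rightarrow> 'a set \<Rightarrow> bool"
  where "pres_ring M p K \<longleftrightarrow> pres M p K \<and> \<one>\<^bsub>M\<^esub> = p 1 \<and> (\<forall>x y. p x \<otimes>\<^bsub>M\<^esub> p y = p (x * y))"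

lemma pres_carrier: "pres M p K \<Longrightarrow> carrier M = range p"
  and pres_zero: "pres M p K \<Longrightarrow> \<zero>\<^bsub>M\<^esub> = p 0"
  and pres_add: "pres M p K \<Longrightarrow> p x \<oplus>\<^bsub>M\<^esub> p y = p (x + y)"
  and pres_eq: "pres M p K \<Longrightarrow> p x = p y \<longleftrightarrow> x - y \<in> K"
  by (simp_all add: pres_def)

text \<open>\<open>M\<close> is not known to be a group here, so the inverse is identified through
  its definite description and not by group laws.\<close>

lemma pres_a_inv: 
  assumes "pres M p K"
  shows "\<ominus>\<^bsub>M\<^esub> p x = p (- x)"
  unfolding a_inv_def m_inv_def
proof (rule the_equality)
  show "p (- x) \<in> carrier (add_monoid M) \<and> p x \<otimes>\<^bsub>add_monoid M\<^esub> p (- x) = \<one>\<^bsub>add_monoid M\<^esub> \<and>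
      p (- x) \<otimes>\<^bsub>add_monoid M\<^esub> p x = \<one>\<^bsub>add_monoid M\<^esub>"
    using assms by (auto simp: pres_def)
next
  fix z
  assume z: "z \<in> carrier (add_monoid M) \<and> p x \<otimes>\<^bsub>add_monoid M\<^esub> z = \<one>\<^bsub>add_monoid M\<^esub> \<and>
      z \<otimes>\<^bsub>add_monoid M\<^esub> p x = \<one>\<^bsub>add_monoid M\<^esub>"
  then obtain y where y: "z = p y" using assms by (auto simp: pres_def)
  with z have "p (x + y) = p 0" using assms by (simp add: pres_def)
  then have "x + y \<in> K" using assms by (simp add: pres_def)
  then show "z = p (- x)" using assms y by (simp add: pres_def add.commute)
qed

lemma pres_minus: "pres M p K \<Longrightarrow> p x \<ominus>\<^bsub>M\<^esub> p y = p (x - y)"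
  using pres_add[of M p K x "- y"] by (simp add: a_minus_def pres_a_inv)

lemma pres_ringD:
  assumes "pres_ring M p K"
  shows "pres M p K" "\<one>\<^bsub>M\<^esub> = p 1" "p x \<otimes>\<^bsub>M\<^esub> p y = p (x * y)"
  using assms by (simp_all add: pres_ring_def)

lemma pres_set_add:
  assumes "pres M p K"
  shows "(p ` A) <+>\<^bsub>M\<^esub> (p ` B) = p ` {a + b |a b. a \<in> A \<and> b \<in> B}"
  using assms by (force simp: set_add_def set_mult_def pres_def)

definition pres_sub :: "('a::ab_group_add \<Rightarrow> 'b) \<Rightarrow> 'b set \<Rightarrow> bool"
  where "pres_sub p H \<longleftrightarrow> H \<subseteq> range p \<and> p 0 \<in> H \<and> (\<forall>x y. p x \<in> H \<longrightarrow> p y \<in> H \<longrightarrow> p (x - y) \<in> H)"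

lemma pres_subI:
  "H \<subseteq> range p \<Longrightarrow> p 0 \<in> H \<Longrightarrow> (\<And>x y. p x \<in> H \<Longrightarrow> p y \<in> H \<Longrightarrow> p (x - y) \<in> H) \<Longrightarrow> pres_sub p H"
  by (simp add: pres_sub_def)

context
  fixes M :: "('b, 'm) ring_scheme" and p :: "'a::ab_group_add \<Rightarrow> 'b" and K :: "'a set" and H :: "'b set"
  assumes M: "pres M p K" and H: "pres_sub p H"
begin

lemma pres_sub_diff: "p x \<in> H \<Longrightarrow> p y \<in> H \<Longrightarrow> p (x - y) \<in> H"
  using H by (simp add: pres_sub_def)

lemma pres_sub_minus: "p x \<in> H \<Longrightarrow> p (- x) \<in> H"
  using H by (metis pres_sub_def diff_0)

lemma pres_sub_add: "p x \<in> H \<Longrightarrow> p y \<in> H \<Longrightarrow> p (x + y) \<in> H"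
  using pres_sub_diff[of x "- y"] pres_sub_minus by simp

lemma pres_coset: "H +>\<^bsub>M\<^esub> p x = p ` {y. p (y - x) \<in> H}"
proof -
  have "h \<oplus>\<^bsub>M\<^esub> p x \<in> p ` {y. p (y - x) \<in> H}" if "h \<in> H" for h
  proof -
    obtain z where z: "h = p z" using \<open>h \<in> H\<close> H unfolding pres_sub_def by blast
    show ?thesis
      by (rule image_eqI[of _ _ "z + x"]) (use that in \<open>simp_all add: z pres_add[OF M]\<close>)
  qed
  moreover have "p y \<in> H +>\<^bsub>M\<^esub> p x" if "p (y - x) \<in> H" for y
    unfolding a_r_coset_def' using pres_add[OF M, of "y - x" x] that by force
  ultimately show ?thesis by (auto simp: a_r_coset_def')
qed

lemma pres_coset_mem: "p y \<in> H +>\<^bsub>M\<^esub> p x \<longleftrightarrow> p (y - x) \<in> H"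
proof -
  have "p (y - x) \<in> H" if "p y = p z" "p (z - x) \<in> H" for z
  proof -
    have "p (y - x) = p (z - x)" using that M by (simp add: pres_def)
    then show ?thesis using that by simp
  qed
  then show ?thesis by (auto simp: pres_coset)
qed

lemma pres_coset_eq: "H +>\<^bsub>M\<^esub> p x = H +>\<^bsub>M\<^esub> p y \<longleftrightarrow> p (x - y) \<in> H"
proof
  assume "H +>\<^bsub>M\<^esub> p x = H +>\<^bsub>M\<^esub> p y"
  moreover have "p x \<in> H +>\<^bsub>M\<^esub> p x" using H by (simp add: pres_coset_mem pres_sub_def)
  ultimately show "p (x - y) \<in> H" by (simp add: pres_coset_mem)
next
  assume a: "p (x - y) \<in> H"
  have "p (z - x) \<in> H \<longleftrightarrow> p (z - y) \<in> H" for z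
    using pres_sub_add[of "z - x" "x - y"] pres_sub_diff[of "z - y" "x - y"] a by auto
  then show "H +>\<^bsub>M\<^esub> p x = H +>\<^bsub>M\<^esub> p y" by (simp add: pres_coset)
qed

lemma pres_coset_0: "H +>\<^bsub>M\<^esub> p 0 = H"
  using H unfolding pres_coset by (auto simp: pres_sub_def)

lemma pres_rcosets: "a_rcosets\<^bsub>M\<^esub> H = range (\<lambda>x. H +>\<^bsub>M\<^esub> p x)"
  using M by (auto simp: A_RCOSETS_def' pres_def a_r_coset_def')

lemma pres_coset_add: "(H +>\<^bsub>M\<^esub> p x) <+>\<^bsub>M\<^esub> (H +>\<^bsub>M\<^esub> p y) = H +>\<^bsub>M\<^esub> p (x + y)"
proof -
  have *: "a + b - (x + y) = (a - x) + (b - y)" "z - y - x = z - (x + y)" for a b z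
    by (simp_all add: algebra_simps)
  have "p (a + b - (x + y)) \<in> H" if "p (a - x) \<in> H" "p (b - y) \<in> H" for a b
    unfolding * using that by (rule pres_sub_add)
  moreover
  have "\<exists>a b. z = a + b \<and> p (a - x) \<in> H \<and> p (b - y) \<in> H" if "p (z - (x + y)) \<in> H" for z
    by (rule exI[of _ "z - y"], rule exI[of _ y]) (use that H in \<open>simp add: *(2) pres_sub_def\<close>)
  ultimately show ?thesis
    unfolding pres_coset pres_set_add[OF M]
    by (intro arg_cong[of _ _ "\<lambda>A. p ` A"]) auto
qed

lemma pres_quotient:
  assumes "carrier M' = a_rcosets\<^bsub>M\<^esub> H" "\<zero>\<^bsub>M'\<^esub> = H" "add M' = set_add M"
  shows "pres M' (\<lambda>x. H +>\<^bsub>M\<^esub> p x) {x. p x \<in> H}"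
  unfolding pres_def using assms by (simp add: pres_rcosets pres_coset_0 pres_coset_add pres_coset_eq)

text \<open>Scalar multiplication on a quotient is a union over representatives. Any two of them
  differ by an element of \<open>H\<close>, which \<open>f\<close> preserves, so the union is over a
  single coset.\<close>

lemma pres_coset_smult:
  assumes "\<And>x. sm (p x) = p (f x)" "\<And>x y. f (x - y) = f x - f y" "\<And>x. p x \<in> H \<Longrightarrow> p (f x) \<in> H"
  shows "(\<Union>x\<in>H +>\<^bsub>M\<^esub> p x. H +>\<^bsub>M\<^esub> (sm x)) = H +>\<^bsub>M\<^esub> p (f x)"
proof -
  have "H +>\<^bsub>M\<^esub> (sm z) = H +>\<^bsub>M\<^esub> p (f x)" if z: "z \<in> H +>\<^bsub>M\<^esub> p x" for z
  proof -
    obtain y where "z = p y" "p (y - x) \<in> H" using z unfolding pres_coset by blast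
    then show ?thesis using assms by (simp add: pres_coset_eq flip: assms(2))
  qed
  moreover have "p x \<in> H +>\<^bsub>M\<^esub> p x" using H by (simp add: pres_coset_mem pres_sub_def)
  ultimately show ?thesis by blast
qed

end

text \<open>Coset multiplication is a union over representatives too; their choice is irrelevant
  because \<open>c * d - x * y\<close> splits into one term from each side of the ideal. Applied
  twice, this presents \<open>Ut\<close> and then \<open>U\<close> over the free algebra.\<close>

lemma pres_ring_quotient:
  fixes p :: "'a::ring_1 \<Rightarrow> 'b"
  assumes M: "pres_ring M p K" and H: "pres_sub p H"
    and id: "\<And>x y. p x \<in> H \<Longrightarrow> p (x * y) \<in> H" "\<And>x y. p x \<in> H \<Longrightarrow> p (y * x) \<in> H"
  shows "pres_ring (M Quot H) (\<lambda>x. H +>\<^bsub>M\<^esub> p x) {x. p x \<in> H}"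
proof -
  note M' = pres_ringD[OF M]
  have "rcoset_mult M H (H +>\<^bsub>M\<^esub> p x) (H +>\<^bsub>M\<^esub> p y) = H +>\<^bsub>M\<^esub> p (x * y)" for x y
  proof -
    have *: "H +>\<^bsub>M\<^esub> (a \<otimes>\<^bsub>M\<^esub> b) = H +>\<^bsub>M\<^esub> p (x * y)" if ab: "a \<in> H +>\<^bsub>M\<^esub> p x" "b \<in> H +>\<^bsub>M\<^esub> p y" for a b
    proof -
      obtain c d where c: "a = p c" "p (c - x) \<in> H" and d: "b = p d" "p (d - y) \<in> H"
        using ab unfolding pres_coset[OF M'(1) H] by blast
      have "c * d - x * y = (c - x) * d + x * (d - y)" by (simp add: algebra_simps)
      then have "p (c * d - x * y) \<in> H"
        using c d by (simp add: id pres_sub_add[OF M'(1) H])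
      then show ?thesis using c d by (simp add: M'(3) pres_coset_eq[OF M'(1) H])
    qed
    have "p x \<in> H +>\<^bsub>M\<^esub> p x" "p y \<in> H +>\<^bsub>M\<^esub> p y"
      using H by (simp_all add: pres_coset_mem[OF M'(1) H] pres_sub_def)
    with * show ?thesis unfolding rcoset_mult_def by blast
  qed
  moreover have "pres (M Quot H) (\<lambda>x. H +>\<^bsub>M\<^esub> p x) {x. p x \<in> H}"
    by (rule pres_quotient[OF M'(1) H]) (simp_all add: FactRing_def)
  ultimately show ?thesis by (simp add: pres_ring_def FactRing_def M'(2))
qed

lemma pres_ring_of_type: "pres_ring (ring_of_type :: 'a::ring_1 ring) (\<lambda>x. x) {0}"
  by (simp add: pres_ring_def pres_def ring_of_type_def)

lemma ring_ring_of_type: "ring (ring_of_type :: 'a::ring_1 ring)"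
proof (rule ringI)
  show "abelian_group (ring_of_type :: 'a ring)"
  proof (rule abelian_groupI)
    fix x assume "x \<in> carrier (ring_of_type :: 'a ring)"
    show "\<exists>y\<in>carrier ring_of_type. y \<oplus>\<^bsub>ring_of_type\<^esub> x = \<zero>\<^bsub>ring_of_type\<^esub>"
      by (rule bexI[of _ "- x"]) (simp_all add: ring_of_type_def)
  qed (simp_all add: ring_of_type_def add_ac)
  show "monoid (ring_of_type :: 'a ring)"
    by (rule monoidI) (simp_all add: ring_of_type_def mult.assoc)
qed (simp_all add: ring_of_type_def distrib_left distrib_right)

text \<open>Lets spans in every quotient be computed in the free algebra. The inductive definition
  adds one scalar multiple at a time, as \<open>FA.span_induct_alt\<close> does.\<close>

lemma lin_span_image:
  assumes V: "pres V p K" and a: "\<And>c x. a c (p x) = p (fscale c x)"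
  shows "lin_span V a (p ` S) = p ` FA.span S"
proof (intro equalityI subsetI)
  fix z assume "z \<in> lin_span V a (p ` S)"
  then show "z \<in> p ` FA.span S"
  proof induction
    case zero
    then show ?case using pres_zero[OF V] FA.span_zero by auto
  next
    case (add x y c)
    then obtain u v where "x = p u" "u \<in> FA.span S" "y = p v" "v \<in> S" by auto
    then have "x \<oplus>\<^bsub>V\<^esub> a c y = p (u + fscale c v)" "u + fscale c v \<in> FA.span S"
      by (simp_all add: a pres_add[OF V] FA.span_add FA.span_scale FA.span_base)
    then show ?case by auto
  qed
next
  fix z assume "z \<in> p ` FA.span S"
  then obtain x where "z = p x" "x \<in> FA.span S" by auto
  from this(2) have "p x \<in> lin_span V a (p ` S)"
  proof (induction rule: FA.span_induct_alt)
    case base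
    then show ?case using lin_span.zero[of V a] by (simp add: pres_zero[OF V])
  next
    case (step c x y)
    then show ?case
      using lin_span.add[of "p y" V a "p ` S" "p x" c] by (simp add: a pres_add[OF V] add.commute)
  qed
  then show "z \<in> lin_span V a (p ` S)" using \<open>z = p x\<close> by simp
qed

definition words :: "'g set \<Rightarrow> ('k::field, 'g) free_algebra set"
  where "words S = mon ` {w. set w \<subseteq> S}"

lemma words_mult: "x \<in> words S \<Longrightarrow> y \<in> words S \<Longrightarrow> x * y \<in> words S"
  by (force simp: words_def simp flip: mon_append)

lemma one_words: "1 \<in> words S"
  unfolding words_def by (rule image_eqI[of _ _ "[]"]) auto

lemma span_words_mult:
  assumes "x \<in> FA.span (words S)" "y \<in> FA.span (words S)"
  shows "x * y \<in> FA.span (words S)"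
  using assms(1)
proof (induction rule: FA.span_induct_alt)
  case base
  then show ?case by (simp add: FA.span_zero)
next
  case (step c u v)
  from assms(2) have "u * y \<in> FA.span (words S)"
  proof (induction rule: FA.span_induct_alt)
    case base
    then show ?case by (simp add: FA.span_zero)
  next
    case (step c x y)
    then show ?case
      using words_mult[OF \<open>u \<in> words S\<close> step(1)]
      by (simp add: distrib_left FA.span_add FA.span_scale FA.span_base)
  qed
  with step show ?case by (simp add: distrib_right FA.span_add FA.span_scale)
qed

text \<open>Words multiply by concatenation, so scalars and generators produce exactly the
  combinations of words. The three subalgebras of \<open>Ut\<close> thus become images of the spans
  of \<open>Fwords\<close>, \<open>Zwords\<close> and \<open>Ewords\<close>.\<close>

lemma generate_ring_image:
  assumes "pres_ring M p K"
  shows "generate_ring M (range (\<lambda>c. p (const c)) \<union> (\<lambda>g. p (var g)) ` S) = p ` FA.span (words S)"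
    (is "?G = _")
proof (intro equalityI subsetI)
  note M = pres_ringD[OF assms]
  fix z assume "z \<in> ?G"
  then show "z \<in> p ` FA.span (words S)"
  proof induction
    case one
    then show ?case using FA.span_base[OF one_words] M(2) by auto
  next
    case (incl h)
    have "const c \<in> FA.span (words S)" for c
      by (simp add: const_eq_scale FA.span_scale FA.span_base one_words)
    moreover have "var g \<in> FA.span (words S)" if "g \<in> S" for g
      by (rule FA.span_base) (use that in \<open>auto simp: words_def mon_def var_def intro!: image_eqI[of _ _ "[g]"]\<close>)
    ultimately show ?case using incl by auto
  next
    case (a_inv h)
    then show ?case by (auto simp: pres_a_inv[OF M(1)] intro!: imageI FA.span_neg)
  next
    case (eng_add h1 h2)
    then show ?case by (auto simp: pres_add[OF M(1)] intro!: imageI FA.span_add)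
  next
    case (eng_mult h1 h2)
    then show ?case by (auto simp: M(3) intro!: imageI span_words_mult)
  qed
next
  note M = pres_ringD[OF assms]
  fix z assume "z \<in> p ` FA.span (words S)"
  then obtain x where "z = p x" "x \<in> FA.span (words S)" by auto
  from this(2) have "p x \<in> ?G"
  proof (induction rule: FA.span_induct_alt)
    case base
    have "p (const 0) \<in> ?G" by (rule generate_ring.incl) blast
    then show ?case by simp
  next
    case (step c u v)
    then obtain w where w: "u = mon w" "set w \<subseteq> S" by (auto simp: words_def)
    from w(2) have "p (mon w) \<in> ?G"
    proof (induction w)
      case Nil
      then show ?case using generate_ring.one[of M] M(2) by simp
    next
      case (Cons g w)
      then have "p (var g) \<in> ?G" "p (mon w) \<in> ?G" by (auto intro!: generate_ring.incl)
      then have "p (var g) \<otimes>\<^bsub>M\<^esub> p (mon w) \<in> ?G" by (rule generate_ring.eng_mult)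
      then show ?case by (simp add: mon_Cons M(3))
    qed
    moreover have "p (const c) \<in> ?G" by (rule generate_ring.incl) blast
    ultimately have "p (const c) \<otimes>\<^bsub>M\<^esub> p (mon w) \<oplus>\<^bsub>M\<^esub> p v \<in> ?G"
      using step by (intro generate_ring.eng_add generate_ring.eng_mult)
    then show ?case by (simp add: w M(3) pres_add[OF M(1)] fscale_def)
  qed
  then show "z \<in> ?G" using \<open>z = p x\<close> by simp
qed

section \<open>The algebra before factoring out the radicals\<close>

lemma span_mult_subspace:
  assumes "x \<in> FA.span S" "y \<in> FA.span T" "FA.subspace V"
    and "\<And>s t. s \<in> S \<Longrightarrow> t \<in> T \<Longrightarrow> s * t \<in> V"
  shows "x * y \<in> V"
proof -
  have "s * y \<in> V" if "s \<in> S" for s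
    using assms(2)
  proof (induction rule: FA.span_induct)
    case base
    show ?case using assms(3) by (auto simp: FA.subspace_def distrib_left)
  qed (use assms(4) that in auto)
  with assms(1) show ?thesis
  proof (induction rule: FA.span_induct)
    case base
    show ?case using assms(3) by (auto simp: FA.subspace_def distrib_right)
  qed auto
qed

lemma subspace_mult_closed_left:
  assumes "FA.subspace V" "\<And>g x. x \<in> V \<Longrightarrow> var g * x \<in> V" "x \<in> V"
  shows "y * x \<in> V"
proof (induction y rule: free_algebra_induct)
  case (mon w)
  show ?case
    by (induction w) (simp_all add: assms mon_Cons mult.assoc)
qed (simp_all add: distrib_right FA.subspace_add[OF assms(1)] FA.subspace_scale[OF assms(1)])

lemma subspace_mult_closed_right:
  assumes "FA.subspace V" "\<And>g x. x \<in> V \<Longrightarrow> x * var g \<in> V" "x \<in> V"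
  shows "x * y \<in> V"
proof (induction y rule: free_algebra_induct)
  case (mon w)
  show ?case using assms(3)
    by (induction w arbitrary: x) (simp_all add: assms mon_Cons flip: mult.assoc)
qed (simp_all add: distrib_left FA.subspace_add[OF assms(1)] FA.subspace_scale[OF assms(1)])

lemma flin_mult_left: "flin (\<lambda>x. y * x)"
  and flin_mult_right: "flin (\<lambda>x. x * y)"
  by (auto intro!: flinI simp: distrib_left distrib_right)

lemma flin_span_subset:
  assumes "flin f" "FA.subspace V" "\<And>s. s \<in> S \<Longrightarrow> f s \<in> V" "x \<in> FA.span S"
  shows "f x \<in> V"
  using flin_subspace[OF assms(1,2)] assms(3,4) FA.span_minimal[of S "{x. f x \<in> V}"] by auto

definition wdeg :: "'n generator list \<Rightarrow> 'n lattice"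
  where "wdeg w = (\<Sum>g\<leftarrow>w. gen_degree g)"

definition hom :: "'n lattice \<Rightarrow> ('k::field, 'n) free_gen set"
  where "hom b = FA.span (mon ` {w. wdeg w = b})"

definition proj :: "'n lattice \<Rightarrow> ('k::field, 'n) free_gen \<Rightarrow> ('k, 'n) free_gen"
  where "proj b = lift (\<lambda>w. if wdeg w = b then mon w else 0)"

lemma wdeg_simps [simp]: "wdeg [] = 0" "wdeg (g # w) = gen_degree g + wdeg w" "wdeg (u @ w) = wdeg u + wdeg w"
  by (simp_all add: wdeg_def)

lemma subspace_hom: "FA.subspace (hom b)"
  by (simp add: hom_def FA.subspace_span)

lemma mon_hom: "mon w \<in> hom (wdeg w)"
  by (auto simp: hom_def intro!: FA.span_base)

text \<open>Replaces the condition on supports in \<open>Ut_degree\<close> by a span, to which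
  linear arguments apply.\<close>

lemma hom_keys: "(hom b :: ('k::field, 'n) free_gen set) = {x. \<forall>w\<in>Poly_Mapping.keys x. word_degree w = b}"
proof (intro equalityI subsetI)
  fix x :: "('k, 'n) free_gen"
  assume "x \<in> hom b"
  moreover have "FA.subspace {x :: ('k, 'n) free_gen. \<forall>w\<in>Poly_Mapping.keys x. word_degree w = b}"
    by (rule FA.subspaceI) (use keys_add in \<open>auto simp: in_keys_iff lookup_add\<close>)
  moreover have "mon ` {w. wdeg w = b} \<subseteq> {x :: ('k, 'n) free_gen. \<forall>w\<in>Poly_Mapping.keys x. word_degree w = b}"
    by (auto simp: mon_def wdeg_def word_degree_def)
  ultimately show "x \<in> {x. \<forall>w\<in>Poly_Mapping.keys x. word_degree w = b}"
    unfolding hom_def using FA.span_minimal by blast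
next
  fix x :: "('k, 'n) free_gen"
  assume x: "x \<in> {x. \<forall>w\<in>Poly_Mapping.keys x. word_degree w = b}"
  have "Poly_Mapping.single w c \<in> hom b" if "word_degree w = b" for w :: "'n generator free_monoid" and c :: 'k
  proof -
    have "Poly_Mapping.single w c = fscale c (mon (letters w))"
      by (cases w) (simp add: fscale_def mon_def const_def mult_single)
    moreover have "(mon (letters w) :: ('k, 'n) free_gen) \<in> hom b"
      using that mon_hom[of "letters w"] by (simp add: wdeg_def word_degree_def)
    ultimately show ?thesis by (simp add: hom_def FA.span_scale)
  qed
  with x show "x \<in> hom b"
    by (subst poly_mapping_sum_single[of x]) (auto simp: hom_def intro!: FA.span_sum)
qed

lemma var_hom: "var g \<in> hom (gen_degree g)"
  using mon_hom[of "[g]"] by (simp add: mon_Cons)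

lemma hom_mult: "x \<in> hom a \<Longrightarrow> y \<in> hom b \<Longrightarrow> x * y \<in> hom (a + b)"
  unfolding hom_def
  by (erule span_mult_subspace, assumption, rule FA.subspace_span)
    (auto intro!: FA.span_base simp flip: mon_append)

lemma one_hom: "1 \<in> hom 0"
  using mon_hom[of "[]"] by simp

lemma flin_proj: "flin (proj b)"
  by (simp add: proj_def flin_lift)

lemma proj_mon: "proj b (mon w) = (if wdeg w = b then mon w else 0)"
  by (simp add: proj_def)

lemma proj_hom: "x \<in> hom a \<Longrightarrow> proj b x = (if a = b then x else 0)"
proof -
  assume "x \<in> hom a"
  then have "x \<in> FA.span (mon ` {w. wdeg w = a})" by (simp add: hom_def)
  then show ?thesis
    by (induction rule: FA.span_induct_alt) (auto simp: flin_simps[OF flin_proj] proj_mon)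
qed

definition gK :: "'n lattice \<Rightarrow> ('k::field, 'n) free_gen" where "gK a = var (Gen_K a)"
definition gL :: "'n lattice \<Rightarrow> ('k::field, 'n) free_gen" where "gL a = var (Gen_L a)"
definition gE :: "'n \<Rightarrow> ('k::field, 'n) free_gen" where "gE i = var (Gen_E i)"
definition gF :: "'n \<Rightarrow> ('k::field, 'n) free_gen" where "gF i = var (Gen_F i)"

lemmas gdefs = gK_def gL_def gE_def gF_def

lemma gen_hom: "gK a \<in> hom 0" "gL a \<in> hom 0" "gE i \<in> hom (\<alpha> i)" "gF i \<in> hom (- \<alpha> i)"
  using var_hom[of "Gen_K a"] var_hom[of "Gen_L a"] var_hom[of "Gen_E i"] var_hom[of "Gen_F i"]
  by (simp_all add: gdefs)

definition Fwords :: "'n generator list set" where "Fwords = {w. set w \<subseteq> range Gen_F}"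
definition Ewords :: "'n generator list set" where "Ewords = {w. set w \<subseteq> range Gen_E}"
definition Zwords :: "'n generator list set" where "Zwords = {w. set w \<subseteq> range Gen_K \<union> range Gen_L}"

lemma words_simps [simp]:
  "[] \<in> Fwords" "[] \<in> Ewords" "[] \<in> Zwords"
  "g # w \<in> Fwords \<longleftrightarrow> g \<in> range Gen_F \<and> w \<in> Fwords"
  "g # w \<in> Ewords \<longleftrightarrow> g \<in> range Gen_E \<and> w \<in> Ewords"
  "g # w \<in> Zwords \<longleftrightarrow> g \<in> range Gen_K \<union> range Gen_L \<and> w \<in> Zwords"
  "u @ w \<in> Fwords \<longleftrightarrow> u \<in> Fwords \<and> w \<in> Fwords"
  "u @ w \<in> Ewords \<longleftrightarrow> u \<in> Ewords \<and> w \<in> Ewords"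
  "u @ w \<in> Zwords \<longleftrightarrow> u \<in> Zwords \<and> w \<in> Zwords"
  by (auto simp: Fwords_def Ewords_def Zwords_def)

locale bicharacter =
  fixes chi :: "('k::field, 'n::finite) bichar"
  assumes bihom: "bihom chi"
begin

abbreviation qq :: "'n \<Rightarrow> 'n \<Rightarrow> 'k"
  where "qq i j \<equiv> chi (\<alpha> i) (\<alpha> j)"

lemma chi_nz [simp]: "chi a b \<noteq> 0"
  and chi_add_right: "chi a (b + c) = chi a b * chi a c"
  and chi_add_left: "chi (a + b) c = chi a c * chi b c"
  using bihom by (simp_all add: bihom_def)

lemma chi_0_left [simp]: "chi 0 b = 1"
  using chi_add_left[of 0 0 b] by simp

lemma chi_0_right [simp]: "chi b 0 = 1"
  using chi_add_right[of b 0 0] by simp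

lemma chi_minus_left: "chi (- a) b = inverse (chi a b)"
  using chi_add_left[of "- a" a b] by (simp add: field_simps)

lemma chi_minus_right: "chi b (- a) = inverse (chi b a)"
  using chi_add_right[of b "- a" a] by (simp add: field_simps)

lemma ideal_relators: "ideal (Ut_ideal chi) ring_of_type"
  unfolding Ut_ideal_def by (rule ring.genideal_ideal[OF ring_ring_of_type]) (simp add: ring_of_type_def)

lemma I_relators: "relators chi \<subseteq> Ut_ideal chi"
  unfolding Ut_ideal_def by (rule ring.genideal_self[OF ring_ring_of_type]) (simp add: ring_of_type_def)

lemma I_add: "x \<in> Ut_ideal chi \<Longrightarrow> y \<in> Ut_ideal chi \<Longrightarrow> x + y \<in> Ut_ideal chi"
  using additive_subgroup.a_closed[OF ideal.axioms(1)[OF ideal_relators]] by (simp add: ring_of_type_def)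

lemma I_mult_left: "x \<in> Ut_ideal chi \<Longrightarrow> y * x \<in> Ut_ideal chi"
  using ideal.I_l_closed[OF ideal_relators, of x y] by (simp add: ring_of_type_def)

lemma I_mult_right: "x \<in> Ut_ideal chi \<Longrightarrow> x * y \<in> Ut_ideal chi"
  using ideal.I_r_closed[OF ideal_relators, of x y] by (simp add: ring_of_type_def)

lemma subspace_I: "FA.subspace (Ut_ideal chi)"
proof (rule FA.subspaceI)
  show "0 \<in> Ut_ideal chi"
    using additive_subgroup.zero_closed[OF ideal.axioms(1)[OF ideal_relators]] by (simp add: ring_of_type_def)
qed (simp_all add: I_add fscale_def I_mult_left)

text \<open>The test for well-definedness used below: the elements on which a construction behaves
  well form a two-sided ideal, so only the relators need to be checked.\<close>

lemma I_least:
  assumes "FA.subspace J" "relators chi \<subseteq> J"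
    and "\<And>x y. x \<in> J \<Longrightarrow> y * x \<in> J" "\<And>x y. x \<in> J \<Longrightarrow> x * y \<in> J"
  shows "Ut_ideal chi \<subseteq> J"
  unfolding Ut_ideal_def
proof (rule ring.genideal_minimal[OF ring_ring_of_type _ assms(2)])
  have inv: "\<ominus>\<^bsub>ring_of_type\<^esub> x = - x" for x :: "('k, 'n) free_gen"
    using pres_a_inv[OF pres_ringD(1)[OF pres_ring_of_type]] .
  show "ideal J ring_of_type"
  proof (rule idealI[OF ring_ring_of_type])
    show "subgroup J (add_monoid ring_of_type)"
    proof (rule group.subgroupI)
      show "group (add_monoid (ring_of_type :: ('k, 'n) free_gen ring))"
        using abelian_group.a_group[OF ring.is_abelian_group[OF ring_ring_of_type]] .
      show "J \<noteq> {}" using FA.subspace_0[OF assms(1)] by auto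
    qed (use assms(1) inv in \<open>auto simp: ring_of_type_def FA.subspace_add a_inv_def FA.subspace_neg\<close>)
  qed (use assms in \<open>auto simp: ring_of_type_def\<close>)
qed

abbreviation q :: "('k, 'n) free_gen \<Rightarrow> ('k, 'n) Ut_elem"
  where "q \<equiv> Ut_class chi"

lemma pres_Ut: "pres_ring (Ut chi) q (Ut_ideal chi)"
proof -
  have "pres_sub (\<lambda>x. x) (Ut_ideal chi)"
    using subspace_I by (auto simp: pres_sub_def FA.subspace_0 FA.subspace_diff)
  from pres_ring_quotient[OF pres_ring_of_type this] show ?thesis
    by (simp add: Ut_def Ut_class_def[abs_def] I_mult_left I_mult_right)
qed

lemmas Ut_pres = pres_ringD(1)[OF pres_Ut]

lemma carrier_Ut: "carrier (Ut chi) = range q"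
  using pres_carrier[OF Ut_pres] .

lemma Ut_hom:
  "q x \<oplus>\<^bsub>Ut chi\<^esub> q y = q (x + y)" "q x \<otimes>\<^bsub>Ut chi\<^esub> q y = q (x * y)" "\<one>\<^bsub>Ut chi\<^esub> = q 1" "\<zero>\<^bsub>Ut chi\<^esub> = q 0"
  "q x \<ominus>\<^bsub>Ut chi\<^esub> q y = q (x - y)"
  using pres_ringD[OF pres_Ut] pres_add[OF Ut_pres] pres_zero[OF Ut_pres] pres_minus[OF Ut_pres] by metis+

lemma q_eq: "q x = q y \<longleftrightarrow> x - y \<in> Ut_ideal chi"
  using pres_eq[OF Ut_pres] .

lemma q_mult: "q x = q x' \<Longrightarrow> q y = q y' \<Longrightarrow> q (x * y) = q (x' * y')"
  and q_add: "q x = q x' \<Longrightarrow> q y = q y' \<Longrightarrow> q (x + y) = q (x' + y')"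
  and q_diff: "q x = q x' \<Longrightarrow> q y = q y' \<Longrightarrow> q (x - y) = q (x' - y')"
  by (metis Ut_hom)+

lemma q_scale: "q x = q x' \<Longrightarrow> q (fscale c x) = q (fscale c x')"
  unfolding fscale_def by (rule q_mult) simp_all

section \<open>The defining relations as equations between classes\<close>

lemma q_relator: "x - y \<in> relators chi \<Longrightarrow> q x = q y"
  using I_relators by (auto simp: q_eq)

lemma q_K0: "q (gK 0) = q 1"
  and q_L0: "q (gL 0) = q 1"
  and q_KK: "q (gK a * gK b) = q (gK (a + b))"
  and q_LL: "q (gL a * gL b) = q (gL (a + b))"
  and q_KL: "q (gK a * gL b) = q (gL b * gK a)"
  and q_KE: "q (gK a * gE i) = q (fscale (chi a (\<alpha> i)) (gE i * gK a))"
  and q_LE: "q (gL a * gE i) = q (fscale (chi (- \<alpha> i) a) (gE i * gL a))"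
  and q_KF: "q (gK a * gF i) = q (fscale (chi a (- \<alpha> i)) (gF i * gK a))"
  and q_LF: "q (gL a * gF i) = q (fscale (chi (\<alpha> i) a) (gF i * gL a))"
  by (rule q_relator; unfold relators_def fscale_def gdefs mult.assoc; blast)+

lemma q_EF: "q (gE i * gF j) = q (gF j * gE i + (if i = j then gL (\<alpha> i) - gK (\<alpha> i) else 0))"
proof (rule q_relator)
  have "gE i * gF j - (gF j * gE i + (if i = j then gL (\<alpha> i) - gK (\<alpha> i) else 0)) =
    var (Gen_E i) * var (Gen_F j) - var (Gen_F j) * var (Gen_E i)
         - (if i = j then - var (Gen_K (\<alpha> i)) + var (Gen_L (\<alpha> i)) else 0 :: ('k, 'n) free_gen)"
    by (simp add: gdefs)
  then show "gE i * gF j - (gF j * gE i + (if i = j then gL (\<alpha> i) - gK (\<alpha> i) else 0)) \<in> relators chi"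
    unfolding relators_def by blast
qed

lemma q_KK_comm: "q (gK a * gK b) = q (gK b * gK a)" "q (gL a * gL b) = q (gL b * gL a)"
  by (simp_all add: q_KK q_LL add.commute)

lemma q_K_gen: "q (gK a * var g) = q (fscale (chi a (gen_degree g)) (var g * gK a))"
  by (cases g) (simp_all add: q_KE q_KF q_KK_comm q_KL flip: gdefs)

lemma q_L_gen: "q (gL a * var g) = q (fscale (chi (- gen_degree g) a) (var g * gL a))"
  by (cases g) (simp_all add: q_LE q_LF q_KK_comm q_KL[symmetric] flip: gdefs)

text \<open>A skew commutation rule passes from generators to words because its scalar is
  multiplicative in the degree.\<close>

lemma q_comm_mon:
  assumes "\<And>g. q (x * var g) = q (fscale (c (gen_degree g)) (var g * x))"
    and "c 0 = 1" "\<And>a b. c (a + b) = c a * c b"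
  shows "q (x * mon w) = q (fscale (c (wdeg w)) (mon w * x))"
proof (induction w)
  case (Cons g w)
  have "q (x * var g * mon w) = q (fscale (c (gen_degree g)) (var g * x) * mon w)"
    by (intro q_mult assms HOL.refl)
  also have "\<dots> = q (fscale (c (gen_degree g)) (var g * (x * mon w)))"
    by (simp add: mult.assoc)
  also have "\<dots> = q (fscale (c (gen_degree g)) (var g * fscale (c (wdeg w)) (mon w * x)))"
    by (intro q_mult q_scale Cons HOL.refl)
  finally show ?case by (simp add: mon_Cons mult.assoc assms)
qed (simp add: assms)

lemma q_K_mon: "q (gK a * mon w) = q (fscale (chi a (wdeg w)) (mon w * gK a))"
  by (rule q_comm_mon[OF q_K_gen]) (simp_all add: chi_add_right)

lemma q_L_mon: "q (gL a * mon w) = q (fscale (chi (- wdeg w) a) (mon w * gL a))"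
  by (rule q_comm_mon[OF q_L_gen]) (simp_all add: chi_minus_left chi_add_left del: minus_add_distrib)

lemma q_span_eqI:
  assumes "x \<in> FA.span S" "flin f" "flin g" "\<And>s. s \<in> S \<Longrightarrow> q (f s) = q (g s)"
  shows "q (f x) = q (g x)"
proof -
  have "flin (\<lambda>x. f x - g x)" using assms(2,3) by (auto simp: flin_def FA.scale_right_diff_distrib)
  from flin_span_subset[OF this subspace_I _ assms(1)] assms(4) show ?thesis by (simp add: q_eq)
qed

lemma q_K_hom: "x \<in> hom b \<Longrightarrow> q (gK a * x) = q (fscale (chi a b) (x * gK a))"
  and q_L_hom: "x \<in> hom b \<Longrightarrow> q (gL a * x) = q (fscale (chi (- b) a) (x * gL a))"
  unfolding hom_def
  by (erule q_span_eqI; auto intro!: flinI simp: algebra_simps fscale_add_right q_K_mon q_L_mon FA.scale_right_distrib)+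

lemma q_hom_K: "x \<in> hom b \<Longrightarrow> q (x * gK a) = q (fscale (inverse (chi a b)) (gK a * x))"
  using q_scale[OF q_K_hom, of x b] by auto

text \<open>All terms of a relator have the same degree. The ideal of relations is therefore graded,
  in the form of \<open>proj_I\<close>.\<close>

lemma relators_hom: "r \<in> relators chi \<Longrightarrow> \<exists>d. r \<in> hom d"
proof -
  have 1: "fscale c (x * y) \<in> hom (a + b)" "x * y \<in> hom (a + b)" if "x \<in> hom a" "y \<in> hom b" for x y :: "('k, 'n) free_gen" and a b and c :: 'k
    using hom_mult[OF that] by (simp_all add: FA.subspace_scale[OF subspace_hom])
  have 2: "x * y - fscale c (y * x) \<in> hom (a + b)" if "x \<in> hom a" "y \<in> hom b" for x y :: "('k, 'n) free_gen" and a b and c :: 'k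
    using 1(2)[OF that] 1(1)[OF that(2,1), of c] FA.subspace_diff[OF subspace_hom]
    by (simp add: add.commute)
  have 3: "x * y - y * x \<in> hom (a + b)" if "x \<in> hom a" "y \<in> hom b" for x y :: "('k, 'n) free_gen" and a b
    using 2[OF that, of 1] by simp
  have 4: "x * y - z \<in> hom 0" if "x \<in> hom 0" "y \<in> hom 0" "z \<in> hom 0" for x y z :: "('k, 'n) free_gen"
    using 1(2)[OF that(1,2)] that(3) FA.subspace_diff[OF subspace_hom, of _ 0] by simp
  have 5: "gE i * gF j - gF j * gE i - (if i = j then - gK (\<alpha> i) + gL (\<alpha> i) else 0)
      \<in> (hom (\<alpha> i - \<alpha> j) :: ('k, 'n) free_gen set)" for i j
  proof -
    have "(if i = j then - gK (\<alpha> i) + gL (\<alpha> i) else 0) \<in> (hom (\<alpha> i - \<alpha> j) :: ('k, 'n) free_gen set)"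
      using FA.subspace_diff[OF subspace_hom gen_hom(2,1)] FA.subspace_0[OF subspace_hom] by auto
    from FA.subspace_diff[OF subspace_hom _ this] 3[OF gen_hom(3,4), of i j] show ?thesis by simp
  qed
  assume "r \<in> relators chi"
  then show ?thesis
    unfolding relators_def mult.assoc gdefs[symmetric] fscale_def[symmetric]
    using FA.subspace_diff[OF subspace_hom gen_hom(1) one_hom]
      FA.subspace_diff[OF subspace_hom gen_hom(2) one_hom]
    by (elim UnE CollectE exE conjE insertE emptyE)
      (auto split del: if_split intro: 4[OF gen_hom(1) gen_hom(1) gen_hom(1)] 4[OF gen_hom(2) gen_hom(2) gen_hom(2)]
        3[OF gen_hom(1) gen_hom(2)] 2[OF gen_hom(1) gen_hom(3)] 2[OF gen_hom(2) gen_hom(3)]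
        2[OF gen_hom(1) gen_hom(4)] 2[OF gen_hom(2) gen_hom(4)] 5)
qed

lemma I_span: "Ut_ideal chi = FA.span {mon u * r * mon w |u r w. r \<in> relators chi}" (is "_ = FA.span ?T")
proof
  show "FA.span ?T \<subseteq> Ut_ideal chi"
    using I_relators by (intro FA.span_minimal subspace_I) (auto intro: I_mult_left I_mult_right)
  have *: "mon u * r * mon w \<in> FA.span ?T" if "r \<in> relators chi" for u r w
    using that by (intro FA.span_base) blast
  show "Ut_ideal chi \<subseteq> FA.span ?T"
  proof (rule I_least)
    show "relators chi \<subseteq> FA.span ?T"
      using *[of _ "[]" "[]"] by auto
    fix x y assume x: "x \<in> FA.span ?T"
    have "var g * (mon u * r * mon w) \<in> FA.span ?T" "mon u * r * mon w * var g \<in> FA.span ?T"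
      if "r \<in> relators chi" for g u r w
      using *[OF that, of "g # u" w] *[OF that, of u "w @ [g]"]
      by (simp_all add: mon_Cons mon_append mult.assoc)
    then show "y * x \<in> FA.span ?T" "x * y \<in> FA.span ?T"
      by (intro subspace_mult_closed_left[OF FA.subspace_span _ x] subspace_mult_closed_right[OF FA.subspace_span _ x];
          elim flin_span_subset[OF flin_mult_left FA.subspace_span, rotated]
            flin_span_subset[OF flin_mult_right FA.subspace_span, rotated]; blast)+
  qed (rule FA.subspace_span)
qed

text \<open>The spanning elements \<open>mon u * r * mon w\<close> of the ideal are homogeneous, and
  \<open>proj b\<close> either keeps or kills each of them.\<close>

lemma proj_I: "x \<in> Ut_ideal chi \<Longrightarrow> proj b x \<in> Ut_ideal chi"
  unfolding I_span
proof (erule flin_span_subset[OF flin_proj FA.subspace_span, rotated])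
  fix t assume "t \<in> {mon u * r * mon w |u r w. r \<in> relators chi}"
  then obtain u r w where t: "t = mon u * r * mon w" "r \<in> relators chi" by auto
  with relators_hom obtain d where "r \<in> hom d" by blast
  with t have "t \<in> hom (wdeg u + d + wdeg w)" by (auto intro!: hom_mult mon_hom)
  then have "proj b t \<in> {t, 0}" by (simp add: proj_hom)
  moreover have "t \<in> FA.span {mon u * r * mon w |u r w. r \<in> relators chi}"
    using t by (intro FA.span_base) blast
  ultimately show "proj b t \<in> FA.span {mon u * r * mon w |u r w. r \<in> relators chi}"
    by (auto simp: FA.span_zero)
qed

end

section \<open>The radical\<close>

definition Fhom :: "'n lattice \<Rightarrow> ('k::field, 'n) free_gen set"
  where "Fhom b = FA.span (mon ` {w \<in> Fwords. wdeg w = b})"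

lemma subspace_Fhom: "FA.subspace (Fhom b)"
  by (simp add: Fhom_def FA.subspace_span)

lemma Fhom_mult: "x \<in> Fhom a \<Longrightarrow> y \<in> Fhom b \<Longrightarrow> x * y \<in> Fhom (a + b)"
  unfolding Fhom_def
  by (erule span_mult_subspace, assumption, rule FA.subspace_span)
    (auto intro!: FA.span_base simp flip: mon_append)

lemma gF_Fhom: "gF i \<in> Fhom (- \<alpha> i)"
  unfolding Fhom_def by (rule FA.span_base, rule image_eqI[of _ _ "[Gen_F i]"]) (simp_all add: mon_Cons gF_def)

lemma Fhom_hom: "x \<in> Fhom b \<Longrightarrow> x \<in> hom b"
  unfolding Fhom_def hom_def using FA.span_mono[of "mon ` {w \<in> Fwords. wdeg w = b}" "mon ` {w. wdeg w = b}"] by auto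

lemma Fhom_Fspan: "x \<in> Fhom b \<Longrightarrow> x \<in> FA.span (mon ` Fwords)"
  unfolding Fhom_def using FA.span_mono[of "mon ` {w \<in> Fwords. wdeg w = b}" "mon ` Fwords"] by auto

lemma proj_Fspan: "x \<in> FA.span (mon ` Fwords) \<Longrightarrow> proj b x \<in> Fhom b"
  by (erule flin_span_subset[OF flin_proj subspace_Fhom, rotated])
    (auto simp: proj_mon Fhom_def FA.span_zero intro!: FA.span_base[OF imageI])

text \<open>Shows from the degree alone whether a given \<open>F_i\<close> occurs in a word.\<close>

lemma lookup_wdeg_Fwords:
  "w \<in> Fwords \<Longrightarrow> Poly_Mapping.lookup (wdeg w) i = - int (count_list w (Gen_F i))"
  by (induction w) (auto simp: lookup_add alpha_def lookup_single when_def split: if_splits)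

definition ht :: "'n::finite lattice \<Rightarrow> int"
  where "ht a = (\<Sum>i\<in>UNIV. Poly_Mapping.lookup a i)"

lemma ht_add: "ht (a + b) = ht a + ht b"
  and ht_diff: "ht (a - b) = ht a - ht b"
  and ht_alpha [simp]: "ht (\<alpha> i) = 1"
  and ht_0 [simp]: "ht 0 = 0"
  by (simp_all add: ht_def lookup_add lookup_minus sum.distrib sum_subtractf alpha_def lookup_single when_def)

lemma ht_nonneg: "nonneg a \<Longrightarrow> 0 \<le> ht a"
  by (auto simp: ht_def nonneg_def intro!: sum_nonneg)

lemma nonneg_0 [simp]: "nonneg 0"
  and nonneg_alpha [simp]: "nonneg (\<alpha> i)"
  and nonneg_add: "nonneg a \<Longrightarrow> nonneg b \<Longrightarrow> nonneg (a + b)"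
  by (auto simp: nonneg_def alpha_def lookup_single when_def lookup_add)

lemma nonneg_induct [case_names less]:
  assumes "\<And>a. (\<And>i. nonneg (a - \<alpha> i) \<Longrightarrow> P (a - \<alpha> i)) \<Longrightarrow> P a"
  shows "P (a :: 'n::finite lattice)"
proof (induction "nat (ht a + 1)" arbitrary: a rule: less_induct)
  case less
  show ?case
  proof (rule assms)
    fix i assume "nonneg (a - \<alpha> i)"
    from ht_nonneg[OF this] show "P (a - \<alpha> i)" by (intro less) (simp add: ht_diff)
  qed
qed

context bicharacter
begin

definition IA :: "'n lattice \<Rightarrow> ('k, 'n) free_gen set"
  where "IA a = {x. q x \<in> It_minus chi a}"

lemma IA_cong: "q x = q y \<Longrightarrow> x \<in> IA a \<longleftrightarrow> y \<in> IA a"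
  by (simp add: IA_def)

lemma Ut_minus_eq: "Ut_minus chi = q ` FA.span (mon ` Fwords)"
  using generate_ring_image[OF pres_Ut, of "range Gen_F"]
  by (simp add: Ut_minus_def Ut_subalgebra_def Ut_const_def[abs_def] Ft_def[abs_def] image_image words_def Fwords_def)

lemma Ut_plus_eq: "Ut_plus chi = q ` FA.span (mon ` Ewords)"
  using generate_ring_image[OF pres_Ut, of "range Gen_E"]
  by (simp add: Ut_plus_def Ut_subalgebra_def Ut_const_def[abs_def] Et_def[abs_def] image_image words_def Ewords_def)

lemma Ut_zero_eq: "Ut_zero chi = q ` FA.span (mon ` Zwords)"
  using generate_ring_image[OF pres_Ut, of "range Gen_K \<union> range Gen_L"]
  by (simp add: Ut_zero_def Ut_subalgebra_def Ut_const_def[abs_def] Kt_def[abs_def] Lt_def[abs_def]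
      image_image image_Un words_def Zwords_def)

lemma Ut_degree_eq: "Ut_degree chi b = q ` hom b"
  by (simp add: Ut_degree_def hom_keys)

text \<open>Membership in \<open>Ut_minus\<close> and in \<open>Ut_degree\<close> comes with two
  different representatives. As the ideal of relations is graded, projecting the first one to degree
  \<open>b\<close> yields an element of the same class that serves for both.\<close>

lemma q_minus_degree: "q x \<in> Ut_minus chi \<inter> Ut_degree chi b \<longleftrightarrow> (\<exists>f\<in>Fhom b. q x = q f)"
proof
  assume "q x \<in> Ut_minus chi \<inter> Ut_degree chi b"
  then obtain f g where f: "q x = q f" "f \<in> FA.span (mon ` Fwords)" and g: "q x = q g" "g \<in> hom b"
    unfolding Ut_minus_eq Ut_degree_eq by blast
  from f g have "f - g \<in> Ut_ideal chi" by (simp flip: q_eq)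
  from proj_I[OF this, of b] have "q (proj b f) = q g"
    using g by (simp add: flin_simps[OF flin_proj] proj_hom q_eq)
  with g proj_Fspan[OF f(2)] show "\<exists>f\<in>Fhom b. q x = q f" by metis
next
  assume "\<exists>f\<in>Fhom b. q x = q f"
  then show "q x \<in> Ut_minus chi \<inter> Ut_degree chi b"
    unfolding Ut_minus_eq Ut_degree_eq using Fhom_hom Fhom_Fspan by blast
qed

lemma It_minus_carrier: "It_minus chi a = q ` IA a"
proof -
  have "It_minus chi a \<subseteq> range q"
  proof (cases "a = 0 \<or> \<not> nonneg a")
    case True
    then show ?thesis by (subst It_minus.simps) (auto simp: Ut_hom)
  next
    case False
    then show ?thesis by (subst It_minus.simps) (auto simp: Ut_minus_eq)
  qed
  then show ?thesis by (auto simp: IA_def)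
qed

lemma IA_trivial: "a = 0 \<or> \<not> nonneg a \<Longrightarrow> IA a = Ut_ideal chi"
  unfolding IA_def by (subst It_minus.simps) (auto simp: Ut_hom q_eq)

lemma IA_iff:
  assumes "a \<noteq> 0" "nonneg a"
  shows "x \<in> IA a \<longleftrightarrow> (\<exists>f\<in>Fhom (- a). q x = q f) \<and>
    (\<forall>i. nonneg (a - \<alpha> i) \<longrightarrow> (\<exists>z1\<in>IA (a - \<alpha> i). \<exists>z2\<in>IA (a - \<alpha> i).
      q (gE i * x - x * gE i) = q (z1 * gK (\<alpha> i) + z2 * gL (\<alpha> i))))"
proof -
  have "(\<lambda>Z. Z \<otimes>\<^bsub>Ut chi\<^esub> Kt chi b) ` It_minus chi c = q ` (\<lambda>z. z * gK b) ` IA c"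
    "(\<lambda>Z. Z \<otimes>\<^bsub>Ut chi\<^esub> Lt chi b) ` It_minus chi c = q ` (\<lambda>z. z * gL b) ` IA c" for b c
    by (simp_all add: It_minus_carrier image_image Kt_def Lt_def gdefs Ut_hom)
  moreover have "q y \<in> q ` {u + v |u v. u \<in> (\<lambda>z. z * gK b) ` IA c \<and> v \<in> (\<lambda>z. z * gL b) ` IA c} \<longleftrightarrow>
      (\<exists>z1\<in>IA c. \<exists>z2\<in>IA c. q y = q (z1 * gK b + z2 * gL b))" for y b c
    by blast
  moreover have "Et chi i \<otimes>\<^bsub>Ut chi\<^esub> q x \<ominus>\<^bsub>Ut chi\<^esub> q x \<otimes>\<^bsub>Ut chi\<^esub> Et chi i = q (gE i * x - x * gE i)" for i
    by (simp add: Et_def gdefs Ut_hom)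
  ultimately show ?thesis
    using assms unfolding IA_def[of a]
    by (subst It_minus.simps) (simp add: pres_set_add[OF Ut_pres] flip: q_minus_degree)
qed

lemma subspace_IA: "FA.subspace (IA a)"
proof (induction a rule: nonneg_induct)
  case (less a)
  show ?case
  proof (cases "a = 0 \<or> \<not> nonneg a")
    case True
    then show ?thesis by (simp add: IA_trivial subspace_I)
  next
    case False
    then have a: "a \<noteq> 0" "nonneg a" by auto
    have 0: "0 \<in> IA a" unfolding IA_iff[OF a]
    proof (intro conjI allI impI)
      show "\<exists>f\<in>Fhom (- a). q 0 = q f" using FA.subspace_0[OF subspace_Fhom] by blast
      fix i assume "nonneg (a - \<alpha> i)"
      from FA.subspace_0[OF less[OF this]]
      show "\<exists>z1\<in>IA (a - \<alpha> i). \<exists>z2\<in>IA (a - \<alpha> i). q (gE i * 0 - 0 * gE i) = q (z1 * gK (\<alpha> i) + z2 * gL (\<alpha> i))"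
        by (intro bexI[of _ 0]) simp_all
    qed
    have lin: "x + fscale c y \<in> IA a" if x: "x \<in> IA a" and y: "y \<in> IA a" for x y c
      unfolding IA_iff[OF a]
    proof (intro conjI allI impI)
      show "\<exists>f\<in>Fhom (- a). q (x + fscale c y) = q f"
        using x y unfolding IA_iff[OF a]
        by (metis FA.subspace_add FA.subspace_scale subspace_Fhom q_add q_scale)
      fix i assume i: "nonneg (a - \<alpha> i)"
      obtain x1 x2 where x12: "x1 \<in> IA (a - \<alpha> i)" "x2 \<in> IA (a - \<alpha> i)"
          "q (gE i * x - x * gE i) = q (x1 * gK (\<alpha> i) + x2 * gL (\<alpha> i))"
        using x i unfolding IA_iff[OF a] by blast
      obtain y1 y2 where y12: "y1 \<in> IA (a - \<alpha> i)" "y2 \<in> IA (a - \<alpha> i)"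
          "q (gE i * y - y * gE i) = q (y1 * gK (\<alpha> i) + y2 * gL (\<alpha> i))"
        using y i unfolding IA_iff[OF a] by blast
      have "q (gE i * (x + fscale c y) - (x + fscale c y) * gE i)
          = q ((gE i * x - x * gE i) + fscale c (gE i * y - y * gE i))"
        by (simp add: FA.scale_right_diff_distrib algebra_simps)
      also have "\<dots> = q ((x1 * gK (\<alpha> i) + x2 * gL (\<alpha> i)) + fscale c (y1 * gK (\<alpha> i) + y2 * gL (\<alpha> i)))"
        by (intro q_add q_scale x12 y12)
      also have "\<dots> = q ((x1 + fscale c y1) * gK (\<alpha> i) + (x2 + fscale c y2) * gL (\<alpha> i))"
        by (simp add: fscale_add_right algebra_simps)
      finally show "\<exists>z1\<in>IA (a - \<alpha> i). \<exists>z2\<in>IA (a - \<alpha> i).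
          q (gE i * (x + fscale c y) - (x + fscale c y) * gE i) = q (z1 * gK (\<alpha> i) + z2 * gL (\<alpha> i))"
        using FA.subspace_add[OF less[OF i]] FA.subspace_scale[OF less[OF i]] x12 y12 by blast
    qed
    show ?thesis
      by (rule FA.subspaceI) (use 0 lin[of _ _ 1] lin[of 0] in auto)
  qed
qed

lemma I_IA: "x \<in> Ut_ideal chi \<Longrightarrow> x \<in> IA a"
  using IA_cong[of x 0 a] FA.subspace_0[OF subspace_IA] by (simp add: q_eq)

lemma IA_Fhom: "x \<in> IA a \<Longrightarrow> \<exists>f\<in>Fhom (- a). q x = q f"
proof (cases "a = 0 \<or> \<not> nonneg a")
  case True
  assume "x \<in> IA a"
  with True show ?thesis
    using FA.subspace_0[OF subspace_Fhom] by (auto simp: IA_trivial q_eq intro!: bexI[of _ 0])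
next
  case False
  assume "x \<in> IA a"
  with False show ?thesis by (subst (asm) IA_iff) auto
qed

lemma IA_K: "x \<in> IA a \<Longrightarrow> q (gK c * x) = q (fscale (chi c (- a)) (x * gK c))"
  and IA_L: "x \<in> IA a \<Longrightarrow> q (gL c * x) = q (fscale (chi a c) (x * gL c))"
proof -
  assume "x \<in> IA a"
  then obtain f where f: "f \<in> Fhom (- a)" "q x = q f" using IA_Fhom by blast
  have "q (gK c * x) = q (gK c * f)" "q (gL c * x) = q (gL c * f)"
    by (auto intro!: q_mult f)
  moreover have "q (fscale b (x * y)) = q (fscale b (f * y))" for b y
    by (intro q_scale q_mult f HOL.refl)
  ultimately show "q (gK c * x) = q (fscale (chi c (- a)) (x * gK c))"
    "q (gL c * x) = q (fscale (chi a c) (x * gL c))"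
    using q_K_hom[OF Fhom_hom[OF f(1)], of c] q_L_hom[OF Fhom_hom[OF f(1)], of c] by simp_all
qed

lemma q_E_F_comm:
  assumes "w \<in> Fwords" "Gen_F i \<notin> set w"
  shows "q (gE i * mon w) = q (mon w * gE i)"
  using assms
proof (induction w)
  case (Cons g w)
  then obtain j where g: "g = Gen_F j" "j \<noteq> i" by auto
  have "q (gE i * gF j * mon w) = q (gF j * gE i * mon w)"
    using q_EF[of i j] g by (intro q_mult[of "gE i * gF j" "gF j * gE i"]) auto
  also have "\<dots> = q (gF j * (gE i * mon w))" by (simp add: mult.assoc)
  also have "\<dots> = q (gF j * (mon w * gE i))" using Cons by (intro q_mult[OF HOL.refl]) auto
  finally show ?case by (simp add: mon_Cons g mult.assoc flip: gdefs)
qed simp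

text \<open>The defining condition speaks only of those \<open>i\<close> with
  \<open>a - \<alpha> i\<close> nonnegative. For the other \<open>i\<close>, words of degree
  \<open>- a\<close> contain no \<open>F_i\<close>, so \<open>E_i\<close> commutes with them and the
  condition holds with zero terms.\<close>

lemma IA_E:
  assumes "x \<in> IA a"
  shows "\<exists>z1\<in>IA (a - \<alpha> i). \<exists>z2\<in>IA (a - \<alpha> i). q (gE i * x - x * gE i) = q (z1 * gK (\<alpha> i) + z2 * gL (\<alpha> i))"
proof -
  have triv: ?thesis if "q (gE i * x - x * gE i) = q 0"
    using that FA.subspace_0[OF subspace_IA] by (intro bexI[of _ 0]) auto
  consider (0) "a = 0 \<or> \<not> nonneg a" | (1) "a \<noteq> 0" "nonneg a" "nonneg (a - \<alpha> i)"
    | (2) "nonneg a" "\<not> nonneg (a - \<alpha> i)" by blast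
  then show ?thesis
  proof cases
    case 0
    then have "x \<in> Ut_ideal chi" using assms by (simp add: IA_trivial)
    then show ?thesis
      by (intro triv) (simp add: q_eq FA.subspace_diff[OF subspace_I] I_mult_left I_mult_right)
  next
    case 1
    then show ?thesis using assms by (simp add: IA_iff)
  next
    case 2
    \<comment> \<open>Subtracting \<open>\<alpha> i\<close> affects only the coefficient at
      \<open>i\<close>, which must drop below 0 from a value that is not negative.\<close>
    have a0: "Poly_Mapping.lookup a i = 0"
    proof (rule antisym)
      obtain j where "Poly_Mapping.lookup (a - \<alpha> i) j < 0" using 2 by (auto simp: nonneg_def not_le)
      moreover have "0 \<le> Poly_Mapping.lookup a j" using 2 by (auto simp: nonneg_def)
      ultimately show "Poly_Mapping.lookup a i \<le> 0"
        by (auto simp: lookup_minus alpha_def lookup_single when_def split: if_splits)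
    qed (use 2 in \<open>simp add: nonneg_def\<close>)
    obtain f where f: "f \<in> Fhom (- a)" "q x = q f" using IA_Fhom assms by blast
    have "q (gE i * f) = q (f * gE i)"
      using f(1) unfolding Fhom_def
    proof (rule q_span_eqI[OF _ flin_mult_left flin_mult_right])
      fix s :: "('k, 'n) free_gen"
      assume "s \<in> mon ` {w \<in> Fwords. wdeg w = - a}"
      then obtain w where w: "s = mon w" "w \<in> Fwords" "wdeg w = - a" by auto
      from lookup_wdeg_Fwords[OF w(2), of i] w(3) a0 have "count_list w (Gen_F i) = 0" by simp
      then have "Gen_F i \<notin> set w" by (simp add: count_list_0_iff)
      then show "q (gE i * s) = q (s * gE i)" using w by (simp add: q_E_F_comm)
    qed
    moreover have "q (gE i * x - x * gE i) = q (gE i * f - f * gE i)"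
      by (intro q_diff q_mult f HOL.refl)
    moreover have "q (gE i * f - f * gE i) = q 0" if "q (gE i * f) = q (f * gE i)"
      using q_diff[OF that HOL.refl, of "f * gE i"] by simp
    ultimately show ?thesis by (intro triv) simp
  qed
qed

lemma nonneg_add_alpha: "nonneg (a :: 'n lattice) \<Longrightarrow> a + \<alpha> j \<noteq> 0 \<and> nonneg (a + \<alpha> j)"
  using ht_nonneg[of a] ht_add[of a "\<alpha> j"] by (auto simp: nonneg_add simp del: add_eq_0_iff_both_eq_0)

text \<open>\<open>I^-\<close> is a two-sided ideal of \<open>U^-\<close>. This is the product rule
  for the bracket with \<open>E_i\<close>, by induction on \<open>a\<close>; the bracket of
  \<open>E_i\<close> with \<open>F_j\<close> adds only multiples of \<open>x K_i\<close> and
  \<open>x L_i\<close>.\<close>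

lemma IA_F:
  assumes "nonneg a" "x \<in> IA a"
  shows "gF j * x \<in> IA (a + \<alpha> j)" "x * gF j \<in> IA (a + \<alpha> j)"
proof -
  have "nonneg a \<longrightarrow> (\<forall>x\<in>IA a. gF j * x \<in> IA (a + \<alpha> j) \<and> x * gF j \<in> IA (a + \<alpha> j))"
  proof (induction a rule: nonneg_induct)
    case (less a)
    show ?case
    proof (intro impI ballI)
      fix x assume a: "nonneg a" and x: "x \<in> IA a"
      obtain f where f: "f \<in> Fhom (- a)" "q x = q f" using IA_Fhom x by blast
      have IH: "gF j * z \<in> IA (a + \<alpha> j - \<alpha> i)" "z * gF j \<in> IA (a + \<alpha> j - \<alpha> i)" if z: "z \<in> IA (a - \<alpha> i)" for z i
      proof -
        have *: "a - \<alpha> i + \<alpha> j = a + \<alpha> j - \<alpha> i" by simp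
        have "gF j * z \<in> IA (a + \<alpha> j - \<alpha> i) \<and> z * gF j \<in> IA (a + \<alpha> j - \<alpha> i)"
        proof (cases "nonneg (a - \<alpha> i)")
          case True
          then show ?thesis using less[of i] z unfolding * by blast
        next
          case False
          then show ?thesis using z by (auto simp: IA_trivial intro: I_IA I_mult_left I_mult_right)
        qed
        then show "gF j * z \<in> IA (a + \<alpha> j - \<alpha> i)" "z * gF j \<in> IA (a + \<alpha> j - \<alpha> i)" by auto
      qed
      have d: "fscale (if i = j then c else 0) x \<in> IA (a + \<alpha> j - \<alpha> i)" for i c
        using FA.subspace_scale[OF subspace_IA x] FA.subspace_0[OF subspace_IA] by auto
      have EF: "q (gE i * gF j - gF j * gE i) = q (if i = j then gL (\<alpha> i) - gK (\<alpha> i) else 0)" for i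
        using q_EF[of i j] by (simp add: q_eq algebra_simps)
      show "gF j * x \<in> IA (a + \<alpha> j) \<and> x * gF j \<in> IA (a + \<alpha> j)"
        unfolding IA_iff[OF conjunct1[OF nonneg_add_alpha[OF a]] conjunct2[OF nonneg_add_alpha[OF a]]]
      proof (intro conjI allI impI)
        show "\<exists>f\<in>Fhom (- (a + \<alpha> j)). q (gF j * x) = q f"
        proof
          show "gF j * f \<in> Fhom (- (a + \<alpha> j))" using Fhom_mult[OF gF_Fhom f(1), of j] by (simp add: add.commute)
          show "q (gF j * x) = q (gF j * f)" by (intro q_mult f HOL.refl)
        qed
        show "\<exists>f\<in>Fhom (- (a + \<alpha> j)). q (x * gF j) = q f"
        proof
          show "f * gF j \<in> Fhom (- (a + \<alpha> j))" using Fhom_mult[OF f(1) gF_Fhom] by simp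
          show "q (x * gF j) = q (f * gF j)" by (intro q_mult f HOL.refl)
        qed
        fix i
        obtain z1 z2 where z: "z1 \<in> IA (a - \<alpha> i)" "z2 \<in> IA (a - \<alpha> i)"
            "q (gE i * x - x * gE i) = q (z1 * gK (\<alpha> i) + z2 * gL (\<alpha> i))"
          using IA_E[OF x] by blast
        \<comment> \<open>The multiples of \<open>x\<close> come from \<open>L_i - K_i\<close>,
          which is carried past \<open>x\<close> to its right.\<close>
        define y1 where "y1 = gF j * z1 - fscale (if i = j then chi (\<alpha> i) (- a) else 0) x"
        define y2 where "y2 = gF j * z2 + fscale (if i = j then chi a (\<alpha> i) else 0) x"
        have "q (gE i * (gF j * x) - gF j * x * gE i) =
            q ((gE i * gF j - gF j * gE i) * x + gF j * (gE i * x - x * gE i))"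
          by (simp add: algebra_simps)
        also have "\<dots> = q ((if i = j then gL (\<alpha> i) - gK (\<alpha> i) else 0) * x + gF j * (z1 * gK (\<alpha> i) + z2 * gL (\<alpha> i)))"
          by (intro q_add q_mult EF z HOL.refl)
        also have "\<dots> = q ((if i = j then gL (\<alpha> i) * x - gK (\<alpha> i) * x else 0) + (gF j * z1 * gK (\<alpha> i) + gF j * z2 * gL (\<alpha> i)))"
          by (simp add: algebra_simps)
        also have "\<dots> = q ((if i = j then fscale (chi a (\<alpha> i)) (x * gL (\<alpha> i)) - fscale (chi (\<alpha> i) (- a)) (x * gK (\<alpha> i)) else 0)
            + (gF j * z1 * gK (\<alpha> i) + gF j * z2 * gL (\<alpha> i)))"
          by (intro q_add HOL.refl) (auto intro!: q_diff IA_K IA_L x)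
        also have "\<dots> = q (y1 * gK (\<alpha> i) + y2 * gL (\<alpha> i))"
          by (simp add: y1_def y2_def algebra_simps)
        finally have e: "q (gE i * (gF j * x) - gF j * x * gE i) = q (y1 * gK (\<alpha> i) + y2 * gL (\<alpha> i))" .
        have "y1 \<in> IA (a + \<alpha> j - \<alpha> i)" "y2 \<in> IA (a + \<alpha> j - \<alpha> i)"
          unfolding y1_def y2_def
          by (intro FA.subspace_diff[OF subspace_IA] FA.subspace_add[OF subspace_IA] IH z d)+
        with e show "\<exists>z1\<in>IA (a + \<alpha> j - \<alpha> i). \<exists>z2\<in>IA (a + \<alpha> j - \<alpha> i).
            q (gE i * (gF j * x) - gF j * x * gE i) = q (z1 * gK (\<alpha> i) + z2 * gL (\<alpha> i))"
          by blast
        \<comment> \<open>Now \<open>L_i - K_i\<close> already stands to the right of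
          \<open>x\<close>; it is the \<open>K_i\<close> and \<open>L_i\<close> from the bracket of
          \<open>x\<close> that are carried past \<open>F_j\<close>.\<close>
        define y3 where "y3 = fscale (chi (\<alpha> i) (- \<alpha> j)) (z1 * gF j) - fscale (if i = j then 1 else 0) x"
        define y4 where "y4 = fscale (qq j i) (z2 * gF j) + fscale (if i = j then 1 else 0) x"
        have "q (gE i * (x * gF j) - x * gF j * gE i) =
            q (x * (gE i * gF j - gF j * gE i) + (gE i * x - x * gE i) * gF j)"
          by (simp add: algebra_simps)
        also have "\<dots> = q (x * (if i = j then gL (\<alpha> i) - gK (\<alpha> i) else 0) + (z1 * gK (\<alpha> i) + z2 * gL (\<alpha> i)) * gF j)"
          by (intro q_add q_mult EF z HOL.refl)
        also have "\<dots> = q (x * (if i = j then gL (\<alpha> i) - gK (\<alpha> i) else 0) + (z1 * (gK (\<alpha> i) * gF j) + z2 * (gL (\<alpha> i) * gF j)))"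
          by (simp add: algebra_simps)
        also have "\<dots> = q (x * (if i = j then gL (\<alpha> i) - gK (\<alpha> i) else 0) +
            (z1 * fscale (chi (\<alpha> i) (- \<alpha> j)) (gF j * gK (\<alpha> i)) + z2 * fscale (qq j i) (gF j * gL (\<alpha> i))))"
          by (intro q_add q_mult q_KF q_LF HOL.refl)
        also have "\<dots> = q (y3 * gK (\<alpha> i) + y4 * gL (\<alpha> i))"
          by (simp add: y3_def y4_def algebra_simps)
        finally have e: "q (gE i * (x * gF j) - x * gF j * gE i) = q (y3 * gK (\<alpha> i) + y4 * gL (\<alpha> i))" .
        have "y3 \<in> IA (a + \<alpha> j - \<alpha> i)" "y4 \<in> IA (a + \<alpha> j - \<alpha> i)"
          unfolding y3_def y4_def
          by (intro FA.subspace_diff[OF subspace_IA] FA.subspace_add[OF subspace_IA]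
              FA.subspace_scale[OF subspace_IA IH(2)] z d)+
        with e show "\<exists>z1\<in>IA (a + \<alpha> j - \<alpha> i). \<exists>z2\<in>IA (a + \<alpha> j - \<alpha> i).
            q (gE i * (x * gF j) - x * gF j * gE i) = q (z1 * gK (\<alpha> i) + z2 * gL (\<alpha> i))"
          by blast
      qed
    qed
  qed
  then show "gF j * x \<in> IA (a + \<alpha> j)" "x * gF j \<in> IA (a + \<alpha> j)" using assms by blast+
qed

end

section \<open>The ideals \<open>J\<^sup>-\<close> and \<open>J\<^sup>- + \<Omega>(J\<^sup>-)\<close>\<close>

text \<open>The algebra homomorphism of free algebras that sends \<open>g\<close> to
  \<open>f g\<close>.\<close>

definition subst :: "('g \<Rightarrow> ('k::field, 'h) free_algebra) \<Rightarrow> ('k, 'g) free_algebra \<Rightarrow> ('k, 'h) free_algebra"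
  where "subst f x = act (\<lambda>g m. f g * m) x 1"

lemma flin_subst: "flin (subst f)"
  using flin_act1 by (simp add: subst_def flin_def)

lemmas subst_simps = flin_simps[OF flin_subst]

lemma subst_mon_Cons: "subst f (mon (g # w)) = f g * subst f (mon w)"
  by (simp add: subst_def)

lemma subst_1 [simp]: "subst f 1 = 1"
  by (simp add: subst_def)

lemma subst_var [simp]: "subst f (var g) = f g"
  by (simp add: subst_def)

lemma subst_const [simp]: "subst f (const c) = const c"
  by (simp add: subst_def flip: const_eq_scale)

lemma subst_mult: "subst f (x * y) = subst f x * subst f y"
proof -
  have "act (\<lambda>g m. f g * m) x m = subst f x * m" for m
  proof (induction x rule: free_algebra_induct)
    case (mon w)
    show ?case by (induction w) (simp_all add: subst_mon_Cons mult.assoc)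
  qed (simp_all add: act_simps subst_simps distrib_right)
  moreover have "subst f (x * y) = act (\<lambda>g m. f g * m) x (subst f y)"
    unfolding subst_def by (rule act_mult[OF flin_mult_left])
  ultimately show ?thesis by simp
qed

fun om :: "'n generator \<Rightarrow> ('k::field, 'n) free_gen"
  where
    "om (Gen_K a) = gK (- a)"
  | "om (Gen_L a) = gL (- a)"
  | "om (Gen_E i) = gF i * gL (- \<alpha> i)"
  | "om (Gen_F i) = gK (- \<alpha> i) * gE i"

text \<open>Obtained by solving the formulas of \<open>om\<close> for \<open>E_i\<close> and
  \<open>F_i\<close>; it is inverse to \<open>om\<close> only modulo the relations.\<close>

fun om_inv :: "'n generator \<Rightarrow> ('k::field, 'n) free_gen"
  where
    "om_inv (Gen_K a) = gK (- a)"
  | "om_inv (Gen_L a) = gL (- a)"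
  | "om_inv (Gen_E i) = gK (- \<alpha> i) * gF i"
  | "om_inv (Gen_F i) = gE i * gL (- \<alpha> i)"

lemma subst_om_gens [simp]:
  "subst om (gK a) = gK (- a)" "subst om (gL a) = gL (- a)"
  "subst om (gE i) = gF i * gL (- \<alpha> i)" "subst om (gF i) = gK (- \<alpha> i) * gE i"
  "subst om_inv (gK a) = gK (- a)" "subst om_inv (gL a) = gL (- a)"
  "subst om_inv (gE i) = gK (- \<alpha> i) * gF i" "subst om_inv (gF i) = gE i * gL (- \<alpha> i)"
  by (subst gdefs, simp)+

lemma hom_mult0: "x \<in> hom b \<Longrightarrow> y \<in> hom 0 \<Longrightarrow> x * y \<in> hom b" "y \<in> hom 0 \<Longrightarrow> x \<in> hom b \<Longrightarrow> y * x \<in> hom b"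
  using hom_mult[of x b y 0] hom_mult[of y 0 x b] by simp_all

context bicharacter
begin

text \<open>The scalar is recorded as nonzero so that \<open>hom_Z\<close> can divide by it.\<close>

lemma Z_hom:
  assumes "z \<in> Zwords" "x \<in> hom b"
  shows "\<exists>s. s \<noteq> 0 \<and> q (mon z * x) = q (fscale s (x * mon z))"
  using assms(1)
proof (induction z)
  case Nil
  then show ?case by (intro exI[of _ 1]) simp
next
  case (Cons g z)
  then obtain s where s: "s \<noteq> 0" "q (mon z * x) = q (fscale s (x * mon z))" by auto
  consider a where "g = Gen_K a" | a where "g = Gen_L a" using Cons.prems by auto
  then obtain t where t: "t \<noteq> 0" "q (var g * x) = q (fscale t (x * var g))"
  proof cases
    case 1
    then show ?thesis using that[of "chi a b" for a] q_K_hom[OF assms(2)] by (simp add: gdefs)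
  next
    case 2
    then show ?thesis using that[of "chi (- b) a" for a] q_L_hom[OF assms(2)] by (simp add: gdefs)
  qed
  have "q (var g * mon z * x) = q (var g * fscale s (x * mon z))"
    unfolding mult.assoc by (intro q_mult s HOL.refl)
  also have "\<dots> = q (fscale s ((var g * x) * mon z))" by (simp add: mult.assoc)
  also have "\<dots> = q (fscale s (fscale t (x * var g) * mon z))" by (intro q_scale q_mult t HOL.refl)
  finally show ?case using s t by (intro exI[of _ "s * t"]) (simp add: mon_Cons mult.assoc)
qed

lemma hom_Z:
  assumes "z \<in> Zwords" "x \<in> hom b"
  shows "\<exists>s. q (x * mon z) = q (fscale s (mon z * x))"
proof -
  obtain s where s: "s \<noteq> 0" "q (mon z * x) = q (fscale s (x * mon z))" using Z_hom[OF assms] by auto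
  from q_scale[OF s(2), of "inverse s"] s(1) show ?thesis by (intro exI[of _ "inverse s"]) simp
qed

definition JA_gens :: "('k, 'n) free_gen set"
  where "JA_gens = {y * mon z * mon e |y a z e. nonneg a \<and> y \<in> IA a \<and> z \<in> Zwords \<and> e \<in> Ewords}"

text \<open>The full preimage of \<open>Jt_minus\<close>, since every \<open>IA a\<close> already
  contains the relations of \<open>Ut\<close>.\<close>

definition JA :: "('k, 'n) free_gen set"
  where "JA = FA.span JA_gens"

lemma subspace_JA: "FA.subspace JA"
  by (simp add: JA_def FA.subspace_span)

lemma Ut_span_image: "Ut_span chi (q ` S) = q ` FA.span S"
  unfolding Ut_span_def by (rule lin_span_image[OF Ut_pres]) (simp add: Ut_const_def Ut_hom fscale_def)

lemma It_minus_total_eq: "It_minus_total chi = q ` FA.span (\<Union>a\<in>{a. nonneg a}. IA a)"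
  unfolding It_minus_total_def It_minus_carrier Ut_span_image[symmetric] image_UN ..

text \<open>The three spans in a product are reduced to their generators one factor at a time, from
  right to left.\<close>

lemma Jt_minus_eq: "Jt_minus chi = q ` JA"
proof -
  let ?Y = "FA.span (\<Union>a\<in>{a. nonneg a}. IA a)" and ?Z = "FA.span (mon ` Zwords)" and ?E = "FA.span (mon ` Ewords)"
  let ?S = "{y * z * x |y z x. y \<in> ?Y \<and> z \<in> ?Z \<and> x \<in> ?E}"
  have "{Y \<otimes>\<^bsub>Ut chi\<^esub> Z \<otimes>\<^bsub>Ut chi\<^esub> X | Y Z X. Y \<in> q ` ?Y \<and> Z \<in> q ` ?Z \<and> X \<in> q ` ?E} = q ` ?S"
    (is "?A = _")
  proof (intro equalityI subsetI)
    fix u assume "u \<in> ?A"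
    then obtain y z x where "u = q y \<otimes>\<^bsub>Ut chi\<^esub> q z \<otimes>\<^bsub>Ut chi\<^esub> q x" "y \<in> ?Y" "z \<in> ?Z" "x \<in> ?E" by blast
    then show "u \<in> q ` ?S" unfolding Ut_hom by blast
  next
    fix u assume "u \<in> q ` ?S"
    then obtain y z x where u: "u = q (y * z * x)" and yzx: "y \<in> ?Y" "z \<in> ?Z" "x \<in> ?E" by blast
    from u have "u = q y \<otimes>\<^bsub>Ut chi\<^esub> q z \<otimes>\<^bsub>Ut chi\<^esub> q x" unfolding Ut_hom .
    with yzx show "u \<in> ?A" by blast
  qed
  then have "Jt_minus chi = q ` FA.span ?S"
    by (simp only: Jt_minus_def It_minus_total_eq Ut_zero_eq Ut_plus_eq Ut_span_image)
  moreover have "FA.span ?S = JA"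
  proof
    have "s \<in> JA" if s: "s \<in> ?S" for s
    proof -
      obtain y z x where s: "s = y * z * x" and y: "y \<in> ?Y" and z: "z \<in> ?Z" and x: "x \<in> ?E"
        using s by blast
      have "y' * mon z' * x \<in> JA" if "y' \<in> IA a" "nonneg a" "z' \<in> Zwords" for y' z' a
        by (rule flin_span_subset[OF flin_mult_left subspace_JA _ x])
          (use that in \<open>auto simp: JA_def JA_gens_def intro!: FA.span_base\<close>)
      then have "y' * z * x \<in> JA" if "y' \<in> IA a" "nonneg a" for y' a
        by (intro flin_span_subset[OF flin_compose[OF flin_mult_right flin_mult_left] subspace_JA _ z])
          (use that in auto)
      then have "y * z * x \<in> JA"
        by (intro flin_span_subset[OF flin_compose[OF flin_mult_right flin_mult_right] subspace_JA _ y]) auto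
      with s show ?thesis by simp
    qed
    then show "FA.span ?S \<subseteq> JA" by (intro FA.span_minimal subspace_JA) auto
    show "JA \<subseteq> FA.span ?S"
      unfolding JA_def JA_gens_def by (intro FA.span_mono) (blast intro: FA.span_base)
  qed
  ultimately show ?thesis by simp
qed

lemma I_JA: "x \<in> Ut_ideal chi \<Longrightarrow> x \<in> JA"
  unfolding JA_def JA_gens_def
  by (rule FA.span_base, rule CollectI, rule exI[of _ x], rule exI[of _ 0], rule exI[of _ "[]"], rule exI[of _ "[]"])
    (simp add: IA_trivial)

lemma JA_cong: "q x = q y \<Longrightarrow> y \<in> JA \<Longrightarrow> x \<in> JA"
  using FA.subspace_add[OF subspace_JA I_JA, of "x - y" y] by (simp add: q_eq)

lemma JA_base: "y \<in> IA a \<Longrightarrow> z \<in> Zwords \<Longrightarrow> e \<in> Ewords \<Longrightarrow> y * mon z * mon e \<in> JA"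
proof (cases "nonneg a")
  case False
  assume "y \<in> IA a"
  with False have "y \<in> Ut_ideal chi" by (simp add: IA_trivial)
  then show ?thesis by (intro I_JA I_mult_right)
qed (auto simp: JA_def JA_gens_def intro!: FA.span_base)

text \<open>Each kind of generator has its own reason: \<open>F_j\<close> is absorbed by
  \<open>IA_F\<close>; \<open>K\<close> and \<open>L\<close> skew-commute with \<open>y\<close> and
  join \<open>z\<close>; \<open>E_i\<close> passes \<open>y\<close> at the cost of a bracket in
  \<open>I^- U^0\<close>, then passes \<open>z\<close> and joins \<open>e\<close>.\<close>

lemma JA_var_left: "x \<in> JA \<Longrightarrow> var g * x \<in> JA"
proof (erule flin_span_subset[OF flin_mult_left subspace_JA, rotated, of _ JA_gens, folded JA_def])
  fix t assume "t \<in> JA_gens"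
  then obtain y a z e where t: "t = y * mon z * mon e" and a: "nonneg a" and y: "y \<in> IA a"
    and z: "z \<in> Zwords" and e: "e \<in> Ewords" unfolding JA_gens_def by blast
  have Z: "var g * t \<in> JA" if g: "[g] \<in> Zwords"
  proof -
    obtain f where f: "f \<in> Fhom (- a)" "q y = q f" using IA_Fhom[OF y] by blast
    obtain s where s: "q (mon [g] * f) = q (fscale s (f * mon [g]))"
      using Z_hom[OF g Fhom_hom[OF f(1)]] by blast
    have "q (var g * t) = q (mon [g] * y * (mon z * mon e))" by (simp add: t mon_Cons mult.assoc)
    also have "\<dots> = q (mon [g] * f * (mon z * mon e))" by (intro q_mult f HOL.refl)
    also have "\<dots> = q (fscale s (f * mon [g]) * (mon z * mon e))" by (intro q_mult s HOL.refl)
    also have "\<dots> = q (fscale s (y * mon [g]) * (mon z * mon e))" by (intro q_mult q_scale f(2)[symmetric] HOL.refl)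
    also have "\<dots> = q (fscale s (y * mon (g # z) * mon e))" by (simp add: mon_Cons mult.assoc)
    finally show ?thesis
      by (rule JA_cong) (intro FA.subspace_scale[OF subspace_JA] JA_base[OF y]; use z e g in simp)
  qed
  show "var g * t \<in> JA"
  proof (cases g)
    case (Gen_F j)
    then show ?thesis using JA_base[OF IA_F(1)[OF a y, of j] z e] by (simp add: t mult.assoc gdefs)
  next
    case (Gen_E i)
    obtain z1 z2 where zz: "z1 \<in> IA (a - \<alpha> i)" "z2 \<in> IA (a - \<alpha> i)"
        "q (gE i * y - y * gE i) = q (z1 * gK (\<alpha> i) + z2 * gL (\<alpha> i))"
      using IA_E[OF y] by blast
    obtain s where s: "q (gE i * mon z) = q (fscale s (mon z * gE i))"
      using hom_Z[OF z gen_hom(3)] by blast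
    have "q (var g * t) = q ((gE i * y - y * gE i) * (mon z * mon e) + y * (gE i * mon z) * mon e)"
      by (simp add: t Gen_E gdefs algebra_simps)
    also have "\<dots> = q ((z1 * gK (\<alpha> i) + z2 * gL (\<alpha> i)) * (mon z * mon e) + y * fscale s (mon z * gE i) * mon e)"
      by (intro q_add q_mult zz s HOL.refl)
    also have "\<dots> = q (z1 * mon (Gen_K (\<alpha> i) # z) * mon e + z2 * mon (Gen_L (\<alpha> i) # z) * mon e
        + fscale s (y * mon z * mon (Gen_E i # e)))"
      by (simp add: mon_Cons gdefs algebra_simps)
    finally show ?thesis
      by (rule JA_cong)
        (intro FA.subspace_add[OF subspace_JA] FA.subspace_scale[OF subspace_JA] JA_base[OF zz(1)]
          JA_base[OF zz(2)] JA_base[OF y]; use z e in simp)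
  qed (use Z in simp_all)
qed

text \<open>Prepares right multiplication by \<open>F_j\<close>: moving it to the front of a word in
  the \<open>E_i\<close> leaves corrections that contain no \<open>F\<close> at all, only terms of
  \<open>U^0 U^+\<close>.\<close>

lemma E_word_F:
  fixes e :: "'n generator list"
  assumes "e \<in> Ewords"
  shows "(mon e * gF j - gF j * mon e :: ('k, 'n) free_gen) \<in> FA.span ({mon z * mon e' |z e'. z \<in> Zwords \<and> e' \<in> Ewords} \<union> Ut_ideal chi)"
    (is "_ \<in> ?D")
  using assms
proof (induction e)
  case (Cons g e)
  then obtain i where g: "g = Gen_E i" and e: "e \<in> Ewords" by auto
  define r :: "('k, 'n) free_gen" where "r = mon e * gF j - gF j * mon e"
  have r: "r \<in> ?D" using Cons e by (simp add: r_def)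
  have ID: "x \<in> ?D" if "q x = q y" "y \<in> ?D" for x y
  proof -
    have "x - y \<in> ?D" using that(1) by (intro FA.span_base) (simp add: q_eq)
    from FA.span_add[OF this that(2)] show ?thesis by simp
  qed
  have base: "mon z * mon e' \<in> ?D" if "z \<in> Zwords" "e' \<in> Ewords" for z e'
    using that by (intro FA.span_base) blast
  have A: "gE i * r \<in> ?D"
    using r
  proof (rule flin_span_subset[OF flin_mult_left FA.subspace_span, rotated])
    fix s assume "s \<in> {mon z * mon e' |z e'. z \<in> Zwords \<and> e' \<in> Ewords} \<union> Ut_ideal chi"
    then consider z e' where "s = mon z * mon e'" "z \<in> Zwords" "e' \<in> Ewords" | "s \<in> Ut_ideal chi" by blast
    then show "gE i * s \<in> ?D"
    proof cases
      case 1
      obtain c where c: "q (gE i * mon z) = q (fscale c (mon z * gE i))"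
        using hom_Z[OF 1(2) gen_hom(3)] by blast
      have "q (gE i * s) = q (gE i * mon z * mon e')" by (simp add: 1 mult.assoc)
      also have "\<dots> = q (fscale c (mon z * gE i) * mon e')" by (intro q_mult c HOL.refl)
      also have "\<dots> = q (fscale c (mon z * mon (Gen_E i # e')))" by (simp add: mon_Cons gdefs mult.assoc)
      finally show ?thesis by (rule ID) (intro FA.span_scale base; use 1 in simp)
    next
      case 2
      then show ?thesis by (intro FA.span_base UnI2 I_mult_left)
    qed
  qed
  have B: "(if i = j then gL (\<alpha> i) - gK (\<alpha> i) else 0) * mon e \<in> ?D"
    using FA.span_diff[OF base[of "[Gen_L (\<alpha> i)]" e] base[of "[Gen_K (\<alpha> i)]" e]] e
    by (auto simp: mon_Cons algebra_simps FA.span_zero gdefs)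
  have C: "q (mon (g # e) * gF j - gF j * mon (g # e)) =
      q ((if i = j then gL (\<alpha> i) - gK (\<alpha> i) else 0) * mon e + gE i * r)"
  proof -
    have EF: "q (gE i * gF j - gF j * gE i) = q (if i = j then gL (\<alpha> i) - gK (\<alpha> i) else 0)"
      using q_EF[of i j] by (simp add: q_eq algebra_simps)
    have "q (mon (g # e) * gF j - gF j * mon (g # e)) = q ((gE i * gF j - gF j * gE i) * mon e + gE i * r)"
      by (simp add: r_def mon_Cons g gdefs algebra_simps)
    also have "\<dots> = q ((if i = j then gL (\<alpha> i) - gK (\<alpha> i) else 0) * mon e + gE i * r)"
      by (intro q_add q_mult EF HOL.refl)
    finally show ?thesis .
  qed
  show ?case by (rule ID[OF C FA.span_add[OF B A]])
qed (simp add: FA.span_zero)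

text \<open>The delicate generator is \<open>F_j\<close>. It is moved left past \<open>e\<close> and
  \<open>z\<close> until it stands next to \<open>y\<close>, where \<open>IA_F\<close> applies; the
  corrections from \<open>E_word_F\<close> are again of the form \<open>U^0 U^+\<close>.\<close>

lemma JA_var_right: "x \<in> JA \<Longrightarrow> x * var g \<in> JA"
proof (erule flin_span_subset[OF flin_mult_right subspace_JA, rotated, of _ JA_gens, folded JA_def])
  fix t assume "t \<in> JA_gens"
  then obtain y a z e where t: "t = y * mon z * mon e" and a: "nonneg a" and y: "y \<in> IA a"
    and z: "z \<in> Zwords" and e: "e \<in> Ewords" unfolding JA_gens_def by blast
  have Z: "t * var g \<in> JA" if g: "[g] \<in> Zwords"
  proof -
    obtain s where s: "q (mon e * mon [g]) = q (fscale s (mon [g] * mon e))"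
      using hom_Z[OF g mon_hom] by blast
    have "q (t * var g) = q (y * mon z * (mon e * mon [g]))" by (simp add: t mult.assoc mon_Cons)
    also have "\<dots> = q (y * mon z * fscale s (mon [g] * mon e))" by (intro q_mult s HOL.refl)
    also have "\<dots> = q (fscale s (y * mon (z @ [g]) * mon e))" by (simp add: mon_append mult.assoc)
    finally show ?thesis
      by (rule JA_cong) (intro FA.subspace_scale[OF subspace_JA] JA_base[OF y]; use z e g in simp)
  qed
  show "t * var g \<in> JA"
  proof (cases g)
    case (Gen_E i)
    have "t * var g = y * mon z * mon (e @ [g])" by (simp add: t mon_append mon_Cons mult.assoc)
    then show ?thesis using JA_base[OF y z, of "e @ [g]"] e Gen_E by simp
  next
    case (Gen_F j)
    obtain s where s: "q (mon z * gF j) = q (fscale s (gF j * mon z))"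
      using Z_hom[OF z gen_hom(4)] by blast
    define r :: "('k, 'n) free_gen" where "r = mon e * gF j - gF j * mon e"
    have 1: "y * mon z * r \<in> JA"
      using E_word_F[OF e, of j] unfolding r_def[symmetric]
    proof (rule flin_span_subset[OF flin_mult_left subspace_JA, rotated])
      fix s assume "s \<in> {mon z * mon e' |z e'. z \<in> Zwords \<and> e' \<in> Ewords} \<union> Ut_ideal chi"
      then consider z' e' where "s = mon z' * mon e'" "z' \<in> Zwords" "e' \<in> Ewords" | "s \<in> Ut_ideal chi" by blast
      then show "y * mon z * s \<in> JA"
      proof cases
        case 1
        then show ?thesis using JA_base[OF y, of "z @ z'" e'] z by (simp add: mon_append mult.assoc)
      qed (intro I_JA I_mult_left)
    qed
    have "q (y * (mon z * gF j) * mon e) = q (y * fscale s (gF j * mon z) * mon e)"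
      by (intro q_mult s HOL.refl)
    also have "\<dots> = q (fscale s (y * gF j * mon z * mon e))" by (simp add: mult.assoc)
    finally have 2: "y * (mon z * gF j) * mon e \<in> JA"
      by (rule JA_cong) (intro FA.subspace_scale[OF subspace_JA] JA_base[OF IA_F(2)[OF a y]] z e)
    have "t * var g = y * (mon z * gF j) * mon e + y * mon z * r"
      by (simp add: t r_def Gen_F gdefs algebra_simps)
    then show ?thesis using 1 2 by (simp add: FA.subspace_add[OF subspace_JA])
  qed (use Z in simp_all)
qed

lemma JA_mult: "x \<in> JA \<Longrightarrow> y * x \<in> JA" "x \<in> JA \<Longrightarrow> x * y \<in> JA"
  by (rule subspace_mult_closed_left[OF subspace_JA JA_var_left] subspace_mult_closed_right[OF subspace_JA JA_var_right];
      assumption)+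

text \<open>Since \<open>[E\<^sub>i, I\<^sup>-] \<subseteq> I\<^sup>- U\<^sup>0\<close>, the factors of \<open>J\<^sup>- = I\<^sup>- U\<^sup>0 U\<^sup>+\<close> can be put in the opposite order.\<close>

definition JA_gens' :: "('k, 'n) free_gen set"
  where "JA_gens' = {mon e * mon z * y |y a z e. nonneg a \<and> y \<in> IA a \<and> z \<in> Zwords \<and> e \<in> Ewords}"

lemma JA_reverse: "JA \<subseteq> FA.span JA_gens'"
  (is "_ \<subseteq> FA.span ?T")
proof -
  have I: "x \<in> FA.span ?T" if "x \<in> Ut_ideal chi" for x
    unfolding JA_gens'_def
    by (rule FA.span_base, rule CollectI, rule exI[of _ x], rule exI[of _ 0], rule exI[of _ "[]"], rule exI[of _ "[]"])
      (simp add: IA_trivial that)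
  have cong: "x \<in> FA.span ?T" if "q x = q y" "y \<in> FA.span ?T" for x y
    using FA.span_add[OF I that(2), of "x - y"] that(1) by (simp add: q_eq)
  have base: "mon e * mon z * y \<in> FA.span ?T" if "y \<in> IA a" "z \<in> Zwords" "e \<in> Ewords" for e z y a
  proof (cases "nonneg a")
    case False
    then have "y \<in> Ut_ideal chi" using that by (simp add: IA_trivial)
    then show ?thesis by (intro I I_mult_left)
  qed (use that in \<open>auto simp: JA_gens'_def intro!: FA.span_base\<close>)
  \<comment> \<open>The reversed span is stable under right multiplication by \<open>E_i\<close>
    because \<open>y E_i = E_i y - [E_i, y]\<close>. The word \<open>e\<close> is afterwards built
    up by appending letters.\<close>
  have E: "x * gE i \<in> FA.span ?T" if "x \<in> FA.span ?T" for x i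
    using that
  proof (rule flin_span_subset[OF flin_mult_right FA.subspace_span, rotated])
    fix t assume "t \<in> ?T"
    then obtain y a z e where t: "t = mon e * mon z * y" and y: "y \<in> IA a"
      and z: "z \<in> Zwords" and e: "e \<in> Ewords" unfolding JA_gens'_def by blast
    obtain z1 z2 where zz: "z1 \<in> IA (a - \<alpha> i)" "z2 \<in> IA (a - \<alpha> i)"
        "q (gE i * y - y * gE i) = q (z1 * gK (\<alpha> i) + z2 * gL (\<alpha> i))"
      using IA_E[OF y] by blast
    obtain s where s: "q (mon z * gE i) = q (fscale s (gE i * mon z))"
      using Z_hom[OF z gen_hom(3)] by blast
    have "\<exists>s. q (z1 * gK (\<alpha> i)) = q (fscale s (gK (\<alpha> i) * z1))"
      using q_scale[OF IA_K[OF zz(1), of "\<alpha> i"], of "inverse (chi (\<alpha> i) (- (a - \<alpha> i)))"]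
      by (intro exI[of _ "inverse (chi (\<alpha> i) (- (a - \<alpha> i)))"]) simp
    moreover have "\<exists>s. q (z2 * gL (\<alpha> i)) = q (fscale s (gL (\<alpha> i) * z2))"
      using q_scale[OF IA_L[OF zz(2), of "\<alpha> i"], of "inverse (chi (a - \<alpha> i) (\<alpha> i))"]
      by (intro exI[of _ "inverse (chi (a - \<alpha> i) (\<alpha> i))"]) simp
    ultimately obtain s1 s2 where s12: "q (z1 * gK (\<alpha> i)) = q (fscale s1 (gK (\<alpha> i) * z1))"
      "q (z2 * gL (\<alpha> i)) = q (fscale s2 (gL (\<alpha> i) * z2))" by blast
    have "q (t * gE i) = q (mon e * (mon z * gE i) * y - mon e * mon z * (gE i * y - y * gE i))"
      by (simp add: t algebra_simps)
    also have "\<dots> = q (mon e * fscale s (gE i * mon z) * y - mon e * mon z * (z1 * gK (\<alpha> i) + z2 * gL (\<alpha> i)))"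
      by (intro q_diff q_mult s zz HOL.refl)
    also have "\<dots> = q (mon e * fscale s (gE i * mon z) * y
        - mon e * mon z * (fscale s1 (gK (\<alpha> i) * z1) + fscale s2 (gL (\<alpha> i) * z2)))"
      by (intro q_diff q_add q_mult s12 HOL.refl)
    also have "\<dots> = q (fscale s (mon (e @ [Gen_E i]) * mon z * y)
        - (fscale s1 (mon e * mon (z @ [Gen_K (\<alpha> i)]) * z1) + fscale s2 (mon e * mon (z @ [Gen_L (\<alpha> i)]) * z2)))"
      by (simp add: mon_append mon_Cons gdefs algebra_simps)
    finally show "t * gE i \<in> FA.span ?T"
      by (rule cong)
        (intro FA.span_diff FA.span_add FA.span_scale base[OF y] base[OF zz(1)] base[OF zz(2)]; use z e in simp)
  qed
  have "y * mon z * mon e \<in> FA.span ?T" if y: "y \<in> IA a" and z: "z \<in> Zwords" and e: "e \<in> Ewords" for y a z e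
    using e
  proof (induction e rule: rev_induct)
    case Nil
    obtain f where f: "f \<in> Fhom (- a)" "q y = q f" using IA_Fhom[OF y] by blast
    obtain s where s: "q (f * mon z) = q (fscale s (mon z * f))"
      using hom_Z[OF z Fhom_hom[OF f(1)]] by blast
    have "q (y * mon z) = q (f * mon z)" by (intro q_mult f HOL.refl)
    also have "\<dots> = q (fscale s (mon z * y))" unfolding s by (intro q_scale q_mult HOL.refl f(2)[symmetric])
    finally show ?case using base[OF y z, of "[]"] by (auto intro: cong FA.span_scale)
  next
    case (snoc g e)
    then obtain i where "g = Gen_E i" by auto
    then show ?case using E[of "y * mon z * mon e" i] snoc by (simp add: mon_append mon_Cons mult.assoc gdefs)
  qed
  then show ?thesis unfolding JA_def JA_gens_def by (intro FA.span_minimal FA.subspace_span) blast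
qed

end

context bicharacter
begin

section \<open>The automorphism \<open>Omega\<close>\<close>

lemma hom_gens: "gF i * gL a \<in> hom (- \<alpha> i)" "gK a * gE i \<in> hom (\<alpha> i)" "gK a * gF i \<in> hom (- \<alpha> i)" "gE i * gL a \<in> hom (\<alpha> i)"
  by (rule hom_mult0(1)[OF gen_hom(4) gen_hom(2)] hom_mult0(2)[OF gen_hom(1) gen_hom(3)]
      hom_mult0(2)[OF gen_hom(1) gen_hom(4)] hom_mult0(1)[OF gen_hom(3) gen_hom(2)])+

lemma q_K_hom': "x \<in> hom b \<Longrightarrow> q (gK (- a) * x) = q (fscale (chi a (- b)) (x * gK (- a)))"
  and q_L_hom': "x \<in> hom b \<Longrightarrow> q (gL (- a) * x) = q (fscale (chi b a) (x * gL (- a)))"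
  by (simp_all add: q_K_hom q_L_hom chi_minus_left chi_minus_right)

text \<open>The computation shared by \<open>om\<close> and \<open>om_inv\<close>. For
  \<open>i = j\<close> the outer factors cancel \<open>K_i\<close> and \<open>L_i\<close>
  respectively, which leaves the right-hand side of the transformed relation.\<close>

lemma K_FE_L:
  "q (gK (- \<alpha> j) * (gF i * gE j) * gL (- \<alpha> i)) = q (gK (- \<alpha> j) * (gE j * gF i) * gL (- \<alpha> i)
    + (if i = j then gL (- \<alpha> i) - gK (- \<alpha> i) else 0))"
proof -
  have "q (gF i * gE j) = q (gE j * gF i - (if i = j then gL (\<alpha> i) - gK (\<alpha> i) else 0))"
    using q_EF[of j i] by (auto simp: q_eq algebra_simps dest: FA.subspace_neg[OF subspace_I])
  then have "q (gK (- \<alpha> j) * (gF i * gE j) * gL (- \<alpha> i)) =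
      q (gK (- \<alpha> j) * (gE j * gF i - (if i = j then gL (\<alpha> i) - gK (\<alpha> i) else 0)) * gL (- \<alpha> i))"
    by (intro q_mult HOL.refl)
  also have "\<dots> = q (gK (- \<alpha> j) * (gE j * gF i) * gL (- \<alpha> i)
      - (if i = j then gK (- \<alpha> i) * (gL (\<alpha> i) * gL (- \<alpha> i)) - gK (- \<alpha> i) * gK (\<alpha> i) * gL (- \<alpha> i) else 0))"
    by (simp add: algebra_simps)
  also have "\<dots> = q (gK (- \<alpha> j) * (gE j * gF i) * gL (- \<alpha> i)
      - (if i = j then gK (- \<alpha> i) * 1 - 1 * gL (- \<alpha> i) else 0))"
  proof (intro q_diff HOL.refl)
    have "q (gL (\<alpha> i) * gL (- \<alpha> i)) = q 1" "q (gK (- \<alpha> i) * gK (\<alpha> i)) = q 1"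
      by (simp_all add: q_LL q_KK q_L0 q_K0)
    then have "q (gK (- \<alpha> i) * (gL (\<alpha> i) * gL (- \<alpha> i)) - gK (- \<alpha> i) * gK (\<alpha> i) * gL (- \<alpha> i)) =
        q (gK (- \<alpha> i) * 1 - 1 * gL (- \<alpha> i))"
      by (intro q_diff q_mult HOL.refl)
    then show "q (if i = j then gK (- \<alpha> i) * (gL (\<alpha> i) * gL (- \<alpha> i)) - gK (- \<alpha> i) * gK (\<alpha> i) * gL (- \<alpha> i) else 0) =
      q (if i = j then gK (- \<alpha> i) * 1 - 1 * gL (- \<alpha> i) else 0)"
      by auto
  qed
  finally show ?thesis by (simp add: algebra_simps)
qed

text \<open>The scalar from moving \<open>gL (- \<alpha> i)\<close> past \<open>om (Gen_F j)\<close>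
  is inverse to the one from moving \<open>gK (- \<alpha> j)\<close> past \<open>gF i\<close>; what
  remains is \<open>K_FE_L\<close>.\<close>

lemma om_EF: "q (om (Gen_E i) * om (Gen_F j)) = q (om (Gen_F j) * om (Gen_E i) + (if i = j then gL (- \<alpha> i) - gK (- \<alpha> i) else 0))"
proof -
  have "q (gF i * (gL (- \<alpha> i) * (gK (- \<alpha> j) * gE j))) = q (gF i * fscale (qq j i) (gK (- \<alpha> j) * gE j * gL (- \<alpha> i)))"
    by (intro q_mult q_L_hom' hom_gens HOL.refl)
  also have "\<dots> = q (fscale (qq j i) (gF i * gK (- \<alpha> j)) * (gE j * gL (- \<alpha> i)))"
    by (simp add: mult.assoc)
  also have "\<dots> = q (fscale (qq j i) (fscale (inverse (chi (- \<alpha> j) (- \<alpha> i))) (gK (- \<alpha> j) * gF i)) * (gE j * gL (- \<alpha> i)))"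
    by (intro q_mult q_scale q_hom_K gen_hom HOL.refl)
  also have "\<dots> = q (gK (- \<alpha> j) * (gF i * gE j) * gL (- \<alpha> i))"
    by (simp add: mult.assoc chi_minus_left chi_minus_right)
  finally show ?thesis unfolding om.simps K_FE_L by (simp add: mult.assoc)
qed

lemma om_inv_EF: "q (om_inv (Gen_E i) * om_inv (Gen_F j)) = q (om_inv (Gen_F j) * om_inv (Gen_E i) + (if i = j then gL (- \<alpha> i) - gK (- \<alpha> i) else 0))"
proof -
  have "q (gE j * (gL (- \<alpha> j) * (gK (- \<alpha> i) * gF i))) = q (gE j * fscale (chi (- \<alpha> i) (\<alpha> j)) (gK (- \<alpha> i) * gF i * gL (- \<alpha> j)))"
    by (intro q_mult q_L_hom' hom_gens HOL.refl)
  also have "\<dots> = q (fscale (chi (- \<alpha> i) (\<alpha> j)) (gE j * gK (- \<alpha> i)) * (gF i * gL (- \<alpha> j)))"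
    by (simp add: mult.assoc)
  also have "\<dots> = q (fscale (chi (- \<alpha> i) (\<alpha> j)) (fscale (inverse (chi (- \<alpha> i) (\<alpha> j))) (gK (- \<alpha> i) * gE j)) * (gF i * gL (- \<alpha> j)))"
    by (intro q_mult q_scale q_hom_K gen_hom HOL.refl)
  also have "\<dots> = q (gK (- \<alpha> i) * (gE j * gF i) * gL (- \<alpha> j))"
    by (simp add: mult.assoc)
  finally have 1: "q (om_inv (Gen_F j) * om_inv (Gen_E i)) = q (gK (- \<alpha> i) * (gE j * gF i) * gL (- \<alpha> j))"
    by (simp add: mult.assoc)
  have 2: "q (om_inv (Gen_E i) * om_inv (Gen_F j)) = q (gK (- \<alpha> i) * (gF i * gE j) * gL (- \<alpha> j))"
    by (simp add: mult.assoc)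
  have "q (gK (- \<alpha> i) * (gF i * gE j) * gL (- \<alpha> j)) =
    q (gK (- \<alpha> i) * (gE j * gF i) * gL (- \<alpha> j) + (if i = j then gL (- \<alpha> i) - gK (- \<alpha> i) else 0))"
  proof (cases "i = j")
    case True
    then show ?thesis using K_FE_L[of j i] by simp
  next
    case False
    then have "q (gF i * gE j) = q (gE j * gF i)" using q_EF[of j i] by simp
    then show ?thesis using False by (auto intro!: q_mult)
  qed
  also have "\<dots> = q (om_inv (Gen_F j) * om_inv (Gen_E i) + (if i = j then gL (- \<alpha> i) - gK (- \<alpha> i) else 0))"
    by (intro q_add 1[symmetric] HOL.refl)
  finally show ?thesis unfolding 2 .
qed

text \<open>The relations that involve \<open>K\<close> and \<open>L\<close> see only the degrees of
  the images of \<open>E_i\<close> and \<open>F_i\<close>. Hence \<open>om\<close> and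
  \<open>om_inv\<close> can be treated together, with the relation between \<open>E_i\<close> and
  \<open>F_j\<close> as the one hypothesis to verify for each.\<close>

lemma subst_respects:
  assumes K: "\<And>a. f (Gen_K a) = gK (- a)" and L: "\<And>a. f (Gen_L a) = gL (- a)"
    and E: "\<And>i. f (Gen_E i) \<in> hom (- \<alpha> i)" and F: "\<And>i. f (Gen_F i) \<in> hom (\<alpha> i)"
    and EF: "\<And>i j. q (f (Gen_E i) * f (Gen_F j)) = q (f (Gen_F j) * f (Gen_E i) + (if i = j then gL (- \<alpha> i) - gK (- \<alpha> i) else 0))"
    and x: "q x = q y"
  shows "q (subst f x) = q (subst f y)"
proof -
  have "Ut_ideal chi \<subseteq> {x. subst f x \<in> Ut_ideal chi}"
  proof (rule I_least)
    show "FA.subspace {x. subst f x \<in> Ut_ideal chi}" by (rule flin_subspace[OF flin_subst subspace_I])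
    fix x y assume "x \<in> {x. subst f x \<in> Ut_ideal chi}"
    then show "y * x \<in> {x. subst f x \<in> Ut_ideal chi}" "x * y \<in> {x. subst f x \<in> Ut_ideal chi}"
      by (simp_all add: subst_mult I_mult_left I_mult_right)
  next
    have EF': "f (Gen_E i) * f (Gen_F j) - f (Gen_F j) * f (Gen_E i)
        - (if i = j then gL (- \<alpha> j) - gK (- \<alpha> j) else 0) \<in> Ut_ideal chi" for i j
      using EF[of i j] by (cases "i = j") (simp_all add: q_eq diff_diff_eq)
    have KK': "gK (- a) * gK (- b) - gK (- a - b) \<in> Ut_ideal chi"
      and LL': "gL (- a) * gL (- b) - gL (- a - b) \<in> Ut_ideal chi" for a b
      using q_KK[of "- a" "- b"] q_LL[of "- a" "- b"] by (simp_all add: q_eq)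
    have if_subst: "subst f (if b then x else 0) = (if b then subst f x else 0)" for b x
      by (simp add: subst_simps)
    show "relators chi \<subseteq> {x. subst f x \<in> Ut_ideal chi}"
      unfolding relators_def
      using q_K0 q_L0 q_KK q_LL q_KL q_K_hom'[OF E] q_L_hom'[OF E] q_K_hom'[OF F] q_L_hom'[OF F]
      by (auto simp: subst_simps subst_mult if_subst K L EF' KK' LL' mult.assoc q_eq chi_minus_left chi_minus_right
          add.commute simp flip: fscale_def cong: if_cong split del: if_split)
  qed
  then show ?thesis using x by (auto simp: q_eq flin_diff[OF flin_subst, symmetric])
qed

lemma subst_om_cong: "q x = q y \<Longrightarrow> q (subst om x) = q (subst om y)"
  by (erule subst_respects[rotated -1]) (simp_all only: om.simps hom_gens om_EF[unfolded om.simps])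

lemma subst_om_inv_cong: "q x = q y \<Longrightarrow> q (subst om_inv x) = q (subst om_inv y)"
  by (erule subst_respects[rotated -1]) (simp_all only: om_inv.simps hom_gens om_inv_EF[unfolded om_inv.simps])

lemma subst_id:
  assumes "\<And>g. q (subst f (subst h (var g))) = q (var g)"
  shows "q (subst f (subst h x)) = q x"
proof (induction x rule: free_algebra_induct)
  case (mon w)
  show ?case
  proof (induction w)
    case (Cons g w)
    then show ?case using q_mult[OF assms Cons] by (simp add: mon_Cons subst_mult)
  qed simp
next
  case (add x y)
  then show ?case using q_add[OF add] by (simp add: subst_simps)
next
  case (scale c x)
  then show ?case using q_scale[OF scale] by (simp add: subst_simps)
qed

lemma q_KL_cancel: "q (gK a * (gK (- a) * x)) = q x" "q (x * gL (- a) * gL a) = q x"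
proof -
  have "q (gK a * gK (- a) * x) = q (1 * x)" by (rule q_mult) (simp_all add: q_KK q_K0)
  then show "q (gK a * (gK (- a) * x)) = q x" by (simp add: mult.assoc)
  have "q (x * (gL (- a) * gL a)) = q (x * 1)" by (rule q_mult) (simp_all add: q_LL q_L0)
  then show "q (x * gL (- a) * gL a) = q x" by (simp add: mult.assoc)
qed

lemma subst_om_om_inv: "q (subst om (subst om_inv x)) = q x"
  by (rule subst_id, case_tac g) (simp_all add: subst_mult q_KL_cancel, simp_all add: gdefs)

lemma subst_om_inv_om: "q (subst om_inv (subst om x)) = q x"
  by (rule subst_id, case_tac g) (simp_all add: subst_mult q_KL_cancel, simp_all add: gdefs)

text \<open>\<open>Omega\<close> is a choice, so nothing can be said about it before an automorphism
  is exhibited. Bijectivity comes from \<open>om_inv\<close>.\<close>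

lemma is_Omega_exists: "\<exists>f. is_Omega chi f"
proof
  define f where "f = (\<lambda>X. q (subst om (SOME x. q x = X)))"
  have f: "f (q x) = q (subst om x)" for x
    unfolding f_def by (rule subst_om_cong) (rule someI[of _ x], simp)
  have "f \<in> ring_hom (Ut chi) (Ut chi)"
    by (rule ring_hom_memI) (auto simp: carrier_Ut f Ut_hom subst_simps subst_mult)
  moreover have "bij_betw f (carrier (Ut chi)) (carrier (Ut chi))"
    unfolding bij_betw_def carrier_Ut
  proof
    show "inj_on f (range q)"
    proof (rule inj_onI)
      fix X Y assume "X \<in> range q" "Y \<in> range q" "f X = f Y"
      then obtain x y where xy: "X = q x" "Y = q y" "q (subst om x) = q (subst om y)" by (auto simp: f)
      from subst_om_inv_cong[OF xy(3)] xy show "X = Y" by (simp add: subst_om_inv_om)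
    qed
    show "f ` range q = range q"
      using subst_om_om_inv by (fastforce simp: f image_iff)
  qed
  ultimately have "f \<in> ring_iso (Ut chi) (Ut chi)" by (simp add: ring_iso_def)
  then show "is_Omega chi f"
    unfolding is_Omega_def Ut_const_def Kt_def Lt_def Et_def Ft_def
    by (simp add: f Ut_hom flip: gdefs)
qed

lemma Omega_q: "Omega chi (q x) = q (subst om x)"
proof -
  have O: "is_Omega chi (Omega chi)"
    unfolding Omega_def by (rule someI_ex[OF is_Omega_exists])
  then have h: "Omega chi \<in> ring_hom (Ut chi) (Ut chi)" by (simp add: is_Omega_def ring_iso_def)
  have add: "Omega chi (q (x + y)) = Omega chi (q x) \<oplus>\<^bsub>Ut chi\<^esub> Omega chi (q y)"
    and mult: "Omega chi (q (x * y)) = Omega chi (q x) \<otimes>\<^bsub>Ut chi\<^esub> Omega chi (q y)" for x y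
    using ring_hom_add[OF h, of "q x" "q y"] ring_hom_mult[OF h, of "q x" "q y"]
    by (auto simp: carrier_Ut Ut_hom)
  have one: "Omega chi (q 1) = q 1" using ring_hom_one[OF h] by (simp add: Ut_hom)
  have c: "Omega chi (q (const c)) = q (const c)" for c
    using O by (simp add: is_Omega_def Ut_const_def)
  have g: "Omega chi (q (var g)) = q (om g)" for g
    using O by (cases g) (simp_all add: is_Omega_def Kt_def Lt_def Et_def Ft_def Ut_hom flip: gdefs)
  show ?thesis
  proof (induction x rule: free_algebra_induct)
    case (mon w)
    show ?case
      by (induction w) (simp_all add: one mon_Cons mult subst_mult g Ut_hom)
  next
    case (scale a x)
    then show ?case by (simp add: fscale_def mult c subst_mult Ut_hom)
  qed (simp add: add subst_simps Ut_hom)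
qed

text \<open>The full preimage of \<open>U_ideal\<close> in the free algebra.\<close>

definition UA :: "('k, 'n) free_gen set"
  where "UA = {a + subst om b |a b. a \<in> JA \<and> b \<in> JA}"

lemma UAI: "a \<in> JA \<Longrightarrow> b \<in> JA \<Longrightarrow> a + subst om b \<in> UA"
  by (auto simp: UA_def)

lemma subspace_UA: "FA.subspace UA"
proof (rule FA.subspaceI)
  show "0 \<in> UA" using UAI[of 0 0] FA.subspace_0[OF subspace_JA] by (simp add: subst_simps)
  fix x y assume "x \<in> UA" "y \<in> UA"
  then obtain a b c d where "x = a + subst om b" "y = c + subst om d" "a \<in> JA" "b \<in> JA" "c \<in> JA" "d \<in> JA"
    unfolding UA_def by blast
  then show "x + y \<in> UA"
    using UAI[of "a + c" "b + d"] FA.subspace_add[OF subspace_JA] by (simp add: subst_simps algebra_simps)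
next
  fix c x assume "x \<in> UA"
  then obtain a b where "x = a + subst om b" "a \<in> JA" "b \<in> JA" unfolding UA_def by blast
  then show "fscale c x \<in> UA"
    using UAI[of "fscale c a" "fscale c b"] FA.subspace_scale[OF subspace_JA]
    by (simp add: subst_simps fscale_add_right)
qed

lemma I_UA: "x \<in> Ut_ideal chi \<Longrightarrow> x \<in> UA"
  using UAI[OF I_JA, of x 0] FA.subspace_0[OF subspace_JA] by (simp add: subst_simps)

lemma UA_cong: "q x = q y \<Longrightarrow> y \<in> UA \<Longrightarrow> x \<in> UA"
  using FA.subspace_add[OF subspace_UA I_UA, of "x - y" y] by (simp add: q_eq)

text \<open>For the second summand, \<open>y\<close> is replaced by the congruent
  \<open>subst om (subst om_inv y)\<close>, so that the product can be taken inside
  \<open>om\<close>, where \<open>JA\<close> is an ideal.\<close>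

lemma UA_mult:
  assumes "x \<in> UA"
  shows "y * x \<in> UA" "x * y \<in> UA"
proof -
  obtain a b where x: "x = a + subst om b" "a \<in> JA" "b \<in> JA" using assms unfolding UA_def by blast
  have "q (y * x) = q (y * a + subst om (subst om_inv y) * subst om b)"
    unfolding x distrib_left by (intro q_add q_mult subst_om_om_inv[symmetric] HOL.refl)
  also have "\<dots> = q (y * a + subst om (subst om_inv y * b))" by (simp add: subst_mult)
  finally show "y * x \<in> UA" by (rule UA_cong) (intro UAI JA_mult x)
  have "q (x * y) = q (a * y + subst om b * subst om (subst om_inv y))"
    unfolding x distrib_right by (intro q_add q_mult subst_om_om_inv[symmetric] HOL.refl)
  also have "\<dots> = q (a * y + subst om (b * subst om_inv y))" by (simp add: subst_mult)
  finally show "x * y \<in> UA" by (rule UA_cong) (intro UAI JA_mult x)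
qed

lemma U_ideal_eq: "U_ideal chi = q ` UA"
proof -
  have "Omega chi ` q ` JA = q ` subst om ` JA" by (simp add: image_image Omega_q)
  then show ?thesis
    by (simp add: U_ideal_def Jt_minus_eq pres_set_add[OF Ut_pres])
      (rule arg_cong[of _ _ "image q"], auto simp: UA_def)
qed

lemma q_U_ideal: "q x \<in> U_ideal chi \<longleftrightarrow> x \<in> UA"
  unfolding U_ideal_eq using UA_cong by blast

definition rho :: "('k, 'n) free_gen \<Rightarrow> ('k, 'n) U_elem"
  where "rho x = U_class chi (q x)"

lemma pres_U: "pres_ring (U chi) rho UA"
proof -
  have "pres_sub q (U_ideal chi)"
    by (rule pres_subI)
      (simp_all add: q_U_ideal FA.subspace_0[OF subspace_UA] FA.subspace_diff[OF subspace_UA],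
        auto simp: U_ideal_eq)
  from pres_ring_quotient[OF pres_Ut this] show ?thesis
    by (simp add: U_def rho_def[abs_def] U_class_def[abs_def] q_U_ideal UA_mult)
qed

end

section \<open>The Verma module before factoring out the radicals\<close>

text \<open>Its underlying space is the free algebra on the index set, the word \<open>w\<close> standing for \<open>F\<^sub>w v\<close>.\<close>

definition wt :: "'n list \<Rightarrow> 'n lattice"
  where "wt w = (\<Sum>i\<leftarrow>w. \<alpha> i)"

lemma wt_simps [simp]: "wt [] = 0" "wt (i # w) = \<alpha> i + wt w" "wt (u @ w) = wt u + wt w"
  by (simp_all add: wt_def)

definition wspace :: "'n lattice \<Rightarrow> ('k::field, 'n) free_algebra set"
  where "wspace b = FA.span (mon ` {w. wt w = b})"

definition eps :: "('k::field, 'g) free_algebra \<Rightarrow> 'k"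
  where "eps m = Poly_Mapping.lookup m (Word [])"

lemma eps_simps [simp]:
  "eps 0 = 0" "eps (x + y) = eps x + eps y" "eps (x - y) = eps x - eps y" "eps (fscale c x) = c * eps x"
  by (simp_all add: eps_def lookup_add lookup_minus)

lemma eps_mon [simp]: "eps (mon w) = (if w = [] then 1 else 0)"
  by (auto simp: eps_def mon_def lookup_single when_def)

lemma eps_1 [simp]: "eps 1 = 1"
  using eps_mon[of "[]"] by simp

lemma eps_var_mult [simp]: "eps (var i * m) = 0"
  by (induction m rule: free_algebra_induct) (simp_all add: distrib_left flip: mon_Cons)

lemma subspace_wspace: "FA.subspace (wspace b)"
  by (simp add: wspace_def FA.subspace_span)

lemma mon_wspace: "mon w \<in> wspace (wt w)"
  unfolding wspace_def by (intro FA.span_base) auto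

lemma var_wspace: "m \<in> wspace b \<Longrightarrow> var i * m \<in> wspace (b + \<alpha> i)"
  unfolding wspace_def[of b]
  by (rule flin_span_subset[OF flin_mult_left subspace_wspace])
    (use mon_wspace[of "i # w" for w] in \<open>auto simp: add.commute simp flip: mon_Cons\<close>)

lemma eps_wspace: "m \<in> wspace b \<Longrightarrow> b \<noteq> 0 \<Longrightarrow> eps m = 0"
  unfolding wspace_def
  by (induction rule: FA.span_induct_alt) (auto split: if_splits)

text \<open>\<open>lK\<close> and \<open>lL\<close> are the values of the highest weight on the
  \<open>K\<close> and the \<open>L\<close>. Being multiplicative suffices to build the module,
  before any character of \<open>U_zero\<close> is at hand.\<close>

locale highest_weight = bicharacter chi for chi :: "('k::field, 'n::finite) bichar" +
  fixes lK lL :: "'n lattice \<Rightarrow> 'k"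
  assumes lK_0: "lK 0 = 1" and lK_add: "lK (a + b) = lK a * lK b"
    and lL_0: "lL 0 = 1" and lL_add: "lL (a + b) = lL a * lL b"
begin

definition Kop :: "'n lattice \<Rightarrow> ('k, 'n) free_algebra \<Rightarrow> ('k, 'n) free_algebra"
  where "Kop a = lift (\<lambda>w. fscale (lK a * chi a (- wt w)) (mon w))"

definition Lop :: "'n lattice \<Rightarrow> ('k, 'n) free_algebra \<Rightarrow> ('k, 'n) free_algebra"
  where "Lop a = lift (\<lambda>w. fscale (lL a * chi (wt w) a) (mon w))"

text \<open>The relation between \<open>E_i\<close> and \<open>F_j\<close>, read as a rule for
  applying \<open>E_i\<close> to \<open>F_j F_w v\<close>.\<close>

fun Eword :: "'n \<Rightarrow> 'n list \<Rightarrow> ('k, 'n) free_algebra"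
  where
    "Eword i [] = 0"
  | "Eword i (j # w) = var j * Eword i w + (if i = j then Lop (\<alpha> i) (mon w) - Kop (\<alpha> i) (mon w) else 0)"

definition Eop :: "'n \<Rightarrow> ('k, 'n) free_algebra \<Rightarrow> ('k, 'n) free_algebra"
  where "Eop i = lift (Eword i)"

lemma flin_ops: "flin (Kop a)" "flin (Lop a)" "flin (Eop i)"
  by (simp_all add: Kop_def Lop_def Eop_def flin_lift)

lemmas op_simps = flin_simps[OF flin_ops(1)] flin_simps[OF flin_ops(2)] flin_simps[OF flin_ops(3)]

lemma Kop_mon: "Kop a (mon w) = fscale (lK a * chi a (- wt w)) (mon w)"
  and Lop_mon: "Lop a (mon w) = fscale (lL a * chi (wt w) a) (mon w)"
  by (simp_all add: Kop_def Lop_def)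

lemma Kop_wspace: "m \<in> wspace b \<Longrightarrow> Kop a m = fscale (lK a * chi a (- b)) m"
  and Lop_wspace: "m \<in> wspace b \<Longrightarrow> Lop a m = fscale (lL a * chi b a) m"
  unfolding wspace_def
  by (induction rule: FA.span_induct_alt; auto simp: op_simps Kop_mon Lop_mon fscale_add_right mult.commute)+

lemma Eop_mon_Cons: "Eop i (mon (j # w)) = var j * Eop i (mon w) + (if i = j then Lop (\<alpha> i) (mon w) - Kop (\<alpha> i) (mon w) else 0)"
  by (simp add: Eop_def)

lemma Eop_1 [simp]: "Eop i 1 = 0"
  using lift_mon[of "Eword i" "[]"] by (simp add: Eop_def)

lemma Eop_var: "Eop i (var j * m) = var j * Eop i m + (if i = j then Lop (\<alpha> i) m - Kop (\<alpha> i) m else 0)"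
  by (induction m rule: free_algebra_induct)
    (auto simp: Eop_mon_Cons op_simps distrib_left fscale_add_right FA.scale_right_diff_distrib simp flip: mon_Cons)

lemma Eop_wspace: "m \<in> wspace b \<Longrightarrow> Eop i m \<in> wspace (b - \<alpha> i)"
  unfolding wspace_def[of b]
proof (erule flin_span_subset[OF flin_ops(3) subspace_wspace, rotated])
  fix s :: "('k, 'n) free_algebra"
  assume "s \<in> mon ` {w. wt w = b}"
  then obtain w where w: "s = mon w" "wt w = b" by auto
  have "Eop i (mon w) \<in> wspace (wt w - \<alpha> i)"
  proof (induction w)
    case Nil
    then show ?case by (simp add: FA.subspace_0[OF subspace_wspace])
  next
    case (Cons j w)
    have "wt w - \<alpha> i + \<alpha> j = wt (j # w) - \<alpha> i" by simp
    with var_wspace[OF Cons, of j] have 1: "var j * Eop i (mon w) \<in> wspace (wt (j # w) - \<alpha> i)" by metis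
    have "Lop (\<alpha> i) (mon w) - Kop (\<alpha> i) (mon w) \<in> wspace (wt w)"
      unfolding Lop_mon Kop_mon
      by (intro FA.subspace_diff[OF subspace_wspace] FA.subspace_scale[OF subspace_wspace] mon_wspace)
    then have 2: "(if i = j then Lop (\<alpha> i) (mon w) - Kop (\<alpha> i) (mon w) else 0) \<in> wspace (wt (j # w) - \<alpha> i)"
      by (auto simp: FA.subspace_0[OF subspace_wspace])
    from FA.subspace_add[OF subspace_wspace 1 2] show ?case by (simp only: Eop_mon_Cons)
  qed
  with w show "Eop i s \<in> wspace (b - \<alpha> i)" by simp
qed

lemma foldr_Eop_wspace: "m \<in> wspace b \<Longrightarrow> foldr Eop w m \<in> wspace (b - wt w)"
proof (induction w)
  case (Cons i w)
  from Eop_wspace[OF Cons(1)[OF Cons(2)], of i] show ?case by (simp add: diff_diff_eq add.commute)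
qed simp

lemma Eop_power_wspace: "m \<in> wspace b \<Longrightarrow> (Eop i ^^ j) m \<in> wspace (b - wt (replicate j i))"
  using foldr_Eop_wspace[of m b "replicate j i"] by simp

lemma Kop_Eop: "Kop a (Eop i m) = fscale (chi a (\<alpha> i)) (Eop i (Kop a m))"
  and Lop_Eop: "Lop a (Eop i m) = fscale (chi (- \<alpha> i) a) (Eop i (Lop a m))"
  by (induction m rule: free_algebra_induct;
      simp add: Kop_wspace[OF Eop_wspace[OF mon_wspace]] Lop_wspace[OF Eop_wspace[OF mon_wspace]]
        Kop_mon Lop_mon op_simps fscale_add_right chi_minus_left chi_minus_right chi_add_right chi_add_left
        diff_conv_add_uminus mult.assoc mult.left_commute mult.commute del: add_uminus_conv_diff)+

lemma Kop_var: "Kop a (var i * m) = fscale (chi a (- \<alpha> i)) (var i * Kop a m)"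
  and Lop_var: "Lop a (var i * m) = fscale (chi (\<alpha> i) a) (var i * Lop a m)"
  by (induction m rule: free_algebra_induct;
      simp add: Kop_mon Lop_mon op_simps fscale_add_right chi_minus_right chi_add_right chi_add_left distrib_left
       mult.assoc mult.left_commute mult.commute del: minus_add_distrib flip: mon_Cons)+

section \<open>The action of \<open>Ut\<close> on \<open>M\<close> and the radical of
  \<open>M\<close>\<close>

fun gact :: "'n generator \<Rightarrow> ('k, 'n) free_algebra \<Rightarrow> ('k, 'n) free_algebra"
  where
    "gact (Gen_K a) = Kop a"
  | "gact (Gen_L a) = Lop a"
  | "gact (Gen_E i) = Eop i"
  | "gact (Gen_F i) = (\<lambda>m. var i * m)"

lemma flin_gact: "flin (gact g)"
  by (cases g) (simp_all add: flin_ops flin_mult_left)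

lemma flin_act: "flin (act gact x)"
  by (rule flin_act2[OF flin_gact])

lemma act_times: "act gact (x * y) m = act gact x (act gact y m)"
  by (rule act_mult[OF flin_gact])

lemma act_gens [simp]:
  "act gact (gK a) m = Kop a m" "act gact (gL a) m = Lop a m" "act gact (gE i) m = Eop i m" "act gact (gF i) m = var i * m"
  by (simp_all add: gdefs)

lemma Kop_Kop: "Kop a (Kop b m) = Kop (a + b) m" "Kop 0 m = m"
  and Lop_Lop: "Lop a (Lop b m) = Lop (a + b) m" "Lop 0 m = m"
  and Kop_Lop: "Kop a (Lop b m) = Lop b (Kop a m)"
  by (induction m rule: free_algebra_induct;
      simp add: Kop_mon Lop_mon op_simps lK_0 lL_0 lK_add lL_add chi_add_left chi_add_right mult_ac)+

lemma act_relators: "r \<in> relators chi \<Longrightarrow> act gact r m = 0"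
  unfolding relators_def mult.assoc gdefs[symmetric] fscale_def[symmetric]
  by (elim UnE CollectE exE conjE insertE emptyE)
    (auto simp: act_simps act_times Kop_Kop Lop_Lop Kop_Lop Kop_Eop Lop_Eop Kop_var Lop_var Eop_var)

lemma act_I: "x \<in> Ut_ideal chi \<Longrightarrow> act gact x m = 0"
proof -
  have "Ut_ideal chi \<subseteq> {x. \<forall>m. act gact x m = 0}"
    by (rule I_least)
      (auto simp: act_relators act_times flin_simps[OF flin_act] act_simps intro!: FA.subspaceI)
  then show "x \<in> Ut_ideal chi \<Longrightarrow> act gact x m = 0" by auto
qed

lemma act_cong: "q x = q y \<Longrightarrow> act gact x m = act gact y m"
  using act_I[of "x - y" m] by (simp add: q_eq act_simps)

text \<open>Tested on words in the \<open>E_i\<close> only; \<open>rad_iff\<close> recovers the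
  condition for all \<open>x\<close>.\<close>

definition rad :: "('k, 'n) free_algebra set"
  where "rad = {m. \<forall>w. eps (foldr Eop w m) = 0}"

lemma flin_foldr_Eop: "flin (foldr Eop w)"
  by (rule flin_foldr) (rule flin_ops)

lemma radI: "(\<And>w. eps (foldr Eop w m) = 0) \<Longrightarrow> m \<in> rad"
  and radD: "m \<in> rad \<Longrightarrow> eps (foldr Eop w m) = 0"
  by (simp_all add: rad_def)

lemma subspace_rad: "FA.subspace rad"
  by (rule FA.subspaceI) (simp_all add: rad_def flin_simps[OF flin_foldr_Eop])

lemma eps_rad: "m \<in> rad \<Longrightarrow> eps m = 0"
  using radD[of m "[]"] by simp

lemma Eop_rad: "m \<in> rad \<Longrightarrow> Eop i m \<in> rad"
  using radD[of m "w @ [i]" for w] by (intro radI) simp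

text \<open>The last letter of a word acts first, so every nonempty word factors through some
  \<open>Eop i m\<close>. This is how singular vectors are put into \<open>rad\<close>.\<close>

lemma rad_singular:
  assumes "eps m = 0" "\<And>i. Eop i m \<in> rad"
  shows "m \<in> rad"
proof (rule radI)
  fix w
  show "eps (foldr Eop w m) = 0"
    by (cases w rule: rev_cases) (use assms radD in auto)
qed

lemma eps_Kop: "eps (Kop a m) = lK a * eps m"
  and eps_Lop: "eps (Lop a m) = lL a * eps m"
  by (induction m rule: free_algebra_induct; simp add: op_simps Kop_mon Lop_mon algebra_simps)+

text \<open>Moving \<open>T\<close> through a word of \<open>E_i\<close> costs a nonzero scalar, so
  the values that test \<open>T m\<close> are proportional to those that test
  \<open>m\<close>.\<close>

lemma rad_semi_invariant:
  assumes T: "\<And>i m. T (Eop i m) = fscale (c i) (Eop i (T m))" "\<And>i. c i \<noteq> 0" "\<And>m. eps (T m) = d * eps m"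
    and m: "m \<in> rad"
  shows "T m \<in> rad"
proof (rule radI)
  fix w
  have "\<exists>s. s \<noteq> 0 \<and> T (foldr Eop w m) = fscale s (foldr Eop w (T m))"
  proof (induction w)
    case Nil
    then show ?case by (intro exI[of _ 1]) simp
  next
    case (Cons i w)
    then obtain s where s: "s \<noteq> 0" "T (foldr Eop w m) = fscale s (foldr Eop w (T m))" by blast
    then show ?case using T(2)[of i] by (intro exI[of _ "c i * s"]) (simp add: T(1) op_simps)
  qed
  then obtain s where s: "s \<noteq> 0" "T (foldr Eop w m) = fscale s (foldr Eop w (T m))" by blast
  from arg_cong[OF s(2), of eps] s(1) show "eps (foldr Eop w (T m)) = 0"
    by (simp add: T(3) radD[OF m])
qed

lemma Kop_rad: "m \<in> rad \<Longrightarrow> Kop a m \<in> rad"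
  and Lop_rad: "m \<in> rad \<Longrightarrow> Lop a m \<in> rad"
  by (rule rad_semi_invariant[OF Kop_Eop _ eps_Kop] rad_semi_invariant[OF Lop_Eop _ eps_Lop]; simp)+

text \<open>The word is shortened at its right end: \<open>E_i F_j m\<close> is
  \<open>F_j E_i m\<close> plus a term from \<open>L_i\<close> and \<open>K_i\<close>, and
  \<open>rad\<close> is stable under \<open>E_i\<close>, \<open>K\<close> and
  \<open>L\<close>.\<close>

lemma var_rad: "m \<in> rad \<Longrightarrow> var j * m \<in> rad"
proof (rule radI)
  fix w assume "m \<in> rad"
  then show "eps (foldr Eop w (var j * m)) = 0"
  proof (induction w arbitrary: m rule: rev_induct)
    case (snoc i w)
    have "eps (foldr Eop w (if i = j then Lop (\<alpha> i) m - Kop (\<alpha> i) m else 0)) = 0"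
      using Kop_rad[OF snoc(2)] Lop_rad[OF snoc(2)]
      by (simp add: flin_simps[OF flin_foldr_Eop] radD)
    then show ?case
      using snoc(1)[OF Eop_rad[OF snoc(2)]] by (simp add: Eop_var flin_simps[OF flin_foldr_Eop] split del: if_split)
  qed simp
qed

lemma act_rad: "m \<in> rad \<Longrightarrow> act gact x m \<in> rad"
proof (induction x rule: free_algebra_induct)
  case (mon w)
  have "gact g m \<in> rad" if "m \<in> rad" for g m
    using that by (cases g) (simp_all add: Kop_rad Lop_rad Eop_rad var_rad)
  then show ?case using mon by (induction w) simp_all
qed (simp_all add: act_simps FA.subspace_add[OF subspace_rad] FA.subspace_scale[OF subspace_rad])

lemma foldr_Eop_act: "foldr Eop w m = act gact (mon (map Gen_E w)) m"
  by (induction w) (simp_all add: mon_Cons act_times)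

lemma rad_iff: "m \<in> rad \<longleftrightarrow> (\<forall>x. eps (act gact x m) = 0)"
  using eps_rad[OF act_rad] by (auto simp del: act_mon simp: foldr_Eop_act intro!: radI)

section \<open>Vanishing on \<open>J^-\<close> and on its image under \<open>Omega\<close>\<close>

lemma act_E_word: "e \<in> Ewords \<Longrightarrow> e \<noteq> [] \<Longrightarrow> act gact (mon e) 1 = 0"
proof (induction e rule: rev_induct)
  case (snoc g e)
  then obtain i where "g = Gen_E i" by auto
  then show ?case using flin_0[OF flin_act, of "mon e"] by (simp del: act_mon add: mon_append mon_Cons act_times)
qed simp

lemma act_Z_word: "z \<in> Zwords \<Longrightarrow> \<exists>c. act gact (mon z) 1 = fscale c 1"
proof (induction z)
  case Nil
  show ?case by (intro exI[of _ 1]) simp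
next
  case (Cons g z)
  then obtain c where c: "foldr gact z 1 = fscale c 1" by auto
  have "Kop a 1 = fscale (lK a) 1" "Lop a 1 = fscale (lL a) 1" for a
    using Kop_mon[of a "[]"] Lop_mon[of a "[]"] by simp_all
  then have "\<exists>d. gact g 1 = fscale d 1" using Cons.prems by (auto simp del: fscale_one)
  then show ?case by (auto simp: c flin_simps[OF flin_gact])
qed

text \<open>An \<open>F\<close>-word of nonzero degree is nonempty. Hence its action puts a letter
  in front and leaves no constant term, while its image under \<open>om\<close> has some
  \<open>K E_i\<close> as its last factor, which kills the highest weight vector.\<close>

lemma Fhom_eps:
  assumes "f \<in> Fhom b" "b \<noteq> 0"
  shows "eps (act gact f m) = 0" "act gact (subst om f) 1 = 0"
proof -
  have nonempty: "w \<noteq> []" if "wdeg w = b" for w using that assms(2) by auto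
  show "eps (act gact f m) = 0"
    using assms(1) unfolding Fhom_def
  proof (induction rule: FA.span_induct_alt)
    case (step c x y)
    then obtain u where u: "x = mon u" "u \<in> Fwords" "wdeg u = b" by auto
    obtain g w where w: "x = mon (g # w)" "g # w \<in> Fwords"
      using nonempty[OF u(3)] u(1,2) that by (metis neq_Nil_conv)
    then obtain i where "g = Gen_F i" by auto
    then show ?case using w step by (simp add: act_simps)
  qed (simp add: act_simps)
  show "act gact (subst om f) 1 = 0"
    using assms(1) unfolding Fhom_def
  proof (induction rule: FA.span_induct_alt)
    case (step c x y)
    then obtain w where "x = mon w" "w \<in> Fwords" "w \<noteq> []" using nonempty by auto
    then obtain w' i where "x = mon (w' @ [Gen_F i])"
      by (cases w rule: rev_cases) auto
    then show ?case using step(2) flin_0[OF flin_act] flin_0[OF flin_ops(1)]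
      by (simp add: act_simps subst_simps mon_append mon_Cons subst_mult act_times)
  qed (simp add: act_simps subst_simps)
qed

text \<open>A nonempty \<open>e\<close> kills the highest weight vector. If \<open>e\<close> is
  empty, then \<open>z\<close> only scales that vector, and \<open>y\<close> leaves no constant
  term.\<close>

lemma eps_JA: "x \<in> JA \<Longrightarrow> eps (act gact x 1) = 0"
  unfolding JA_def JA_gens_def
proof (induction rule: FA.span_induct_alt)
  case (step c t x)
  then obtain y a z e where t: "t = y * mon z * mon e" "y \<in> IA a" "z \<in> Zwords" "e \<in> Ewords" by blast
  have "eps (act gact t 1) = 0"
  proof (cases "e = []")
    case True
    obtain d where d: "act gact (mon z) 1 = fscale d 1" using act_Z_word[OF t(3)] by blast
    obtain f where f: "f \<in> Fhom (- a)" "q y = q f" using IA_Fhom[OF t(2)] by blast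
    have "act gact y m = act gact f m" for m by (rule act_cong[OF f(2)])
    moreover have "eps (act gact f m) = 0" for m
    proof (cases "a = 0")
      \<comment> \<open>In degree 0 the \<open>F\<close>-words give no information, but there
        \<open>IA\<close> is just the ideal of relations.\<close>
      case True
      then have "y \<in> Ut_ideal chi" using t(2) by (simp add: IA_trivial)
      then show ?thesis using act_I act_cong[OF f(2)] by (metis eps_simps(1))
    qed (use Fhom_eps(1)[OF f(1)] in simp)
    ultimately show ?thesis using True d by (simp add: t act_times del: act_mon)
  next
    case False
    then show ?thesis using act_E_word[OF t(4)] flin_0[OF flin_act] by (simp add: t act_times del: act_mon)
  qed
  then show ?case using step(2) by (simp add: act_simps)
qed (simp add: act_simps)

text \<open>Needs the reversed order from \<open>JA_reverse\<close>: the factor from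
  \<open>I^-\<close> then acts first, and under \<open>om\<close> it kills the highest weight
  vector.\<close>

lemma act_om_JA: "x \<in> JA \<Longrightarrow> act gact (subst om x) 1 = 0"
proof -
  assume "x \<in> JA"
  then have "x \<in> FA.span JA_gens'"
    using JA_reverse by blast
  then show ?thesis
  proof (induction rule: FA.span_induct_alt)
    case (step c t x)
    then obtain y a z e where t: "t = mon e * mon z * y" "y \<in> IA a" unfolding JA_gens'_def by blast
    obtain f where f: "f \<in> Fhom (- a)" "q y = q f" using IA_Fhom[OF t(2)] by blast
    have "act gact (subst om y) 1 = 0"
    proof (cases "a = 0")
      case True
      then have "q y = q 0" using t(2) by (simp add: IA_trivial q_eq)
      then show ?thesis using act_cong[OF subst_om_cong] by (metis act_simps(3) subst_simps(3))
    next
      case False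
      then show ?thesis using Fhom_eps(2)[OF f(1)] act_cong[OF subst_om_cong[OF f(2)]] by simp
    qed
    then show ?case using step(2) flin_0[OF flin_act]
      by (simp add: t act_simps subst_simps subst_mult act_times)
  qed (simp add: act_simps subst_simps)
qed

text \<open>\<open>UA\<close> is a left ideal, so the words that test membership in
  \<open>rad\<close> can be absorbed into the element.\<close>

lemma act_UA: "x \<in> UA \<Longrightarrow> act gact x 1 \<in> rad"
proof (rule radI)
  fix w assume "x \<in> UA"
  then have "mon (map Gen_E w) * x \<in> UA" by (rule UA_mult)
  then obtain a b where ab: "mon (map Gen_E w) * x = a + subst om b" "a \<in> JA" "b \<in> JA"
    by (auto simp: UA_def)
  have "foldr Eop w (act gact x 1) = act gact (mon (map Gen_E w) * x) 1"
    by (simp add: foldr_Eop_act act_times del: act_mon)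
  then show "eps (foldr Eop w (act gact x 1)) = 0"
    unfolding ab using eps_JA[OF ab(2)] act_om_JA[OF ab(3)] by (simp add: act_simps)
qed

end

section \<open>Reduction to the concrete module\<close>

lemma submodule_pres:
  assumes M: "pres M p K" and R: "carrier R = range r" and sm: "\<And>a x. r a \<odot>\<^bsub>M\<^esub> p x = p (a * x)"
  shows "submodule H R M \<longleftrightarrow> pres_sub p H \<and> (\<forall>a x. p x \<in> H \<longrightarrow> p (a * x) \<in> H)"
proof
  assume "submodule H R M"
  then interpret submodule H R M .
  have "p (x - y) \<in> H" if "p x \<in> H" "p y \<in> H" for x y
    using m_closed[OF that(1) m_inv_closed[OF that(2)]]
      pres_a_inv[OF M, of y, unfolded a_inv_def] pres_add[OF M, of x "- y"] by simp
  moreover have "p 0 \<in> H" using one_closed pres_zero[OF M] by simp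
  moreover have "H \<subseteq> range p" using subset M by (simp add: pres_carrier)
  moreover have "p (a * x) \<in> H" if "p x \<in> H" for a x
    using smult_closed[of "r a" "p x"] R sm that by simp
  ultimately show "pres_sub p H \<and> (\<forall>a x. p x \<in> H \<longrightarrow> p (a * x) \<in> H)"
    by (simp add: pres_sub_def)
next
  assume H: "pres_sub p H \<and> (\<forall>a x. p x \<in> H \<longrightarrow> p (a * x) \<in> H)"
  then have rep: "h \<in> H \<Longrightarrow> \<exists>x. h = p x" for h by (auto simp: pres_sub_def)
  show "submodule H R M"
  proof (intro submodule.intro subgroup.intro submodule_axioms.intro)
    show "H \<subseteq> carrier (add_monoid M)" using H M by (simp add: pres_sub_def pres_carrier)
    show "\<one>\<^bsub>add_monoid M\<^esub> \<in> H" using H M by (simp add: pres_sub_def pres_zero)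
    show "x \<otimes>\<^bsub>add_monoid M\<^esub> y \<in> H" if xy: "x \<in> H" "y \<in> H" for x y
    proof -
      obtain u v where "x = p u" "y = p v" using rep xy by meson
      then show ?thesis using xy pres_sub_add[OF M conjunct1[OF H]] by (simp add: pres_add[OF M])
    qed
    show "inv\<^bsub>add_monoid M\<^esub> x \<in> H" if x: "x \<in> H" for x
    proof -
      obtain u where "x = p u" using rep x by meson
      then show ?thesis using x pres_sub_minus[OF M conjunct1[OF H], of u] pres_a_inv[OF M, of u] by (simp add: a_inv_def)
    qed
    show "a \<odot>\<^bsub>M\<^esub> x \<in> H" if ax: "a \<in> carrier R" "x \<in> H" for a x
    proof -
      obtain u b where "x = p u" "a = r b" using rep ax R by (metis imageE)
      then show ?thesis using ax H by (simp add: sm)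
    qed
  qed
qed

definition wproj :: "'n lattice \<Rightarrow> ('k::field, 'n) free_algebra \<Rightarrow> ('k, 'n) free_algebra"
  where "wproj b = lift (\<lambda>w. if wt w = b then mon w else 0)"

lemma flin_wproj: "flin (wproj b)"
  by (simp add: wproj_def flin_lift)

lemma wproj_mon: "wproj b (mon w) = (if wt w = b then mon w else 0)"
  by (simp add: wproj_def)

lemma wproj_wspace: "wproj b m \<in> wspace b"
  by (induction m rule: free_algebra_induct)
    (auto simp: wproj_mon flin_simps[OF flin_wproj] mon_wspace FA.subspace_0[OF subspace_wspace]
      FA.subspace_add[OF subspace_wspace] FA.subspace_scale[OF subspace_wspace])

lemma sum_wproj: "\<exists>B. finite B \<and> m = (\<Sum>b\<in>B. wproj b m)"
proof -
  have "\<exists>B. finite B \<and> (\<forall>C. finite C \<longrightarrow> B \<subseteq> C \<longrightarrow> m = (\<Sum>b\<in>C. wproj b m))"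
  proof (induction m rule: free_algebra_induct)
    case (mon w)
    show ?case by (rule exI[of _ "{wt w}"]) (auto simp: wproj_mon)
  next
    case (add x y)
    then obtain B C where "finite B" "\<And>D. finite D \<Longrightarrow> B \<subseteq> D \<Longrightarrow> x = (\<Sum>b\<in>D. wproj b x)"
      "finite C" "\<And>D. finite D \<Longrightarrow> C \<subseteq> D \<Longrightarrow> y = (\<Sum>b\<in>D. wproj b y)" by metis
    then show ?case
      by (intro exI[of _ "B \<union> C"]) (simp add: flin_simps[OF flin_wproj] sum.distrib)
  next
    case (scale c x)
    then show ?case
      by (auto simp: flin_simps[OF flin_wproj] simp flip: FA.scale_sum_right)
  qed
  then show ?thesis by blast
qed

text \<open>A linear section of \<open>x \<mapsto> x v\<close>, by \<open>act_iota\<close>.\<close>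

definition iota :: "('k::field, 'n) free_algebra \<Rightarrow> ('k, 'n) free_gen"
  where "iota = lift (\<lambda>w. mon (map Gen_F w))"

lemma flin_iota: "flin iota"
  by (simp add: iota_def flin_lift)

lemma iota_mon [simp]: "iota (mon w) = mon (map Gen_F w)"
  by (simp add: iota_def)

lemma iota_1 [simp]: "iota 1 = 1"
  using iota_mon[of "[]"] by simp

lemma iota_var: "iota (var i * m) = gF i * iota m"
proof (induction m rule: free_algebra_induct)
  case (mon w)
  show ?case by (simp only: mon_Cons[symmetric] iota_mon list.map gdefs)
qed (simp_all add: distrib_left flin_simps[OF flin_iota])

lemma wdeg_F: "wdeg (map Gen_F w) = - wt w"
  by (induction w) simp_all

lemma F_Fwords: "map Gen_F w \<in> Fwords"
  by (induction w) simp_all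

lemma iota_wspace: "m \<in> wspace b \<Longrightarrow> iota m \<in> Fhom (- b)"
  unfolding wspace_def
  by (erule flin_span_subset[OF flin_iota subspace_Fhom, rotated])
    (auto simp: Fhom_def wdeg_F F_Fwords intro!: FA.span_base)

lemma ht_wt: "ht (wt w) = int (length w)"
  by (induction w) (simp_all add: ht_add)

lemma wt_eq_0: "wt w = 0 \<longleftrightarrow> w = []" for w :: "'n::finite list"
  using ht_wt[of w] by auto

lemma wspace_0: "m \<in> wspace 0 \<Longrightarrow> m = fscale (eps m) 1" for m :: "('k::field, 'n::finite) free_algebra"
  unfolding wspace_def
  by (induction rule: FA.span_induct_alt) (auto simp: wt_eq_0 fscale_add_left)

context highest_weight
begin

lemma act_iota: "act gact (iota m) 1 = m"
proof (induction m rule: free_algebra_induct)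
  case (mon w)
  show ?case by (induction w) (simp_all add: mon_Cons iota_var act_times del: iota_mon act_mon)
qed (simp_all add: flin_simps[OF flin_iota] act_simps)

text \<open>The coefficient of \<open>v\<close> after a word \<open>w\<close> of \<open>E_i\<close>
  sees only the component of weight \<open>wt w\<close>; hence \<open>rad\<close> is graded.\<close>

lemma wproj_rad:
  assumes "m \<in> rad"
  shows "wproj b m \<in> rad"
proof (rule radI)
  fix w
  have "eps (foldr Eop w (wproj b m)) = (if b = wt w then eps (foldr Eop w m) else 0)" for m
  proof (induction m rule: free_algebra_induct)
    case (mon u)
    have "eps (foldr Eop w (mon u)) = 0" if "wt u \<noteq> wt w"
      using eps_wspace[OF foldr_Eop_wspace[OF mon_wspace, of w u]] that by simp
    then show ?case by (auto simp: wproj_mon flin_0[OF flin_foldr_Eop])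
  qed (simp_all add: flin_simps[OF flin_wproj] flin_simps[OF flin_foldr_Eop])
  then show "eps (foldr Eop w (wproj b m)) = 0" using assms by (simp add: radD)
qed

lemma act_wspace: "x \<in> hom b \<Longrightarrow> m \<in> wspace c \<Longrightarrow> act gact x m \<in> wspace (c - b)"
  unfolding hom_def
proof (induction rule: FA.span_induct_alt)
  case base
  then show ?case by (simp add: act_simps FA.subspace_0[OF subspace_wspace])
next
  case (step a s x)
  then obtain w where w: "s = mon w" "wdeg w = b" by auto
  have g: "gact g m \<in> wspace (c - gen_degree g)" if "m \<in> wspace c" for g m c
    using that by (cases g) (simp_all add: Kop_wspace Lop_wspace Eop_wspace var_wspace FA.subspace_scale[OF subspace_wspace])
  have "foldr gact w m \<in> wspace (c - wdeg w)"
  proof (induction w)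
    case (Cons g w)
    from g[OF Cons, of g] show ?case by (simp add: diff_diff_eq add.commute)
  qed (simp add: step)
  with step w show ?case
    by (simp add: act_simps FA.subspace_add[OF subspace_wspace] FA.subspace_scale[OF subspace_wspace])
qed

end

locale character = bicharacter chi for chi :: "('k::field, 'n::finite) bichar" +
  fixes \<Lambda> :: "('k, 'n) U_elem \<Rightarrow> 'k"
  assumes \<Lambda>: "\<Lambda> \<in> Ch chi"
begin

lemmas U_pres = pres_ringD(1)[OF pres_U]

lemma carrier_U: "carrier (U chi) = range rho"
  using pres_carrier[OF U_pres] .

lemma U_hom:
  "rho x \<oplus>\<^bsub>U chi\<^esub> rho y = rho (x + y)" "rho x \<otimes>\<^bsub>U chi\<^esub> rho y = rho (x * y)" "\<one>\<^bsub>U chi\<^esub> = rho 1" "\<zero>\<^bsub>U chi\<^esub> = rho 0"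
  "rho x \<ominus>\<^bsub>U chi\<^esub> rho y = rho (x - y)"
  using pres_ringD[OF pres_U] pres_add[OF U_pres] pres_zero[OF U_pres] pres_minus[OF U_pres] by metis+

lemma U_gens:
  "U_K chi a = rho (gK a)" "U_L chi a = rho (gL a)" "U_E chi i = rho (gE i)" "U_const chi c = rho (const c)"
  by (simp_all add: U_K_def U_L_def U_E_def U_const_def rho_def gdefs Kt_def Lt_def Et_def Ut_const_def)

lemma U_parts:
  "U_zero chi = rho ` FA.span (mon ` Zwords)" "U_minus chi = rho ` FA.span (mon ` Fwords)"
  "U_degree chi b = rho ` hom b"
  by (simp_all add: U_zero_def U_minus_def U_degree_def Ut_zero_eq Ut_minus_eq Ut_degree_eq image_image rho_def)

lemma rho_cong: "q x = q y \<Longrightarrow> rho x = rho y"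
  by (simp add: rho_def)

lemma Zspan_base: "z \<in> Zwords \<Longrightarrow> mon z \<in> FA.span (mon ` Zwords)"
  by (intro FA.span_base imageI)

lemma \<Lambda>_hom: "\<Lambda> \<in> ring_hom ((U chi)\<lparr>carrier := U_zero chi\<rparr>) ring_of_type"
  using \<Lambda> by (simp add: Ch_def)

lemma \<Lambda>_mult: "x \<in> FA.span (mon ` Zwords) \<Longrightarrow> y \<in> FA.span (mon ` Zwords) \<Longrightarrow> \<Lambda> (rho (x * y)) = \<Lambda> (rho x) * \<Lambda> (rho y)"
  and \<Lambda>_add: "x \<in> FA.span (mon ` Zwords) \<Longrightarrow> y \<in> FA.span (mon ` Zwords) \<Longrightarrow> \<Lambda> (rho (x + y)) = \<Lambda> (rho x) + \<Lambda> (rho y)"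
  using ring_hom_mult[OF \<Lambda>_hom, of "rho x" "rho y"] ring_hom_add[OF \<Lambda>_hom, of "rho x" "rho y"]
  by (auto simp: U_parts U_hom ring_of_type_def)

lemma \<Lambda>_const: "\<Lambda> (rho (const c)) = c"
  using \<Lambda> by (simp add: Ch_def U_gens)

lemma const_Zspan: "const c \<in> FA.span (mon ` Zwords)"
  using FA.span_scale[OF Zspan_base[of "[]"], of c] by (simp add: const_eq_scale)

lemma \<Lambda>_1: "\<Lambda> (rho 1) = 1"
  using \<Lambda>_const[of 1] by simp

lemma gK_Zspan: "gK a \<in> FA.span (mon ` Zwords)" and gL_Zspan: "gL a \<in> FA.span (mon ` Zwords)"
  using Zspan_base[of "[Gen_K a]"] Zspan_base[of "[Gen_L a]"] by (simp_all add: mon_Cons gdefs)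

definition lK :: "'n lattice \<Rightarrow> 'k" where "lK a = \<Lambda> (rho (gK a))"
definition lL :: "'n lattice \<Rightarrow> 'k" where "lL a = \<Lambda> (rho (gL a))"

sublocale highest_weight chi lK lL
proof
  fix a b
  show "lK 0 = 1" "lL 0 = 1"
    using rho_cong[OF q_K0] rho_cong[OF q_L0] by (simp_all add: lK_def lL_def \<Lambda>_1)
  show "lK (a + b) = lK a * lK b" "lL (a + b) = lL a * lL b"
    using \<Lambda>_mult[OF gK_Zspan gK_Zspan, of a b] \<Lambda>_mult[OF gL_Zspan gL_Zspan, of a b]
      rho_cong[OF q_KK, of a b] rho_cong[OF q_LL, of a b] by (simp_all add: lK_def lL_def)
qed

lemma \<Lambda>_KL: "\<Lambda> (U_K chi a \<otimes>\<^bsub>U chi\<^esub> U_L chi b) = lK a * lL b"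
  by (simp add: U_gens U_hom \<Lambda>_mult gK_Zspan gL_Zspan lK_def lL_def)

lemma act_Zspan: "z \<in> FA.span (mon ` Zwords) \<Longrightarrow> act gact z 1 = fscale (\<Lambda> (rho z)) 1"
proof -
  assume "z \<in> FA.span (mon ` Zwords)"
  then have "z \<in> FA.span (mon ` Zwords) \<and> act gact z 1 = fscale (\<Lambda> (rho z)) 1"
  proof (induction rule: FA.span_induct_alt)
    case base
    show ?case using \<Lambda>_const[of 0] by (simp add: act_simps FA.span_zero)
  next
    case (step c s x)
    then obtain w where w: "s = mon w" "w \<in> Zwords" by auto
    from w(2) have "act gact (mon w) 1 = fscale (\<Lambda> (rho (mon w))) 1"
    proof (induction w)
      case Nil
      show ?case by (simp add: \<Lambda>_1)
    next
      case (Cons g w)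
      have "Kop a 1 = fscale (lK a) 1" "Lop a 1 = fscale (lL a) 1" for a
        using Kop_mon[of a "[]"] Lop_mon[of a "[]"] by simp_all
      then have g: "gact g 1 = fscale (\<Lambda> (rho (var g))) 1" "var g \<in> FA.span (mon ` Zwords)"
        using Cons.prems gK_Zspan gL_Zspan by (auto simp: lK_def lL_def gdefs simp del: fscale_one)
      have "act gact (mon (g # w)) 1 = gact g (act gact (mon w) 1)" by simp
      also have "\<dots> = fscale (\<Lambda> (rho (mon w))) (gact g 1)"
        using Cons by (simp add: flin_simps[OF flin_gact])
      also have "\<dots> = fscale (\<Lambda> (rho (mon (g # w)))) 1"
        using Cons.prems by (simp add: g \<Lambda>_mult Zspan_base mon_Cons mult.commute)
      finally show ?case .
    qed
    then have "act gact (fscale c s) 1 = fscale (c * \<Lambda> (rho s)) 1" by (simp add: act_simps w)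
    moreover have "\<Lambda> (rho (fscale c s + x)) = c * \<Lambda> (rho s) + \<Lambda> (rho x)"
      using w step \<Lambda>_mult[OF const_Zspan[of c] Zspan_base[OF w(2)]]
      by (simp add: \<Lambda>_add FA.span_scale Zspan_base \<Lambda>_const flip: fscale_def)
    moreover have "fscale c s + x \<in> FA.span (mon ` Zwords)"
      using w step by (simp add: FA.span_add FA.span_scale Zspan_base)
    ultimately show ?case using step by (simp add: act_simps fscale_add_left)
  qed
  then show ?thesis by blast
qed

abbreviation reg where "reg \<equiv> regular_module (U chi)"

lemma reg_pres: "pres reg rho UA"
  using U_pres by (simp add: pres_def regular_module_def)

lemma reg_smult: "rho a \<odot>\<^bsub>reg\<^esub> rho x = rho (a * x)"
  by (simp add: regular_module_def U_hom)

lemmas reg_submodule = submodule_pres[OF reg_pres carrier_U reg_smult]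

text \<open>The annihilator of the highest weight vector in \<open>M / rad\<close>, later seen to be
  the kernel of the map onto \<open>irr\<close>.\<close>

definition N0 :: "('k, 'n) free_gen set"
  where "N0 = {x. act gact x 1 \<in> rad}"

lemma subspace_N0: "FA.subspace N0"
  unfolding N0_def by (rule flin_subspace[OF flin_act1 subspace_rad])

lemma N0_mult: "x \<in> N0 \<Longrightarrow> y * x \<in> N0"
  by (simp add: N0_def act_times act_rad)

lemma UA_N0: "UA \<subseteq> N0"
  using act_UA by (auto simp: N0_def)

lemma rho_image_mem:
  assumes "UA \<subseteq> H" "FA.subspace H"
  shows "rho x \<in> rho ` H \<longleftrightarrow> x \<in> H"
proof
  assume "rho x \<in> rho ` H"
  then obtain y where "y \<in> H" "x - y \<in> UA" using pres_eq[OF U_pres] by auto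
  then show "x \<in> H" using FA.subspace_add[OF assms(2), of "x - y" y] assms(1) by auto
qed auto

definition V :: "('k, 'n) free_gen set"
  where "V = {x. rho x \<in> verma_ideal chi \<Lambda>}"

lemma verma_gens: "{Z \<ominus>\<^bsub>U chi\<^esub> U_const chi (\<Lambda> Z) | Z. Z \<in> U_zero chi} \<union> range (U_E chi) =
    rho ` ({z - const (\<Lambda> (rho z)) |z. z \<in> FA.span (mon ` Zwords)} \<union> range gE)"
  unfolding U_parts by (auto simp: U_gens U_hom image_iff) (metis U_gens(4) U_hom(5))+

lemma verma_ideal_image: "verma_ideal chi \<Lambda> \<subseteq> rho ` N0"
proof -
  have "submodule (rho ` N0) (U chi) reg"
    unfolding reg_submodule
    using rho_image_mem[OF UA_N0 subspace_N0] FA.subspace_0[OF subspace_N0] FA.subspace_diff[OF subspace_N0]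
    by (auto simp: pres_sub_def N0_mult)
  moreover have "gE i \<in> N0" "z \<in> FA.span (mon ` Zwords) \<Longrightarrow> z - const (\<Lambda> (rho z)) \<in> N0" for i z
    using FA.subspace_0[OF subspace_rad] by (simp_all add: N0_def act_simps act_Zspan)
  ultimately show ?thesis
    unfolding verma_ideal_def generated_submodule_def verma_gens by (intro Inter_lower) auto
qed

lemma verma_ideal_submodule: "submodule (verma_ideal chi \<Lambda>) (U chi) reg"
  unfolding reg_submodule
proof
  define F where "F = {H. submodule H (U chi) reg \<and>
      {Z \<ominus>\<^bsub>U chi\<^esub> U_const chi (\<Lambda> Z) | Z. Z \<in> U_zero chi} \<union> range (U_E chi) \<subseteq> H}"
  have vi: "verma_ideal chi \<Lambda> = \<Inter> F"
    unfolding verma_ideal_def generated_submodule_def F_def ..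
  have F: "pres_sub rho H" "rho x \<in> H \<Longrightarrow> rho (a * x) \<in> H" if "H \<in> F" for H x a
    using that unfolding F_def by (simp_all add: reg_submodule)
  show "pres_sub rho (verma_ideal chi \<Lambda>)"
  proof (rule pres_subI)
    \<comment> \<open>An intersection of submodules lies in the carrier only if there is at least
      one of them; the submodule given by \<open>N0\<close> is one.\<close>
    show "verma_ideal chi \<Lambda> \<subseteq> range rho" using verma_ideal_image by blast
  qed (use F(1) in \<open>simp_all add: vi pres_sub_def\<close>)
  show "\<forall>a x. rho x \<in> verma_ideal chi \<Lambda> \<longrightarrow> rho (a * x) \<in> verma_ideal chi \<Lambda>"
    using F(2) by (simp add: vi)
qed

lemmas verma_sub = conjunct1[OF verma_ideal_submodule[unfolded reg_submodule]]

lemma V_mult: "x \<in> V \<Longrightarrow> y * x \<in> V"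
  using verma_ideal_submodule unfolding reg_submodule V_def by blast

lemma subspace_V: "FA.subspace V"
proof (rule FA.subspaceI)
  show "0 \<in> V" using verma_sub by (simp add: V_def pres_sub_def)
qed (simp_all add: V_mult fscale_def, simp add: V_def pres_sub_add[OF reg_pres verma_sub])

lemma V_cong: "q x = q y \<Longrightarrow> y \<in> V \<Longrightarrow> x \<in> V"
  using rho_cong[of x y] by (simp add: V_def)

lemma V_gens: "gE i \<in> V" "z \<in> FA.span (mon ` Zwords) \<Longrightarrow> z - const (\<Lambda> (rho z)) \<in> V"
proof -
  have "rho ` ({z - const (\<Lambda> (rho z)) |z. z \<in> FA.span (mon ` Zwords)} \<union> range gE) \<subseteq> verma_ideal chi \<Lambda>"
    unfolding verma_ideal_def generated_submodule_def verma_gens by blast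
  then show "gE i \<in> V" "z \<in> FA.span (mon ` Zwords) \<Longrightarrow> z - const (\<Lambda> (rho z)) \<in> V"
    by (auto simp: V_def)
qed

lemma V_N0: "V \<subseteq> N0"
  using verma_ideal_image rho_image_mem[OF UA_N0 subspace_N0] by (auto simp: V_def)

text \<open>Modulo the Verma ideal a generator acts on \<open>F\<close>-words as it does on
  \<open>M\<close>: \<open>K\<close> and \<open>L\<close> are moved to the right end and evaluated
  by \<open>\<Lambda>\<close>, and \<open>E_i\<close> is moved there by its commutators with the
  \<open>F_j\<close>.\<close>

lemma V_reduce_gen: "var g * iota m - iota (gact g m) \<in> V"
proof -
  have Z: "var g * iota (mon w) - iota (gact g (mon w)) \<in> V"
    if comm: "q (var g * iota (mon w)) = q (fscale c (iota (mon w) * var g))"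
      and g: "gact g (mon w) = fscale (\<Lambda> (rho (var g)) * c) (mon w)" "(var g :: ('k, 'n) free_gen) \<in> FA.span (mon ` Zwords)" for g w c
  proof -
    have "q (var g * iota (mon w) - iota (gact g (mon w))) =
        q (fscale c (iota (mon w) * var g) - iota (gact g (mon w)))" by (rule q_diff[OF comm]) simp
    also have "fscale c (iota (mon w) * var g) - iota (gact g (mon w)) =
        fscale c (iota (mon w) * (var g - const (\<Lambda> (rho (var g)))))"
      by (simp add: g flin_simps[OF flin_iota] right_diff_distrib FA.scale_right_diff_distrib const_eq_scale mult.commute)
    finally show ?thesis
      by (rule V_cong) (intro FA.subspace_scale[OF subspace_V] V_mult V_gens g)
  qed
  have K: "gK a * iota (mon w) - iota (Kop a (mon w)) \<in> V" for a w
    using Z[of "Gen_K a" w "chi a (- wt w)"] q_K_mon[of a "map Gen_F w"] gK_Zspan[of a]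
    by (simp add: wdeg_F Kop_mon lK_def flip: gdefs)
  have L: "gL a * iota (mon w) - iota (Lop a (mon w)) \<in> V" for a w
    using Z[of "Gen_L a" w "chi (wt w) a"] q_L_mon[of a "map Gen_F w"] gL_Zspan[of a]
    by (simp add: wdeg_F Lop_mon lL_def flip: gdefs)
  have E: "gE i * iota (mon w) - iota (Eop i (mon w)) \<in> V" for i w
  proof (induction w)
    case Nil
    then show ?case using V_gens(1)[of i] by (simp add: flin_simps[OF flin_iota])
  next
    case (Cons j w)
    have "q (gE i * gF j * iota (mon w)) = q ((gF j * gE i + (if i = j then gL (\<alpha> i) - gK (\<alpha> i) else 0)) * iota (mon w))"
      by (intro q_mult q_EF HOL.refl)
    then have "q (gE i * iota (mon (j # w)) - iota (Eop i (mon (j # w)))) =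
      q ((gF j * gE i + (if i = j then gL (\<alpha> i) - gK (\<alpha> i) else 0)) * iota (mon w) - iota (Eop i (mon (j # w))))"
      by (intro q_diff HOL.refl) (simp only: mon_Cons iota_var mult.assoc)
    also have "(gF j * gE i + (if i = j then gL (\<alpha> i) - gK (\<alpha> i) else 0)) * iota (mon w) - iota (Eop i (mon (j # w))) =
      gF j * (gE i * iota (mon w) - iota (Eop i (mon w))) +
      (if i = j then (gL (\<alpha> i) * iota (mon w) - iota (Lop (\<alpha> i) (mon w))) - (gK (\<alpha> i) * iota (mon w) - iota (Kop (\<alpha> i) (mon w))) else 0)"
      by (simp add: Eop_mon_Cons flin_simps[OF flin_iota] iota_var algebra_simps del: iota_mon)
    finally show ?case
      by (rule V_cong) (intro FA.subspace_add[OF subspace_V] V_mult Cons,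
        use FA.subspace_diff[OF subspace_V L K] FA.subspace_0[OF subspace_V] in \<open>simp del: iota_mon\<close>)
  qed
  have F: "gF i * iota m - iota (var i * m) \<in> V" for i m
    by (simp add: iota_var FA.subspace_0[OF subspace_V])
  have "var g * iota (mon w) - iota (gact g (mon w)) \<in> V" for w
    by (cases g) (use K L E F in \<open>simp_all add: gdefs del: iota_mon\<close>)
  moreover have "flin (\<lambda>m. var g * iota m - iota (gact g m))"
    by (rule flinI)
      (simp_all add: flin_simps[OF flin_iota] flin_simps[OF flin_gact] algebra_simps FA.scale_right_diff_distrib)
  ultimately show ?thesis
    using flin_span_subset[OF _ subspace_V, of "\<lambda>m. var g * iota m - iota (gact g m)" "range mon" m]
    by (auto simp: span_mon simp del: iota_mon)
qed

text \<open>Every class of the Verma module is represented by a combination of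
  \<open>F\<close>-words that depends only on \<open>x v\<close>. In particular
  \<open>x v = 0\<close> forces \<open>x\<close> into \<open>V\<close>.\<close>

lemma V_reduce: "x - iota (act gact x 1) \<in> V"
proof (induction x rule: free_algebra_induct)
  case (mon w)
  show ?case
  proof (induction w)
    case Nil
    then show ?case using iota_mon[of "[]"] by (simp add: FA.subspace_0[OF subspace_V])
  next
    case (Cons g w)
    let ?m = "act gact (mon w) 1"
    have e: "mon (g # w) - iota (act gact (mon (g # w)) 1) =
        var g * (mon w - iota ?m) + (var g * iota ?m - iota (gact g ?m))"
      by (simp add: mon_Cons act_times algebra_simps del: act_mon)
    show ?case unfolding e by (rule FA.subspace_add[OF subspace_V V_mult[OF Cons] V_reduce_gen])
  qed
next
  case (add x y)
  then show ?case using FA.subspace_add[OF subspace_V add]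
    by (simp add: act_simps flin_simps[OF flin_iota] algebra_simps)
next
  case (scale c x)
  then show ?case using FA.subspace_scale[OF subspace_V scale, of c]
    by (simp add: act_simps flin_simps[OF flin_iota] FA.scale_right_diff_distrib)
qed

section \<open>The Verma module and its maximal graded submodule\<close>

definition vpi :: "('k, 'n) free_gen \<Rightarrow> ('k, 'n) verma_elem"
  where "vpi x = verma_ideal chi \<Lambda> +>\<^bsub>reg\<^esub> rho x"

lemma verma_pres: "pres (verma chi \<Lambda>) vpi V"
proof -
  have "pres (verma chi \<Lambda>) (\<lambda>x. verma_ideal chi \<Lambda> +>\<^bsub>reg\<^esub> rho x) {x. rho x \<in> verma_ideal chi \<Lambda>}"
    by (rule pres_quotient[OF reg_pres verma_sub]) (simp_all add: verma_def quotient_module_def)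
  then show ?thesis by (simp add: vpi_def[abs_def] V_def)
qed

lemma verma_smult: "rho a \<odot>\<^bsub>verma chi \<Lambda>\<^esub> vpi x = vpi (a * x)"
  unfolding verma_def quotient_module_def vpi_def
  using pres_coset_smult[OF reg_pres verma_sub, of "\<lambda>m. rho a \<odot>\<^bsub>reg\<^esub> m" "\<lambda>x. a * x" x] V_mult
  by (simp add: reg_smult right_diff_distrib V_def)

lemma vpi_eq: "vpi x = vpi y \<longleftrightarrow> x - y \<in> V"
  using pres_eq[OF verma_pres] .

lemmas verma_submodule = submodule_pres[OF verma_pres carrier_U verma_smult]

lemma verma_vec_eq: "verma_vec chi \<Lambda> = vpi 1"
  by (simp add: verma_vec_def vpi_def U_hom)

lemma verma_degree_eq: "verma_degree chi \<Lambda> b = vpi ` {x. rho x \<in> U_minus chi \<inter> U_degree chi b}"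
proof (intro equalityI subsetI)
  fix X assume "X \<in> verma_degree chi \<Lambda> b"
  then obtain Y where Y: "Y \<in> U_minus chi \<inter> U_degree chi b" "X = Y \<odot>\<^bsub>verma chi \<Lambda>\<^esub> vpi 1"
    unfolding verma_degree_def verma_vec_eq by blast
  then obtain x where "Y = rho x" unfolding U_parts by blast
  with Y show "X \<in> vpi ` {x. rho x \<in> U_minus chi \<inter> U_degree chi b}"
    by (simp add: verma_smult)
next
  fix X assume "X \<in> vpi ` {x. rho x \<in> U_minus chi \<inter> U_degree chi b}"
  then obtain x where x: "X = vpi x" "rho x \<in> U_minus chi \<inter> U_degree chi b" by blast
  then have "X = rho x \<odot>\<^bsub>verma chi \<Lambda>\<^esub> vpi 1" by (simp add: verma_smult)
  with x show "X \<in> verma_degree chi \<Lambda> b" unfolding verma_degree_def verma_vec_eq by blast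
qed

lemma Fhom_verma_degree: "f \<in> Fhom b \<Longrightarrow> vpi f \<in> verma_degree chi \<Lambda> b"
  unfolding verma_degree_eq U_parts using Fhom_hom Fhom_Fspan by blast

lemma verma_degree_hom:
  assumes "X \<in> verma_degree chi \<Lambda> b"
  shows "\<exists>y\<in>hom b. X = vpi y"
proof -
  obtain x where x: "X = vpi x" "rho x \<in> U_degree chi b" using assms unfolding verma_degree_eq by blast
  then obtain y where "y \<in> hom b" "rho x = rho y" unfolding U_parts by blast
  then show ?thesis using x by (auto simp: vpi_def)
qed

lemma verma_span_image: "verma_span chi \<Lambda> (vpi ` S) = vpi ` FA.span S"
  unfolding verma_span_def
  by (rule lin_span_image[OF verma_pres]) (simp add: U_gens verma_smult fscale_def)

lemma vpi_N0: "vpi x \<in> vpi ` N0 \<longleftrightarrow> x \<in> N0"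
proof
  assume "vpi x \<in> vpi ` N0"
  then obtain y where "y \<in> N0" "x - y \<in> V" by (auto simp: vpi_eq)
  then show "x \<in> N0" using FA.subspace_add[OF subspace_N0, of "x - y" y] V_N0 by auto
qed auto

lemma N0_sub: "submodule (vpi ` N0) (U chi) (verma chi \<Lambda>)"
  unfolding verma_submodule pres_sub_def vpi_N0
  using FA.subspace_0[OF subspace_N0] FA.subspace_diff[OF subspace_N0] N0_mult by blast

lemma one_notin_N0: "1 \<notin> N0"
  using eps_rad[of 1] by (auto simp: N0_def)

text \<open>Rests on \<open>wproj_rad\<close>: the weight components of an element of
  \<open>rad\<close> stay in \<open>rad\<close>, and \<open>iota\<close> turns them into homogeneous
  representatives.\<close>

lemma N0_graded: "proper_graded_submodule chi \<Lambda> (vpi ` N0)"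
  unfolding proper_graded_submodule_def
proof (intro conjI N0_sub)
  show "vpi ` N0 \<noteq> carrier (verma chi \<Lambda>)"
    using vpi_N0[of 1] one_notin_N0 by (auto simp: pres_carrier[OF verma_pres])
  let ?S = "{x \<in> N0. \<exists>b. vpi x \<in> verma_degree chi \<Lambda> b}"
  have S: "(\<Union>b. vpi ` N0 \<inter> verma_degree chi \<Lambda> b) = vpi ` ?S" by auto
  have "vpi ` N0 \<subseteq> vpi ` FA.span ?S"
  proof
    fix X assume "X \<in> vpi ` N0"
    then obtain x where x: "X = vpi x" "act gact x 1 \<in> rad" by (auto simp: N0_def)
    let ?m = "act gact x 1"
    obtain B where B: "finite B" "?m = (\<Sum>b\<in>B. wproj b ?m)" using sum_wproj by blast
    have "iota (wproj b ?m) \<in> FA.span ?S" for b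
    proof (rule FA.span_base, intro CollectI conjI exI)
      show "iota (wproj b ?m) \<in> N0" using x(2) by (simp add: N0_def act_iota wproj_rad)
      show "vpi (iota (wproj b ?m)) \<in> verma_degree chi \<Lambda> (- b)"
        by (intro Fhom_verma_degree iota_wspace wproj_wspace)
    qed
    then have "(\<Sum>b\<in>B. iota (wproj b ?m)) \<in> FA.span ?S" by (rule FA.span_sum)
    moreover have "iota ?m = (\<Sum>b\<in>B. iota (wproj b ?m))"
      by (rule trans[OF arg_cong[OF B(2), of iota] flin_sum[OF flin_iota]])
    ultimately have "iota ?m \<in> FA.span ?S" by (rule ssubst[rotated])
    moreover have "vpi x = vpi (iota ?m)" by (simp add: vpi_eq V_reduce)
    ultimately show "X \<in> vpi ` FA.span ?S" using x by blast
  qed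
  moreover have "FA.span ?S \<subseteq> N0" by (intro FA.span_minimal subspace_N0) auto
  ultimately show "vpi ` N0 = verma_span chi \<Lambda> (\<Union>b. vpi ` N0 \<inter> verma_degree chi \<Lambda> b)"
    unfolding S verma_span_image by blast
qed

text \<open>In degree 0 an element of \<open>P\<close> is a multiple of the highest weight vector,
  and a nonzero multiple would make \<open>P\<close> everything. In other degrees there is no
  constant term. So \<open>eps\<close> vanishes on \<open>P\<close>, and as \<open>P\<close> is a
  submodule this persists after acting by any \<open>u\<close>.\<close>

lemma graded_subset_N0:
  assumes "proper_graded_submodule chi \<Lambda> P"
  shows "P \<subseteq> vpi ` N0"
proof -
  have sub: "pres_sub vpi P" "\<And>a x. vpi x \<in> P \<Longrightarrow> vpi (a * x) \<in> P"
    and proper: "P \<noteq> carrier (verma chi \<Lambda>)"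
    and gr: "P = verma_span chi \<Lambda> (\<Union>b. P \<inter> verma_degree chi \<Lambda> b)"
    using assms unfolding proper_graded_submodule_def verma_submodule by blast+
  have one: "vpi 1 \<notin> P"
  proof
    assume "vpi 1 \<in> P"
    then have "vpi x \<in> P" for x using sub(2)[of 1 x] by simp
    then show False using proper sub(1) by (auto simp: pres_carrier[OF verma_pres] pres_sub_def)
  qed
  let ?S = "{s. \<exists>b. vpi s \<in> P \<inter> verma_degree chi \<Lambda> b}"
  have "(\<Union>b. P \<inter> verma_degree chi \<Lambda> b) = vpi ` ?S" using verma_degree_hom by fastforce
  then have P: "P = vpi ` FA.span ?S" using gr by (simp add: verma_span_image)
  have V: "eps (act gact x 1) = 0" if "x \<in> V" for x
    using that V_N0 eps_rad by (auto simp: N0_def)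
  have s: "eps (act gact s 1) = 0" if s: "s \<in> ?S" for s
  proof -
    obtain b where b: "vpi s \<in> P" "vpi s \<in> verma_degree chi \<Lambda> b" using s by blast
    obtain y where y: "y \<in> hom b" "vpi s = vpi y" using verma_degree_hom[OF b(2)] by blast
    have *: "act gact y 1 \<in> wspace (0 - b)"
      using act_wspace[OF y(1), of 1 0] mon_wspace[of "[]"] by simp
    have "eps (act gact (s - y) 1) = 0" using y(2) by (intro V) (simp add: vpi_eq)
    then have sy: "eps (act gact s 1) = eps (act gact y 1)" by (simp add: act_simps)
    show ?thesis
    proof (cases "b = 0")
      case True
      let ?c = "eps (act gact y 1)"
      have "act gact y 1 = fscale ?c 1" using wspace_0 * True by simp
      then have "act gact (y - const ?c) 1 = 0" by (simp add: act_simps)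
      then have "y - const ?c \<in> V" using V_reduce[of "y - const ?c"] by (simp add: flin_simps[OF flin_iota])
      then have "vpi (const ?c) \<in> P" using b(1) y(2) by (simp add: vpi_eq[symmetric])
      then have "vpi (const (inverse ?c) * const ?c) \<in> P" by (rule sub(2))
      then have "?c = 0" using one by (cases "?c = 0") (simp_all flip: const_mult)
      then show ?thesis by (simp add: sy)
    next
      case False
      then show ?thesis using eps_wspace[OF *] by (simp add: sy)
    qed
  qed
  have eps: "eps (act gact y 1) = 0" if y: "vpi y \<in> P" for y
  proof -
    obtain y' where y': "y' \<in> FA.span ?S" "vpi y = vpi y'" using y P by blast
    from y'(1) have "eps (act gact y' 1) = 0"
      by (induction rule: FA.span_induct_alt) (use s in \<open>simp_all add: act_simps\<close>)
    moreover have "eps (act gact (y - y') 1) = 0" using y'(2) by (intro V) (simp add: vpi_eq)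
    ultimately show ?thesis by (simp add: act_simps)
  qed
  show ?thesis
  proof
    fix X assume X: "X \<in> P"
    then obtain x where x: "X = vpi x" using P by blast
    have "eps (act gact u (act gact x 1)) = 0" for u
      using eps[of "u * x"] sub(2)[of x u] X x by (simp add: act_times)
    then show "X \<in> vpi ` N0" by (simp add: x vpi_N0) (simp add: N0_def rad_iff)
  qed
qed

lemma max_graded_submodule_eq: "max_graded_submodule chi \<Lambda> = vpi ` N0"
proof -
  have "\<Union> {P. proper_graded_submodule chi \<Lambda> P} = vpi ` N0"
    using N0_graded graded_subset_N0 by blast
  moreover have "FA.span N0 = N0" by (simp add: FA.span_eq_iff subspace_N0)
  ultimately show ?thesis
    unfolding max_graded_submodule_def by (simp only: verma_span_image)
qed

definition ipi :: "('k, 'n) free_gen \<Rightarrow> ('k, 'n) irr_elem"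
  where "ipi x = max_graded_submodule chi \<Lambda> +>\<^bsub>verma chi \<Lambda>\<^esub> vpi x"

lemmas max_sub = conjunct1[OF N0_sub[unfolded verma_submodule]]

lemma irr_pres: "pres (irr chi \<Lambda>) ipi N0"
proof -
  have "pres (irr chi \<Lambda>) (\<lambda>x. vpi ` N0 +>\<^bsub>verma chi \<Lambda>\<^esub> vpi x) {x. vpi x \<in> vpi ` N0}"
    by (rule pres_quotient[OF verma_pres max_sub]) (simp_all add: irr_def quotient_module_def max_graded_submodule_eq)
  then show ?thesis by (simp add: ipi_def[abs_def] vpi_N0 max_graded_submodule_eq)
qed

lemma irr_smult: "rho a \<odot>\<^bsub>irr chi \<Lambda>\<^esub> ipi x = ipi (a * x)"
  unfolding irr_def quotient_module_def ipi_def max_graded_submodule_eq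
  using pres_coset_smult[OF verma_pres max_sub, of "\<lambda>m. rho a \<odot>\<^bsub>verma chi \<Lambda>\<^esub> m" "\<lambda>x. a * x" x] N0_mult
  by (simp add: verma_smult right_diff_distrib vpi_N0)

lemma irr_span_image: "lin_span (irr chi \<Lambda>) (\<lambda>c m. U_const chi c \<odot>\<^bsub>irr chi \<Lambda>\<^esub> m) (ipi ` S) = ipi ` FA.span S"
  by (rule lin_span_image[OF irr_pres]) (simp add: U_gens irr_smult fscale_def)

text \<open>The map \<open>x \<mapsto> x v\<close> identifies \<open>irr\<close> with
  \<open>M / rad\<close>, and \<open>iota\<close> goes back; finite spanning sets are carried along
  both.\<close>

theorem finite_dimensional_irr_iff:
  "finite_dimensional chi (irr chi \<Lambda>) \<longleftrightarrow> (\<exists>B. finite B \<and> FA.span (B \<union> rad) = UNIV)"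
proof
  assume "finite_dimensional chi (irr chi \<Lambda>)"
  then obtain B where B: "finite B" "B \<subseteq> range ipi"
    "lin_span (irr chi \<Lambda>) (\<lambda>c m. U_const chi c \<odot>\<^bsub>irr chi \<Lambda>\<^esub> m) B = range ipi"
    by (auto simp: finite_dimensional_def pres_carrier[OF irr_pres])
  obtain S where S: "finite S" "B = ipi ` S" using finite_subset_image[OF B(1,2)] by blast
  have "m \<in> FA.span ((\<lambda>x. act gact x 1) ` S \<union> rad)" for m
  proof -
    have "ipi (iota m) \<in> ipi ` FA.span S" using B(3) unfolding S(2) irr_span_image by blast
    then obtain y where y: "y \<in> FA.span S" "iota m - y \<in> N0" using pres_eq[OF irr_pres] by blast
    then have 1: "m - act gact y 1 \<in> rad" by (simp add: N0_def act_simps act_iota)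
    have "act gact y 1 \<in> FA.span ((\<lambda>x. act gact x 1) ` S)"
      using y(1) flin_span[OF flin_act1, of gact 1 S] by blast
    then have "act gact y 1 \<in> FA.span ((\<lambda>x. act gact x 1) ` S \<union> rad)"
      using FA.span_mono[of "(\<lambda>x. act gact x 1) ` S" "(\<lambda>x. act gact x 1) ` S \<union> rad"] by auto
    moreover have "m - act gact y 1 \<in> FA.span ((\<lambda>x. act gact x 1) ` S \<union> rad)"
      using 1 by (intro FA.span_base) auto
    ultimately have "(m - act gact y 1) + act gact y 1 \<in> FA.span ((\<lambda>x. act gact x 1) ` S \<union> rad)"
      by (intro FA.span_add)
    then show ?thesis by simp
  qed
  then show "\<exists>B. finite B \<and> FA.span (B \<union> rad) = UNIV" using S(1) by blast
next
  assume "\<exists>B. finite B \<and> FA.span (B \<union> rad) = UNIV"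
  then obtain B where B: "finite B" "FA.span (B \<union> rad) = UNIV" by blast
  have "ipi x \<in> ipi ` FA.span (iota ` B)" for x
  proof -
    have "act gact x 1 \<in> FA.span (B \<union> rad)" using B by simp
    then obtain b r where br: "act gact x 1 = b + r" "b \<in> FA.span B" "r \<in> rad"
      using FA.span_eq_iff[THEN iffD2, OF subspace_rad] unfolding FA.span_Un by auto
    then have "x - iota b \<in> N0" by (simp add: N0_def act_simps act_iota)
    then have "ipi x = ipi (iota b)" using pres_eq[OF irr_pres] by blast
    then show ?thesis using br(2) flin_span[OF flin_iota, of B] by blast
  qed
  then have "lin_span (irr chi \<Lambda>) (\<lambda>c m. U_const chi c \<odot>\<^bsub>irr chi \<Lambda>\<^esub> m) (ipi ` iota ` B) = range ipi"
    unfolding irr_span_image by blast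
  then show "finite_dimensional chi (irr chi \<Lambda>)"
    unfolding finite_dimensional_def pres_carrier[OF irr_pres]
    using B(1) by (intro exI[of _ "ipi ` iota ` B"]) auto
qed

end

section \<open>Finiteness of the simple quotient\<close>

lemma qnum_Suc: "qnum (Suc m) t = 1 + t * qnum m t"
  unfolding qnum_def by (subst sum.lessThan_Suc_shift) (simp add: sum_distrib_left)

lemma qnum_Suc': "qnum (Suc m) t = qnum m t + t ^ m"
  by (simp add: qnum_def)

lemma qnum_nz: "\<not> root_of_unity t \<Longrightarrow> qnum (Suc m) t \<noteq> 0"
proof
  assume t: "\<not> root_of_unity t" and "qnum (Suc m) t = 0"
  moreover have "(t - 1) * qnum (Suc m) t = t ^ Suc m - 1"
    unfolding qnum_def by (simp only: power_diff_1_eq)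
  ultimately have "t ^ Suc m = 1" by simp
  then show False using t unfolding root_of_unity_def by blast
qed

text \<open>The powers of \<open>1 / t\<close> up to \<open>m\<close> add up to
  \<open>qnum (Suc m) t / t ^ m\<close>, so both geometric sums share a factor. It is used for
  \<open>E_i\<close> on powers of \<open>F_i\<close>, for the \<open>q\<close>-Serre elements, and
  for \<open>F_i\<close> on powers of \<open>E_i\<close>.\<close>

lemma qsum_closed_form:
  assumes "t \<noteq> 0"
  shows "(\<Sum>j<Suc m. t ^ j * x - y / t ^ j) = qnum (Suc m) t * (x - y / t ^ m)"
proof (induction m)
  case (Suc m)
  have "(\<Sum>j<Suc (Suc m). t ^ j * x - y / t ^ j) = qnum (Suc m) t * (x - y / t ^ m) + (t ^ Suc m * x - y / t ^ Suc m)"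
    by (simp only: sum.lessThan_Suc[of _ "Suc m"] Suc)
  also have "\<dots> = (qnum (Suc m) t + t ^ Suc m) * x - (t * qnum (Suc m) t + 1) * y / t ^ Suc m"
  proof -
    have gen: "u * (x - t * y / z) + (z * x - y / z) = (u + z) * x - (t * u + 1) * y / z" for u z
      by (simp add: algebra_simps add_divide_distrib)
    have "y / t ^ m = t * y / t ^ Suc m" using assms by simp
    then show ?thesis by (simp only: gen)
  qed
  also have "\<dots> = qnum (Suc (Suc m)) t * (x - y / t ^ Suc m)"
  proof -
    have "t * qnum (Suc m) t + 1 = qnum (Suc (Suc m)) t" by (simp add: qnum_Suc[of "Suc m"])
    then show ?thesis
      unfolding qnum_Suc'[of "Suc m", symmetric] by (simp only: right_diff_distrib times_divide_eq_right)
  qed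
  finally show ?case .
qed (simp add: qnum_def)

lemma root_of_unity_power_inject:
  assumes "\<not> root_of_unity t" "t \<noteq> 0" "t ^ m = t ^ n"
  shows "m = n"
proof -
  have *: "m = n" if "m \<le> n" "t ^ m = t ^ n" for m n
  proof (rule ccontr)
    assume "m \<noteq> n"
    with that have "t ^ (n - m) = 1" "0 < n - m"
      using assms(2) by (simp_all add: power_diff)
    then show False using assms(1) unfolding root_of_unity_def by blast
  qed
  show ?thesis using *[of m n] *[of n m] assms(3) by (cases "m \<le> n") auto
qed

lemma power_mult_shift: "x ^ n * (x * y) = x ^ Suc n * y" for x :: "'a::monoid_mult"
  by (simp add: power_commutes flip: mult.assoc)

lemma mon_replicate: "mon (replicate m i) = var i ^ m"
  by (induction m) (simp_all add: mon_Cons)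

lemma mon_inject: "mon u = (mon w :: ('k::field, 'g) free_algebra) \<longleftrightarrow> u = w"
proof
  assume "mon u = (mon w :: ('k, 'g) free_algebra)"
  then have "Poly_Mapping.lookup (mon u :: ('k, 'g) free_algebra) (Word w) = Poly_Mapping.lookup (mon w :: ('k, 'g) free_algebra) (Word w)" by simp
  then show "u = w" by (simp add: mon_def lookup_single when_def split: if_splits)
qed simp

lemma independent_mon:
  assumes W: "finite W"
  shows "FA.independent (mon ` W :: ('k::field, 'g) free_algebra set)"
proof (rule FA.independent_if_scalars_zero)
  fix f :: "('k, 'g) free_algebra \<Rightarrow> 'k" and x :: "('k, 'g) free_algebra"
  assume f: "(\<Sum>x\<in>mon ` W. fscale (f x) x) = 0" and "x \<in> mon ` W"
  then obtain w where w: "w \<in> W" "x = mon w" by auto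
  have "0 = Poly_Mapping.lookup (\<Sum>x\<in>mon ` W. fscale (f x) x) (Word w)" by (simp add: f)
  also have "\<dots> = (\<Sum>u\<in>W. f (mon u) * (if u = w then 1 else 0))"
    by (subst sum.reindex, simp add: inj_on_def mon_inject)
      (auto simp: lookup_sum mon_def lookup_single when_def intro!: sum.cong)
  also have "\<dots> = f x" using W w by (simp add: if_distrib cong: if_cong)
  finally show "f x = 0" by simp
qed (simp add: W)

lemma wspace_mult: "x \<in> wspace a \<Longrightarrow> y \<in> wspace b \<Longrightarrow> x * y \<in> wspace (a + b)"
  unfolding wspace_def
  by (erule span_mult_subspace, assumption, rule FA.subspace_span)
    (auto intro!: FA.span_base simp flip: mon_append)

lemma var_in_wspace: "var i \<in> wspace (\<alpha> i)"
  using mon_wspace[of "[i]"] by (simp add: mon_Cons)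

lemma eps_wspace_mult: "y \<in> wspace b \<Longrightarrow> b \<noteq> 0 \<Longrightarrow> eps (y * x) = 0"
  unfolding wspace_def
proof (induction rule: FA.span_induct_alt)
  case (step c s y)
  then obtain w where w: "s = mon w" "wt w = b" by auto
  then have "w \<noteq> []" using step.prems by auto
  then obtain i v where "s = var i * mon v" using w by (cases w) (auto simp: mon_Cons)
  then show ?case using step by (simp add: distrib_right mult.assoc)
qed simp

fun lsum :: "nat \<Rightarrow> 'a::monoid_add \<Rightarrow> 'a"
  where "lsum 0 a = 0" | "lsum (Suc n) a = a + lsum n a"

lemma ht_lsum: "ht (lsum n a) = int n * ht a"
  by (induction n) (simp_all add: ht_add algebra_simps)

lemma lsum_add: "lsum (m + n) a = lsum m a + lsum n a"
  by (induction m) (simp_all add: add.assoc)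

lemma var_power_wspace: "m \<in> wspace b \<Longrightarrow> var i ^ n * m \<in> wspace (b + lsum n (\<alpha> i))"
proof (induction n)
  case (Suc n)
  from var_wspace[OF Suc(1)[OF Suc(2)], of i] show ?case by (simp add: mult.assoc add_ac)
qed simp

lemma wspace_nz: "m \<in> wspace b \<Longrightarrow> m \<noteq> 0 \<Longrightarrow> \<exists>w. wt w = b"
  by (cases "{w. wt w = b} = {}") (auto simp: wspace_def)

context highest_weight
begin

lemma chi_lsum_left: "chi (lsum n a) b = chi a b ^ n"
  and chi_lsum_right: "chi b (lsum n a) = chi b a ^ n"
  by (induction n) (simp_all add: chi_add_left chi_add_right)

lemma lK_nz [simp]: "lK a \<noteq> 0" and lL_nz [simp]: "lL a \<noteq> 0"
  using lK_add[of a "- a"] lL_add[of a "- a"] lK_0 lL_0 by auto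

section \<open>Rank one: powers of a single \<open>F_i\<close>\<close>

lemma wt_replicate: "wt (replicate m i) = lsum m (\<alpha> i)"
  by (induction m) simp_all

lemma Kop_var_power: "Kop a (var i ^ m) = fscale (lK a * inverse (chi a (\<alpha> i) ^ m)) (var i ^ m)"
  and Lop_var_power: "Lop a (var i ^ m) = fscale (lL a * chi (\<alpha> i) a ^ m) (var i ^ m)"
  using Kop_mon[of a "replicate m i"] Lop_mon[of a "replicate m i"]
  by (simp_all add: mon_replicate wt_replicate chi_minus_right chi_lsum_left chi_lsum_right)

lemma Eop_var_power:
  defines "t \<equiv> \<lambda>i. qq i i"
  shows "Eop i (var i ^ Suc m) = fscale (qnum (Suc m) (t i) * (lL (\<alpha> i) - lK (\<alpha> i) / t i ^ m)) (var i ^ m)"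
    and "k \<noteq> i \<Longrightarrow> Eop k (var i ^ m) = 0"
proof -
  have "Eop i (var i ^ Suc m) = fscale (\<Sum>j<Suc m. t i ^ j * lL (\<alpha> i) - lK (\<alpha> i) / t i ^ j) (var i ^ m)"
  proof (induction m)
    case 0
    show ?case using Eop_var[of i i 1] Kop_var_power[of _ i 0] Lop_var_power[of _ i 0]
      by (simp add: FA.scale_left_diff_distrib)
  next
    case (Suc m)
    have "Eop i (var i ^ Suc (Suc m)) = var i * Eop i (var i ^ Suc m) + (Lop (\<alpha> i) (var i ^ Suc m) - Kop (\<alpha> i) (var i ^ Suc m))"
      by (simp only: power_Suc[of _ "Suc m"] Eop_var if_True simp_thms)
    then show ?case
      unfolding Suc Kop_var_power Lop_var_power
      by (subst sum.lessThan_Suc) (simp add: fscale_add_left FA.scale_left_diff_distrib t_def mult.commute divide_inverse algebra_simps)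
  qed
  then show "Eop i (var i ^ Suc m) = fscale (qnum (Suc m) (t i) * (lL (\<alpha> i) - lK (\<alpha> i) / t i ^ m)) (var i ^ m)"
    by (subst (asm) qsum_closed_form) (simp_all add: t_def)
  show "Eop k (var i ^ m) = 0" if "k \<noteq> i"
    using that by (induction m) (simp_all add: Eop_var)
qed

text \<open>If no \<open>r\<close> fits, no coefficient in \<open>Eop_var_power\<close> vanishes.
  The functionals \<open>psi k\<close> then show that all powers of \<open>F_i\<close> applied to
  \<open>v\<close> stay independent modulo \<open>rad\<close>.\<close>

lemma integrality:
  assumes B: "finite B" "FA.span (B \<union> rad) = UNIV" and t: "\<not> root_of_unity (qq i i)"
  shows "\<exists>r. lK (\<alpha> i) = qq i i ^ r * lL (\<alpha> i)"
proof (rule ccontr)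
  assume no: "\<nexists>r. lK (\<alpha> i) = qq i i ^ r * lL (\<alpha> i)"
  define psi where "psi = (\<lambda>k x. eps (foldr Eop (replicate k i) x))"
  have same: "psi k (var i ^ k) \<noteq> 0" for k
  proof (induction k)
    case (Suc k)
    have "lL (\<alpha> i) - lK (\<alpha> i) / qq i i ^ k \<noteq> 0"
    proof
      assume "lL (\<alpha> i) - lK (\<alpha> i) / qq i i ^ k = 0"
      then have "lK (\<alpha> i) = qq i i ^ k * lL (\<alpha> i)" by (simp add: field_simps)
      then show False using no by blast
    qed
    moreover have "foldr Eop (replicate (Suc k) i) x = foldr Eop (replicate k i) (Eop i x)" for x
      by (induction k) simp_all
    ultimately show ?case
      using Suc qnum_nz[OF t, of k] by (simp add: psi_def Eop_var_power(1) flin_simps[OF flin_foldr_Eop] del: replicate_Suc power_Suc foldr_replicate)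
  qed (simp add: psi_def)
  have diff: "psi k (var i ^ l) = 0" if "k \<noteq> l" for k l
  proof -
    have "foldr Eop (replicate k i) (var i ^ l) \<in> wspace (lsum l (\<alpha> i) - lsum k (\<alpha> i))"
      using foldr_Eop_wspace[OF mon_wspace, of "replicate k i" "replicate l i"] by (simp add: mon_replicate wt_replicate)
    moreover have "lsum l (\<alpha> i) - lsum k (\<alpha> i) \<noteq> 0"
      using that ht_lsum[of l "\<alpha> i"] ht_lsum[of k "\<alpha> i"] by auto
    ultimately have "eps (foldr Eop (replicate k i) (var i ^ l) * 1) = 0" by (rule eps_wspace_mult)
    then show ?thesis by (simp add: psi_def del: foldr_replicate)
  qed
  define d where "d = card B"
  \<comment> \<open>\<open>T\<close> kills \<open>rad\<close>, so its range is spanned by the images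
    of the \<open>d\<close> elements of \<open>B\<close>; yet it contains nonzero multiples of the
    \<open>d + 1\<close> independent vectors \<open>var i ^ k\<close> with
    \<open>k \<le> d\<close>.\<close>
  define T where "T = (\<lambda>x. \<Sum>k\<le>d. fscale (psi k x) (var i ^ k :: ('k, 'n) free_algebra))"
  have "flin T"
    by (rule flinI) (simp_all add: T_def psi_def flin_simps[OF flin_foldr_Eop] fscale_add_left sum.distrib FA.scale_sum_right del: foldr_replicate)
  have Tp: "T (var i ^ k) = fscale (psi k (var i ^ k)) (var i ^ k)" if "k \<le> d" for k
  proof -
    have "T (var i ^ k) = (\<Sum>l\<le>d. if l = k then fscale (psi k (var i ^ k)) (var i ^ k) else 0)"
      unfolding T_def by (rule sum.cong) (auto simp: diff)
    then show ?thesis using that by simp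
  qed
  have "T x = 0" if "x \<in> rad" for x using that by (simp add: T_def psi_def radD del: foldr_replicate)
  then have "T ` (B \<union> rad) \<subseteq> insert 0 (T ` B)" by auto
  then have "FA.span (T ` (B \<union> rad)) \<subseteq> FA.span (T ` B)"
    using FA.span_mono[of "T ` (B \<union> rad)" "insert 0 (T ` B)"] by (simp add: FA.span_insert_0)
  then have ran: "T x \<in> FA.span (T ` B)" for x
    using flin_span[OF \<open>flin T\<close>, of "B \<union> rad"] B(2) by auto
  let ?W = "(\<lambda>k. replicate k i) ` {..d}"
  have "mon ` ?W \<subseteq> FA.span (T ` B)"
  proof
    fix x :: "('k, 'n) free_algebra"
    assume "x \<in> mon ` ?W"
    then obtain k where k: "k \<le> d" "x = var i ^ k" by (auto simp: mon_replicate)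
    have "x = fscale (inverse (psi k (var i ^ k))) (T (var i ^ k))" using k same[of k] by (simp add: Tp)
    then show "x \<in> FA.span (T ` B)" using FA.span_scale[OF ran] by simp
  qed
  then have "card (mon ` ?W :: ('k, 'n) free_algebra set) \<le> card (T ` B)"
    using FA.independent_span_bound[of "T ` B" "mon ` ?W"] B(1) independent_mon[of ?W] by simp
  moreover have "card (mon ` ?W :: ('k, 'n) free_algebra set) = Suc d"
  proof -
    have "card (mon ` ?W :: ('k, 'n) free_algebra set) = card ?W"
      by (rule card_image) (simp add: inj_on_def mon_inject)
    also have "\<dots> = Suc d" by (subst card_image) (auto simp: inj_on_def)
    finally show ?thesis .
  qed
  moreover have "card (T ` B) \<le> d" unfolding d_def using B(1) by (rule card_image_le)
  ultimately show False by simp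
qed

section \<open>The \<open>q\<close>-Serre elements\<close>

lemma Kop_wspace_mult: "y \<in> wspace b \<Longrightarrow> Kop a (y * x) = fscale (chi a (- b)) (y * Kop a x)"
  and Lop_wspace_mult: "y \<in> wspace b \<Longrightarrow> Lop a (y * x) = fscale (chi b a) (y * Lop a x)"
proof -
  have *: "Kop a (mon w * x) = fscale (chi a (- wt w)) (mon w * Kop a x)"
    "Lop a (mon w * x) = fscale (chi (wt w) a) (mon w * Lop a x)" for w
    by (induction w) (simp_all add: mon_Cons mult.assoc Kop_var Lop_var op_simps chi_add_left chi_add_right chi_minus_right
        del: minus_add_distrib)
  have "y \<in> wspace b \<Longrightarrow> Kop a (y * x) = fscale (chi a (- b)) (y * Kop a x) \<and> Lop a (y * x) = fscale (chi b a) (y * Lop a x)"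
    unfolding wspace_def
    by (induction rule: FA.span_induct_alt) (auto simp: * op_simps distrib_right fscale_add_right mult.commute)
  then show "y \<in> wspace b \<Longrightarrow> Kop a (y * x) = fscale (chi a (- b)) (y * Kop a x)"
    "y \<in> wspace b \<Longrightarrow> Lop a (y * x) = fscale (chi b a) (y * Lop a x)" by blast+
qed

text \<open>Iterated \<open>q\<close>-commutators of \<open>F\<^sub>i\<close> with \<open>F\<^sub>j\<close>. The scalar is chosen to cancel the \<open>L\<^sub>i\<close>-part of
  the commutator with \<open>E\<^sub>i\<close>.\<close>

fun serre :: "'n \<Rightarrow> 'n \<Rightarrow> nat \<Rightarrow> ('k, 'n) free_algebra"
  where
    "serre i j 0 = var j"
  | "serre i j (Suc m) = var i * serre i j m - fscale (qq i i ^ m * qq j i) (serre i j m * var i)"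

lemma serre_wspace: "serre i j m \<in> wspace (\<alpha> j + lsum m (\<alpha> i))"
proof (induction m)
  case 0
  show ?case by (simp add: var_in_wspace)
next
  case (Suc m)
  have "var i * serre i j m \<in> wspace (\<alpha> j + lsum (Suc m) (\<alpha> i))"
    "serre i j m * var i \<in> wspace (\<alpha> j + lsum (Suc m) (\<alpha> i))"
    using wspace_mult[OF var_in_wspace Suc, of i] wspace_mult[OF Suc var_in_wspace, of i] by (simp_all add: add_ac)
  then show ?case by (simp add: FA.subspace_diff[OF subspace_wspace] FA.subspace_scale[OF subspace_wspace])
qed

text \<open>After the \<open>L_i\<close>-terms have cancelled, the \<open>K_i\<close>-terms collect
  into a sum of the form treated by \<open>qsum_closed_form\<close>.\<close>

lemma Eop_serre_i:
  assumes "i \<noteq> j"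
  defines "t \<equiv> qq i i"
  shows "Eop i (serre i j (Suc m) * x) = serre i j (Suc m) * Eop i x
    + fscale (\<Sum>l<Suc m. t ^ l * qq j i - inverse (qq i j) / t ^ l) (serre i j m * Kop (\<alpha> i) x)"
proof -
  define b where "b = qq j i"
  define a where "a = inverse (qq i j)"
  define c where "c = (\<lambda>m. \<Sum>l<m. t ^ l * b - a / t ^ l)"
  have t: "t \<noteq> 0" by (simp add: t_def)
  have Ku: "Kop (\<alpha> i) (serre i j m * y) = fscale (a / t ^ m) (serre i j m * Kop (\<alpha> i) y)"
    and Lu: "Lop (\<alpha> i) (serre i j m * y) = fscale (t ^ m * b) (serre i j m * Lop (\<alpha> i) y)" for m y
    using Kop_wspace_mult[OF serre_wspace, of "\<alpha> i" i j m y] Lop_wspace_mult[OF serre_wspace, of "\<alpha> i" i j m y]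
    by (simp_all add: a_def b_def t_def chi_add_left chi_add_right chi_minus_right chi_lsum_left chi_lsum_right
        divide_inverse mult.commute del: minus_add_distrib)
  \<comment> \<open>\<open>z\<close> stands for \<open>serre i j (m - 1)\<close>, or for 0 when
    \<open>m = 0\<close>, where \<open>c 0 = 0\<close>; one computation thus serves for base and
    step. The factor \<open>inverse t\<close> comes from carrying \<open>K_i\<close> past
    \<open>F_i\<close>.\<close>
  have step: "Eop i (serre i j (Suc m) * x) = serre i j (Suc m) * Eop i x + fscale (c (Suc m)) (serre i j m * Kop (\<alpha> i) x)"
    if IH: "\<And>x. Eop i (serre i j m * x) = serre i j m * Eop i x + fscale (c m) (z * Kop (\<alpha> i) x)"
      and z: "fscale (c m) (var i * z - fscale (t ^ m * b * inverse t) (z * var i)) = fscale (c m) (serre i j m)" for m z x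
  proof -
    have 1: "Eop i (var i * (serre i j m * x)) = var i * (serre i j m * Eop i x) + fscale (c m) (var i * (z * Kop (\<alpha> i) x))
        + (fscale (t ^ m * b) (serre i j m * Lop (\<alpha> i) x) - fscale (a / t ^ m) (serre i j m * Kop (\<alpha> i) x))"
      by (simp add: Eop_var IH Ku Lu distrib_left)
    have 2: "Eop i (serre i j m * (var i * x)) = serre i j m * (var i * Eop i x) + serre i j m * Lop (\<alpha> i) x - serre i j m * Kop (\<alpha> i) x
        + fscale (c m * inverse t) (z * (var i * Kop (\<alpha> i) x))"
      by (simp add: IH Eop_var Kop_var distrib_left right_diff_distrib chi_minus_right t_def)
    have "fscale (c m) (var i * (z * Kop (\<alpha> i) x)) - fscale (t ^ m * b * (c m * inverse t)) (z * (var i * Kop (\<alpha> i) x))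
        = fscale (c m) (var i * z - fscale (t ^ m * b * inverse t) (z * var i)) * Kop (\<alpha> i) x"
      by (simp add: FA.scale_right_diff_distrib left_diff_distrib mult_ac mult.assoc)
    also have "\<dots> = fscale (c m) (serre i j m * Kop (\<alpha> i) x)" by (simp add: z)
    finally have 3: "fscale (c m) (var i * (z * Kop (\<alpha> i) x)) =
       fscale (t ^ m * b * (c m * inverse t)) (z * (var i * Kop (\<alpha> i) x)) + fscale (c m) (serre i j m * Kop (\<alpha> i) x)"
      by (simp add: algebra_simps)
    have "serre i j (Suc m) * x = var i * (serre i j m * x) - fscale (t ^ m * b) (serre i j m * (var i * x))"
      by (simp add: left_diff_distrib mult.assoc t_def b_def)
    then have "Eop i (serre i j (Suc m) * x) = Eop i (var i * (serre i j m * x)) - fscale (t ^ m * b) (Eop i (serre i j m * (var i * x)))"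
      by (simp add: op_simps)
    also have "\<dots> = serre i j (Suc m) * Eop i x + fscale (c m + (t ^ m * b - a / t ^ m)) (serre i j m * Kop (\<alpha> i) x)"
      unfolding 1 2 3
      by (simp add: fscale_add_right FA.scale_right_diff_distrib fscale_add_left FA.scale_left_diff_distrib left_diff_distrib mult.assoc
          algebra_simps t_def[symmetric] b_def[symmetric])
    finally show ?thesis by (simp add: c_def)
  qed
  have "Eop i (serre i j (Suc m) * x) = serre i j (Suc m) * Eop i x + fscale (c (Suc m)) (serre i j m * Kop (\<alpha> i) x)" for x
  proof (induction m arbitrary: x)
    case 0
    show ?case
      by (rule step[of 0 0]) (use assms(1) in \<open>simp_all add: Eop_var c_def\<close>)
  next
    case (Suc m)
    show ?case
      by (rule step[OF Suc]) (use t in \<open>simp add: t_def[symmetric] b_def[symmetric] mult.assoc\<close>)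
  qed
  then show ?thesis by (simp add: c_def a_def b_def)
qed

text \<open>Here the \<open>K_j\<close>-terms cancel, already for \<open>m = 0\<close>, and every
  further commutator with \<open>F_i\<close> multiplies the \<open>L_j\<close>-term by one new
  factor.\<close>

lemma Eop_serre_j:
  assumes "i \<noteq> j"
  shows "Eop j (serre i j (Suc m) * x) = serre i j (Suc m) * Eop j x
    + fscale (\<Prod>l<Suc m. 1 - qq i i ^ l * (qq i j * qq j i)) (var i ^ Suc m * Lop (\<alpha> j) x)"
proof (induction m arbitrary: x)
  case 0
  show ?case using assms
    by (simp add: left_diff_distrib mult.assoc op_simps Eop_var Kop_var Lop_var distrib_left right_diff_distrib
        chi_minus_right algebra_simps FA.scale_left_diff_distrib fscale_add_right FA.scale_right_diff_distrib)
next
  case (Suc m)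
  let ?u = "serre i j (Suc m)" and ?t = "qq i i ^ Suc m * qq j i"
  let ?D = "\<lambda>m. \<Prod>l<m. 1 - qq i i ^ l * (qq i j * qq j i)"
  have p: "var i * (var i ^ Suc m * y) = var i ^ Suc (Suc m) * y" "var i ^ Suc m * (var i * y) = var i ^ Suc (Suc m) * y" for y
    by (simp_all only: power_mult_shift) (simp add: mult.assoc)
  have u: "serre i j (Suc (Suc m)) * y = var i * (?u * y) - fscale ?t (?u * (var i * y))" for y
    by (subst serre.simps(2)) (simp add: left_diff_distrib mult.assoc del: serre.simps)
  have "Eop j (serre i j (Suc (Suc m)) * x) = var i * Eop j (?u * x) - fscale ?t (Eop j (?u * (var i * x)))"
    using assms by (simp add: u op_simps Eop_var del: serre.simps)
  also have "\<dots> = var i * (?u * Eop j x) - fscale ?t (?u * (var i * Eop j x))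
      + (fscale (?D (Suc m)) (var i ^ Suc (Suc m) * Lop (\<alpha> j) x)
        - fscale (?t * ?D (Suc m) * qq i j) (var i ^ Suc (Suc m) * Lop (\<alpha> j) x))"
    using assms
    by (simp add: Suc Eop_var Lop_var distrib_left fscale_add_right p mult.assoc del: serre.simps power_Suc prod.lessThan_Suc)
  also have "\<dots> = serre i j (Suc (Suc m)) * Eop j x + fscale (?D (Suc (Suc m))) (var i ^ Suc (Suc m) * Lop (\<alpha> j) x)"
    unfolding u by (subst (3) prod.lessThan_Suc)
      (simp add: FA.scale_left_diff_distrib right_diff_distrib left_diff_distrib mult_ac del: serre.simps power_Suc prod.lessThan_Suc)
  finally show ?case .
qed

lemma Eop_serre_other: "k \<noteq> i \<Longrightarrow> k \<noteq> j \<Longrightarrow> Eop k (serre i j m * x) = serre i j m * Eop k x"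
  by (induction m arbitrary: x) (simp_all add: Eop_var left_diff_distrib mult.assoc op_simps)

text \<open>The hypothesis makes both scalars vanish: the closed form of the sum in
  \<open>Eop_serre_i\<close> and the factor \<open>l = m\<close> in \<open>Eop_serre_j\<close>. The
  element then commutes with every \<open>E_k\<close>, and multiplying by it leaves no constant
  term.\<close>

lemma serre_rad:
  assumes "i \<noteq> j" and p: "qq i i ^ m * (qq i j * qq j i) = 1"
  shows "serre i j (Suc m) * x \<in> rad"
proof -
  let ?u = "serre i j (Suc m)"
  have "qq j i - inverse (qq i j) / qq i i ^ m = 0"
    using p by (simp add: field_simps)
  then have i: "Eop i (?u * x) = ?u * Eop i x" for x
    unfolding Eop_serre_i[OF assms(1)] by (subst qsum_closed_form) simp_all
  have j: "Eop j (?u * x) = ?u * Eop j x" for x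
    unfolding Eop_serre_j[OF assms(1)] using p by simp
  have E: "Eop k (?u * x) = ?u * Eop k x" for k x
    using i j Eop_serre_other[of k i j "Suc m" x] by (cases "k = i"; cases "k = j") (simp_all del: serre.simps)
  have "foldr Eop w (?u * x) = ?u * foldr Eop w x" for w
    by (induction w) (simp_all only: E foldr.simps o_apply id_apply)
  moreover have "\<alpha> j + lsum (Suc m) (\<alpha> i) \<noteq> 0"
  proof
    assume "\<alpha> j + lsum (Suc m) (\<alpha> i) = 0"
    then have "ht (\<alpha> j + lsum (Suc m) (\<alpha> i)) = 0" by simp
    then show False by (simp add: ht_add ht_lsum del: lsum.simps)
  qed
  ultimately show ?thesis
    by (intro radI) (simp add: eps_wspace_mult[OF serre_wspace] del: serre.simps lsum.simps)
qed

lemma mult_rad: "m \<in> rad \<Longrightarrow> x * m \<in> rad"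
proof (induction x rule: free_algebra_induct)
  case (mon w)
  then show ?case by (induction w) (simp_all add: mon_Cons mult.assoc var_rad)
qed (simp_all add: distrib_right FA.subspace_add[OF subspace_rad] FA.subspace_scale[OF subspace_rad])

text \<open>From \<open>F_i u_m = u_(m+1) + c u_m F_i\<close> with \<open>u_m = serre i j m\<close>:
  each \<open>F_i\<close> either raises \<open>m\<close>, at most \<open>M - m\<close> times before
  \<open>rad\<close> is reached, or passes on to \<open>y\<close>, at most \<open>s\<close> times.
  The case \<open>m = 0\<close> controls \<open>F_i\<close> on \<open>F_j y\<close>.\<close>

lemma serre_nilpotent:
  assumes M: "\<And>x. serre i j M * x \<in> rad"
  shows "var i ^ s * y \<in> rad \<Longrightarrow> m \<le> M \<Longrightarrow> var i ^ (s + (M - m)) * (serre i j m * y) \<in> rad"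
proof (induction "s + (M - m)" arbitrary: s m y)
  case 0
  then have s0: "s = 0" by arith
  have "y \<in> rad" using 0(2) unfolding s0 by simp
  then show ?case by (intro mult_rad)
next
  case (Suc n)
  consider "m = M" | "s = 0" | s' where "s = Suc s'" "m < M"
    using Suc.prems(2) by (metis not0_implies_Suc le_neq_implies_less)
  then show ?case
  proof cases
    case 1
    then show ?thesis using M by (simp add: mult_rad)
  next
    case 2
    then have "y \<in> rad" using Suc.prems by simp
    then show ?thesis by (intro mult_rad)
  next
    case 3
    let ?c = "qq i i ^ m * qq j i"
    have "var i ^ (s + (M - Suc m)) * (serre i j (Suc m) * y) \<in> rad"
      by (rule Suc.hyps(1)) (use Suc.hyps(2) Suc.prems 3 in auto)
    moreover have "s + (M - Suc m) = n" using Suc.hyps(2) 3 by arith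
    ultimately have 1: "var i ^ n * (serre i j (Suc m) * y) \<in> rad" by (simp only:)
    have "var i ^ (s' + (M - m)) * (serre i j m * (var i * y)) \<in> rad"
    proof (rule Suc.hyps(1))
      show "var i ^ s' * (var i * y) \<in> rad" using Suc.prems(1) 3
        by (simp add: power_commutes flip: mult.assoc)
    qed (use Suc.hyps(2) Suc.prems 3 in auto)
    moreover have "s' + (M - m) = n" using Suc.hyps(2) 3 by arith
    ultimately have 2: "var i ^ n * (serre i j m * (var i * y)) \<in> rad" by (simp only:)
    have "var i ^ Suc n * (serre i j m * y) = var i ^ n * (var i * (serre i j m * y))"
      by (simp add: power_commutes flip: mult.assoc)
    also have "\<dots> = var i ^ n * (serre i j (Suc m) * y) + fscale ?c (var i ^ n * (serre i j m * (var i * y)))"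
      by (simp add: left_diff_distrib right_diff_distrib mult.assoc)
    finally show ?thesis
      using 1 2 Suc.hyps(2) by (simp add: FA.subspace_add[OF subspace_rad] FA.subspace_scale[OF subspace_rad] del: serre.simps power_Suc)
  qed
qed

end

text \<open>\<open>a i j\<close> is \<open>2 (s_i, s_j) / (s_i, s_i)\<close>, and \<open>r i\<close>
  is the value of the highest weight \<open>\<lambda>\<close> on the \<open>i\<close>-th
  coroot.\<close>

locale integral_weight = highest_weight chi lK lL
  for chi :: "('k::field, 'n::finite) bichar" and lK lL +
  fixes s :: "'n \<Rightarrow> 'v::euclidean_space" and a :: "'n \<Rightarrow> 'n \<Rightarrow> int" and r :: "'n \<Rightarrow> nat"
  assumes s_inj: "inj s" and s_indep: "independent (range s)"
    and a_s: "2 * inner (s i) (s j) = of_int (a i j) * inner (s i) (s i)"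
    and a_neg: "i \<noteq> j \<Longrightarrow> a i j \<le> 0"
    and q_nroot: "\<not> root_of_unity (qq i i)"
    and q_a: "qq i j * qq j i = qq i i powi a i j"
    and lK_lL: "lK (\<alpha> i) = qq i i ^ r i * lL (\<alpha> i)"
begin

text \<open>Induction on the word: \<open>F_i\<close> to the power \<open>r i + 1\<close> makes
  \<open>v\<close> singular, a letter \<open>i\<close> in front changes nothing, and another letter
  \<open>j\<close> raises the exponent by \<open>1 - a i j\<close>, the index of the
  \<open>q\<close>-Serre element that lies in \<open>rad\<close>.\<close>

lemma nilpotent: "\<exists>t. var i ^ t * m \<in> rad"
proof (induction m rule: free_algebra_induct)
  case (mon w)
  show ?case
  proof (induction w)
    case Nil
    have "var i ^ Suc (r i) \<in> rad"
    proof (rule rad_singular)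
      show "eps (var i ^ Suc (r i)) = 0" by simp
      fix k
      have "Eop k (var i ^ Suc (r i)) = 0"
        using lK_lL[of i] Eop_var_power(1)[of i "r i"] Eop_var_power(2)[of k i "Suc (r i)"]
        by (cases "k = i") (simp_all del: power_Suc)
      then show "Eop k (var i ^ Suc (r i)) \<in> rad" by (simp add: FA.subspace_0[OF subspace_rad])
    qed
    then show ?case by (intro exI[of _ "Suc (r i)"]) simp
  next
    case (Cons j w)
    then obtain t where t: "var i ^ t * mon w \<in> rad" by blast
    show ?case
    proof (cases "i = j")
      case True
      have e: "var i ^ t * mon (j # w) = var i * (var i ^ t * mon w)"
        by (simp add: mon_Cons True power_mult_shift mult.assoc)
      show ?thesis by (rule exI[of _ t], subst e, rule var_rad[OF t])
    next
      case False
      define M where "M = nat (- a i j)"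
      have "qq i i ^ M * (qq i j * qq j i) = 1"
      proof -
        have M: "qq i i ^ M = qq i i powi (- a i j)"
          using a_neg[OF False] by (simp add: M_def power_int_def)
        show ?thesis unfolding M q_a by (simp add: power_int_minus)
      qed
      then have "serre i j (Suc M) * x \<in> rad" for x using serre_rad[OF False] by blast
      from serre_nilpotent[OF this t, of 0]
      show ?thesis by (intro exI[of _ "t + Suc M"]) (simp add: mon_Cons)
    qed
  qed
next
  case (add x y)
  then obtain t u where t: "var i ^ t * x \<in> rad" and u: "var i ^ u * y \<in> rad" by blast
  have "var i ^ (u + t) * x \<in> rad" "var i ^ (t + u) * y \<in> rad"
    using mult_rad[OF t, of "var i ^ u"] mult_rad[OF u, of "var i ^ t"] by (simp_all add: power_add mult.assoc)
  then show ?case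
    by (intro exI[of _ "t + u"]) (simp add: distrib_left FA.subspace_add[OF subspace_rad] add.commute)
next
  case (scale c x)
  then obtain t where "var i ^ t * x \<in> rad" by blast
  then show ?case by (intro exI[of _ t]) (simp add: FA.subspace_scale[OF subspace_rad])
qed

text \<open>The value of \<open>b\<close> on the \<open>i\<close>-th coroot.\<close>

definition pair :: "'n \<Rightarrow> 'n lattice \<Rightarrow> int"
  where "pair i b = (\<Sum>j\<in>UNIV. a i j * Poly_Mapping.lookup b j)"

lemma pair_add: "pair i (b + c) = pair i b + pair i c"
  by (simp add: pair_def lookup_add distrib_left sum.distrib)

lemma pair_alpha: "pair i (\<alpha> j) = a i j"
  by (simp add: pair_def alpha_def lookup_single when_def if_distrib cong: if_cong)

lemma a_diag: "a i i = 2"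
proof -
  have "s i \<noteq> 0" using s_indep dependent_zero[of "range s"] by (metis rangeI)
  then show ?thesis using a_s[of i i] by simp
qed

lemma pair_lsum: "pair i (lsum n (\<alpha> i)) = 2 * int n"
  by (induction n) (simp_all add: pair_add pair_alpha a_diag, simp add: pair_def)

lemma chi_pair: "chi (\<alpha> i) (wt w) * chi (wt w) (\<alpha> i) = qq i i powi pair i (wt w)"
proof (induction w)
  case Nil
  show ?case by (simp add: pair_def)
next
  case (Cons j w)
  have "chi (\<alpha> i) (wt (j # w)) * chi (wt (j # w)) (\<alpha> i) =
      (qq i j * qq j i) * (chi (\<alpha> i) (wt w) * chi (wt w) (\<alpha> i))"
    by (simp add: chi_add_left chi_add_right mult_ac)
  then show ?case by (simp add: Cons q_a pair_add pair_alpha power_int_add)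
qed

definition lvec :: "'n lattice \<Rightarrow> 'v"
  where "lvec b = (\<Sum>i\<in>UNIV. of_int (Poly_Mapping.lookup b i) *\<^sub>R s i)"

text \<open>This is \<open>|\<lambda> - b|^2 - |\<lambda>|^2\<close> with
  \<open>2 (\<lambda>, s_i) = r_i (s_i, s_i)\<close>, expanded so that \<open>\<lambda>\<close>
  itself does not occur.\<close>

definition Q :: "'n lattice \<Rightarrow> real"
  where "Q b = inner (lvec b) (lvec b) - (\<Sum>i\<in>UNIV. of_int (Poly_Mapping.lookup b i) * real (r i) * inner (s i) (s i))"

lemma inner_lvec: "2 * inner (s i) (lvec b) = of_int (pair i b) * inner (s i) (s i)"
proof -
  have "2 * inner (s i) (lvec b) = (\<Sum>j\<in>UNIV. of_int (Poly_Mapping.lookup b j) * (2 * inner (s i) (s j)))"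
    by (simp add: lvec_def inner_sum_right sum_distrib_left mult_ac)
  also have "\<dots> = of_int (pair i b) * inner (s i) (s i)"
    by (simp add: a_s pair_def sum_distrib_right sum_distrib_left mult_ac)
  finally show ?thesis .
qed

text \<open>By the assumption \<open>\<lambda> - b\<close> takes the value \<open>- k\<close> on the
  \<open>i\<close>-th coroot, so adding \<open>k\<close> times \<open>s i\<close> is the reflection,
  an isometry.\<close>

lemma Q_reflect:
  assumes "int (r i) - pair i b = - int k"
  shows "Q (b - lsum k (\<alpha> i)) = Q b"
proof -
  have l: "Poly_Mapping.lookup (lsum k (\<alpha> i)) j = (if i = j then int k else 0)" for j
    by (induction k) (simp_all add: lookup_add alpha_def lookup_single)
  have v: "lvec (b - lsum k (\<alpha> i)) = lvec b - real k *\<^sub>R s i"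
    by (simp add: lvec_def lookup_minus l scaleR_left_diff_distrib sum_subtractf if_distrib[of of_int]
        if_distrib[of "\<lambda>x. x *\<^sub>R _"] cong: if_cong)
  have "(\<Sum>j\<in>UNIV. of_int (Poly_Mapping.lookup (b - lsum k (\<alpha> i)) j) * real (r j) * inner (s j) (s j))
      = (\<Sum>j\<in>UNIV. of_int (Poly_Mapping.lookup b j) * real (r j) * inner (s j) (s j)) - real k * real (r i) * inner (s i) (s i)"
    by (simp add: lookup_minus l left_diff_distrib sum_subtractf if_distrib[of of_int] if_distrib[of "\<lambda>x. x * _"] cong: if_cong)
  moreover have "inner (lvec b - real k *\<^sub>R s i) (lvec b - real k *\<^sub>R s i) =
      inner (lvec b) (lvec b) - real k * (2 * inner (s i) (lvec b)) + real k * real k * inner (s i) (s i)"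
    by (simp add: inner_diff_left inner_diff_right inner_commute algebra_simps)
  moreover have "real_of_int (pair i b) = real (r i) + real k"
    using assms by linarith
  ultimately show ?thesis
    by (simp add: Q_def v inner_lvec algebra_simps)
qed

text \<open>Pairing the dominant \<open>\<lambda> - b\<close> with the nonnegative \<open>b\<close>
  gives \<open>|b|^2 \<le> (\<lambda>, b)\<close>, which is stronger than the required
  \<open>|b|^2 \<le> 2 (\<lambda>, b)\<close>.\<close>

lemma Q_dominant:
  assumes "nonneg b" "\<And>i. pair i b \<le> int (r i)"
  shows "Q b \<le> 0"
proof -
  have "2 * inner (lvec b) (lvec b) = (\<Sum>i\<in>UNIV. of_int (Poly_Mapping.lookup b i) * (2 * inner (s i) (lvec b)))"
    by (subst lvec_def) (simp add: inner_sum_left sum_distrib_left mult_ac)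
  also have "\<dots> = (\<Sum>i\<in>UNIV. of_int (Poly_Mapping.lookup b i) * (of_int (pair i b) * inner (s i) (s i)))"
    by (simp add: inner_lvec)
  also have "\<dots> \<le> (\<Sum>i\<in>UNIV. of_int (Poly_Mapping.lookup b i) * (real (r i) * inner (s i) (s i)))"
  proof (rule sum_mono)
    fix i
    have "real_of_int (pair i b) \<le> real (r i)" using assms(2)[of i] by linarith
    then show "of_int (Poly_Mapping.lookup b i) * (of_int (pair i b) * inner (s i) (s i))
        \<le> of_int (Poly_Mapping.lookup b i) * (real (r i) * inner (s i) (s i))"
      using assms(1) by (intro mult_left_mono mult_right_mono) (simp_all add: nonneg_def)
  qed
  finally have "inner (lvec b) (lvec b) \<le> (\<Sum>i\<in>UNIV. of_int (Poly_Mapping.lookup b i) * (real (r i) * inner (s i) (s i)))"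
    using inner_ge_zero[of "lvec b"] by linarith
  then show ?thesis by (simp add: Q_def mult.assoc)
qed

lemma nonneg_wt: "nonneg (wt w)"
  by (induction w) (simp_all add: nonneg_add)

text \<open>Modulo \<open>rad\<close>, \<open>u\<close> is a lowest weight vector for
  \<open>E_i\<close> and \<open>F_i\<close>, with eigenvalues \<open>kap\<close> of
  \<open>K_i\<close> and \<open>ell\<close> of \<open>L_i\<close>. Applying \<open>F_i\<close> to
  the power \<open>j + 1\<close> of \<open>E_i\<close> on \<open>u\<close> returns the power
  \<open>j\<close> times \<open>qnum (Suc j) t * (kap - ell / t ^ j)\<close>. This is nonzero for
  \<open>j < n\<close>, since the weight forces \<open>kap * t ^ n = ell\<close>.\<close>

lemma lowest_vector_reflect:
  assumes u: "u \<in> wspace b" "u \<notin> rad" "var i * u \<in> rad" and n: "int (r i) - pair i b = - int n"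
  shows "j \<le> n \<Longrightarrow> (Eop i ^^ j) u \<notin> rad"
proof -
  let ?t = "qq i i"
  obtain w where w: "b = wt w"
    using wspace_nz[OF u(1)] u(2) FA.subspace_0[OF subspace_rad] by metis
  define kap where "kap = lK (\<alpha> i) * chi (\<alpha> i) (- b)"
  define ell where "ell = lL (\<alpha> i) * chi b (\<alpha> i)"
  have ell: "ell \<noteq> 0" by (simp add: ell_def)
  have kl: "kap * ?t ^ n = ell"
  proof -
    have "pair i b = int (r i) + int n" using n by simp
    then have "chi (\<alpha> i) b * chi b (\<alpha> i) = ?t ^ r i * ?t ^ n"
      unfolding w chi_pair by (simp add: power_int_add)
    then show ?thesis by (simp add: kap_def ell_def lK_lL chi_minus_right field_simps)
  qed
  have wsp: "(Eop i ^^ j) u \<in> wspace (b - lsum j (\<alpha> i))" for j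
    using Eop_power_wspace[OF u(1)] by (simp add: wt_replicate)
  have K: "Kop (\<alpha> i) ((Eop i ^^ j) u) = fscale (?t ^ j * kap) ((Eop i ^^ j) u)"
    and L: "Lop (\<alpha> i) ((Eop i ^^ j) u) = fscale (ell / ?t ^ j) ((Eop i ^^ j) u)" for j
    unfolding Kop_wspace[OF wsp] Lop_wspace[OF wsp] diff_conv_add_uminus minus_add_distrib
    by (simp_all only: chi_add_left chi_add_right chi_minus_left chi_minus_right minus_minus chi_lsum_left chi_lsum_right
        kap_def ell_def divide_inverse mult_ac)
  have c: "var i * (Eop i ^^ Suc j) u - fscale (\<Sum>l<Suc j. ?t ^ l * kap - ell / ?t ^ l) ((Eop i ^^ j) u) \<in> rad" for j
  proof (induction j)
    case 0
    have "var i * Eop i u = Eop i (var i * u) - Lop (\<alpha> i) u + Kop (\<alpha> i) u" by (simp add: Eop_var)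
    then have "var i * (Eop i ^^ Suc 0) u - fscale (\<Sum>l<Suc 0. ?t ^ l * kap - ell / ?t ^ l) ((Eop i ^^ 0) u) = Eop i (var i * u)"
      using K[of 0] L[of 0] by (simp add: FA.scale_left_diff_distrib)
    then show ?case using Eop_rad[OF u(3)] by simp
  next
    case (Suc j)
    let ?c = "\<Sum>l<Suc j. ?t ^ l * kap - ell / ?t ^ l"
    let ?e = "(Eop i ^^ Suc j) u"
    have "var i * Eop i ?e = Eop i (var i * ?e) - Lop (\<alpha> i) ?e + Kop (\<alpha> i) ?e" by (simp add: Eop_var)
    also have "\<dots> = Eop i (var i * ?e) + fscale (?t ^ Suc j * kap - ell / ?t ^ Suc j) ?e"
      by (simp only: K L FA.scale_left_diff_distrib) (simp add: algebra_simps)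
    finally have "var i * (Eop i ^^ Suc (Suc j)) u - fscale (\<Sum>l<Suc (Suc j). ?t ^ l * kap - ell / ?t ^ l) ?e
        = Eop i (var i * ?e) - fscale ?c ?e"
      by (simp add: fscale_add_left)
    also have "\<dots> = Eop i (var i * ?e - fscale ?c ((Eop i ^^ j) u))"
      by (simp add: op_simps)
    finally show ?case using Eop_rad[OF Suc, of i] by simp
  qed
  show "(Eop i ^^ j) u \<notin> rad" if "j \<le> n" for j
    using that
  proof (induction j)
    case (Suc j)
    define C where "C = qnum (Suc j) ?t * (kap - ell / ?t ^ j)"
    have "C \<noteq> 0"
    proof -
      have "ell / ?t ^ j \<noteq> kap"
      proof
        assume "ell / ?t ^ j = kap"
        with kl ell have "?t ^ j = ?t ^ n" by (auto simp: field_simps)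
        from root_of_unity_power_inject[OF q_nroot chi_nz this] Suc.prems show False by simp
      qed
      then show ?thesis using qnum_nz[OF q_nroot] by (auto simp: C_def)
    qed
    show ?case
    proof
      assume "(Eop i ^^ Suc j) u \<in> rad"
      from FA.subspace_diff[OF subspace_rad var_rad[OF this, of i] c[of j]]
      have "fscale C ((Eop i ^^ j) u) \<in> rad" by (simp add: C_def qsum_closed_form del: sum.lessThan_Suc funpow.simps)
      from FA.subspace_scale[OF subspace_rad this, of "inverse C"] \<open>C \<noteq> 0\<close>
      have "(Eop i ^^ j) u \<in> rad" by simp
      then show False using Suc by simp
    qed
  qed (simp add: u)
qed

text \<open>Induction on the height: if \<open>\<lambda> - b\<close> is not dominant, a reflection
  leads to another weight with the same \<open>Q\<close> and smaller height.\<close>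

lemma weight_bound: "m \<in> wspace b \<Longrightarrow> m \<notin> rad \<Longrightarrow> Q b \<le> 0"
proof (induction "nat (ht b)" arbitrary: b m rule: less_induct)
  case less
  have nn: "nonneg b"
    using wspace_nz[OF less.prems(1)] less.prems(2) FA.subspace_0[OF subspace_rad] nonneg_wt by metis
  show ?case
  proof (cases "\<forall>i. pair i b \<le> int (r i)")
    case True
    then show ?thesis using Q_dominant[OF nn] by blast
  next
    case False
    then obtain i where i: "int (r i) < pair i b" by (auto simp: not_le)
    define k where "k = nat (pair i b - int (r i))"
    have k: "int (r i) - pair i b = - int k" "0 < k" using i by (simp_all add: k_def)
    define t where "t = (LEAST t. var i ^ t * m \<in> rad)"
    have t: "var i ^ t * m \<in> rad" unfolding t_def by (rule LeastI_ex[OF nilpotent])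
    then have "t \<noteq> 0" using less.prems(2) by (intro notI) simp
    then obtain t' where t': "t = Suc t'" by (cases t) auto
    define u where "u = var i ^ t' * m"
    have u1: "u \<notin> rad" unfolding u_def using not_less_Least[of t' "\<lambda>t. var i ^ t * m \<in> rad"] t' by (simp add: t_def)
    have u2: "var i * u \<in> rad" using t by (simp add: u_def t' mult.assoc)
    have u3: "u \<in> wspace (b + lsum t' (\<alpha> i))" unfolding u_def by (rule var_power_wspace[OF less.prems(1)])
    \<comment> \<open>\<open>u\<close> lies \<open>t'\<close> steps below \<open>m\<close>, so at
      least \<open>k + 2 * t'\<close> steps up from it stay nonzero; after \<open>k + t'\<close> of
      them the reflected weight is reached.\<close>
    have "int (r i) - pair i (b + lsum t' (\<alpha> i)) = - int (k + 2 * t')"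
      using k by (simp add: pair_add pair_lsum)
    from lowest_vector_reflect[OF u3 u1 u2 this, of "k + t'"]
    have e: "(Eop i ^^ (k + t')) u \<notin> rad" by simp
    have w: "(Eop i ^^ (k + t')) u \<in> wspace (b - lsum k (\<alpha> i))"
      using Eop_power_wspace[OF u3, of "k + t'" i] by (simp add: wt_replicate lsum_add algebra_simps)
    have "\<exists>w. wt w = b - lsum k (\<alpha> i)"
      using wspace_nz[OF w] e FA.subspace_0[OF subspace_rad] by metis
    then have "nonneg (b - lsum k (\<alpha> i))" using nonneg_wt by metis
    from ht_nonneg[OF this] have "nat (ht (b - lsum k (\<alpha> i))) < nat (ht b)"
      using k(2) by (simp add: ht_diff ht_lsum)
    from less.hyps[OF this w e] show ?thesis using Q_reflect[OF k(1)] by simp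
  qed
qed

text \<open>Independence of the \<open>s i\<close> makes the map from coordinates to vectors
  injective, hence bounded below in finite dimension.\<close>

lemma lvec_bound: "\<exists>c>0. \<forall>b. c * (\<Sum>i\<in>UNIV. \<bar>of_int (Poly_Mapping.lookup b i)\<bar>) \<le> norm (lvec b)"
proof -
  define f :: "real ^ 'n \<Rightarrow> 'v" where "f x = (\<Sum>i\<in>UNIV. (x $ i) *\<^sub>R s i)" for x
  have lin: "linear f"
    by (rule linearI) (simp_all add: f_def scaleR_add_left sum.distrib scaleR_sum_right)
  have "inj f"
  proof (subst linear_injective_0[OF lin], intro allI impI)
    fix x assume "f x = 0"
    then have "(\<Sum>v\<in>range s. (x $ inv_into UNIV s v) *\<^sub>R v) = 0"
      unfolding f_def by (subst sum.reindex[OF s_inj]) (simp add: s_inj)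
    then have "x $ inv_into UNIV s v = 0" if "v \<in> range s" for v
      using independentD[OF s_indep, of "range s" "\<lambda>v. x $ inv_into UNIV s v" v] that by simp
    from this[OF rangeI] show "x = 0" by (simp add: vec_eq_iff inv_f_f[OF s_inj])
  qed
  then obtain c where c: "c > 0" "\<And>x. c * norm x \<le> norm (f x)"
    using linear_inj_bounded_below_pos[OF lin] by blast
  have "c / real CARD('n) * (\<Sum>i\<in>UNIV. \<bar>real_of_int (Poly_Mapping.lookup b i)\<bar>) \<le> norm (lvec b)" for b
  proof -
    define x :: "real ^ 'n" where "x = (\<chi> i. real_of_int (Poly_Mapping.lookup b i))"
    have "(\<Sum>i\<in>UNIV. \<bar>real_of_int (Poly_Mapping.lookup b i)\<bar>) \<le> (\<Sum>i\<in>(UNIV :: 'n set). norm x)"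
      by (rule sum_mono) (metis component_le_norm_cart vec_lambda_beta x_def)
    then have "c * (\<Sum>i\<in>UNIV. \<bar>real_of_int (Poly_Mapping.lookup b i)\<bar>) \<le> real CARD('n) * (c * norm x)"
      using c(1) by (simp add: mult.left_commute)
    also have "\<dots> \<le> real CARD('n) * norm (lvec b)"
      using c(2)[of x] by (intro mult_left_mono) (simp_all add: f_def x_def lvec_def)
    finally show ?thesis by (simp add: field_simps)
  qed
  then show ?thesis using c(1) by (intro exI[of _ "c / real CARD('n)"]) simp
qed

lemma finite_codim: "\<exists>B. finite B \<and> FA.span (B \<union> rad) = UNIV"
proof -
  obtain c where c: "c > 0" "\<And>b. c * (\<Sum>i\<in>UNIV. \<bar>of_int (Poly_Mapping.lookup b i)\<bar>) \<le> norm (lvec b)"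
    using lvec_bound by blast
  define R where "R = (\<Sum>i\<in>UNIV. real (r i) * inner (s i) (s i))"
  have R: "0 \<le> R" by (simp add: R_def sum_nonneg)
  define W where "W = {w. Q (wt w) \<le> 0}"
  \<comment> \<open>For \<open>n = length w\<close>, \<open>Q\<close> compares a quadratic with a
    linear term: \<open>c^2 n^2 \<le> n R\<close>.\<close>
  have "length w \<le> nat \<lceil>R / c\<^sup>2\<rceil>" if w: "Q (wt w) \<le> 0" for w
  proof -
    have nn: "0 \<le> Poly_Mapping.lookup (wt w) i" for i using nonneg_wt[of w] by (simp add: nonneg_def)
    have len: "(\<Sum>i\<in>UNIV. real_of_int (Poly_Mapping.lookup (wt w) i)) = real (length w)"
    proof -
      have "ht (wt w) = int (length w)" by (induction w) (simp_all add: ht_add)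
      then show ?thesis unfolding ht_def by (metis of_int_of_nat_eq of_int_sum)
    qed
    have "(c * real (length w))\<^sup>2 \<le> (norm (lvec (wt w)))\<^sup>2"
      using c(1) c(2)[of "wt w"] by (intro power_mono) (simp_all add: nn len)
    also have "\<dots> = inner (lvec (wt w)) (lvec (wt w))" by (simp add: power2_norm_eq_inner)
    also have "\<dots> \<le> (\<Sum>i\<in>UNIV. of_int (Poly_Mapping.lookup (wt w) i) * (real (r i) * inner (s i) (s i)))"
      using w by (simp add: Q_def mult.assoc)
    also have "\<dots> \<le> (\<Sum>i\<in>UNIV. of_int (Poly_Mapping.lookup (wt w) i) * R)"
    proof (intro sum_mono mult_left_mono)
      fix i
      show "real (r i) * inner (s i) (s i) \<le> R"
        unfolding R_def by (rule member_le_sum) simp_all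
    qed (simp add: nn)
    also have "\<dots> = real (length w) * R" by (simp add: len flip: sum_distrib_right)
    finally have "real (length w) * (real (length w) * c\<^sup>2) \<le> real (length w) * R"
      by (simp add: power_mult_distrib power2_eq_square mult_ac)
    then have "real (length w) * c\<^sup>2 \<le> R" using R by (cases "w = []") auto
    then have "real (length w) \<le> R / c\<^sup>2" using c(1) by (simp add: field_simps)
    then show ?thesis by linarith
  qed
  then have "W \<subseteq> {w. set w \<subseteq> UNIV \<and> length w \<le> nat \<lceil>R / c\<^sup>2\<rceil>}" by (auto simp: W_def)
  then have "finite W" using finite_lists_length_le[of "UNIV :: 'n set"] by (rule finite_subset) simp
  moreover have "FA.span (mon ` W \<union> rad) = UNIV"
  proof -
    have "mon w \<in> mon ` W \<union> rad" for w
      using weight_bound[OF mon_wspace, of w] by (auto simp: W_def)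
    then have "FA.span (range mon) \<subseteq> FA.span (mon ` W \<union> rad)" by (intro FA.span_mono) blast
    then show ?thesis by (simp add: span_mon top.extremum_unique)
  qed
  ultimately show ?thesis by blast
qed

end

section \<open>Bi-homomorphisms of Cartan type\<close>

text \<open>What \<open>integral_weight\<close> needs of Cartan type. It involves only the twist
  class of \<open>chi\<close> and no numbering of the indices, so it survives
  \<open>twist_rel\<close> and permutations.\<close>

definition cartan_data :: "('k::field, 'n::finite) bichar \<Rightarrow> ('n \<Rightarrow> real ^ 'n) \<Rightarrow> ('n \<Rightarrow> 'n \<Rightarrow> int) \<Rightarrow> bool"
  where "cartan_data chi s a \<longleftrightarrow> inj s \<and> independent (range s) \<and>
    (\<forall>i j. 2 * inner (s i) (s j) = of_int (a i j) * inner (s i) (s i)) \<and>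
    (\<forall>i j. i \<noteq> j \<longrightarrow> a i j \<le> 0) \<and>
    (\<forall>i. \<not> root_of_unity (chi (\<alpha> i) (\<alpha> i))) \<and>
    (\<forall>i j. chi (\<alpha> i) (\<alpha> j) * chi (\<alpha> j) (\<alpha> i) = chi (\<alpha> i) (\<alpha> i) powi a i j)"

lemma cartan_data_twist: "twist_rel chi chi' \<Longrightarrow> cartan_data chi' s a \<Longrightarrow> cartan_data chi s a"
  unfolding twist_rel_def cartan_data_def by simp

lemma cartan_data_permute:
  assumes "cartan_data chi' s a" "bij g" "\<And>i j. chi' (\<alpha> i) (\<alpha> j) = chi (\<alpha> (g i)) (\<alpha> (g j))"
  shows "cartan_data chi (\<lambda>i. s (inv_into UNIV g i)) (\<lambda>i j. a (inv_into UNIV g i) (inv_into UNIV g j))"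
proof -
  let ?h = "inv_into UNIV g"
  have h: "chi (\<alpha> i) (\<alpha> j) = chi' (\<alpha> (?h i)) (\<alpha> (?h j))" for i j
    using assms(2,3) by (simp add: bij_is_surj surj_f_inv_f)
  have bij: "bij ?h" using assms(2) by (rule bij_imp_bij_inv)
  have "range (\<lambda>i. s (?h i)) = range s"
    using bij_is_surj[OF bij] by (metis image_image)
  moreover have "inj (\<lambda>i. s (?h i))"
    using assms(1) bij_is_inj[OF bij] unfolding cartan_data_def by (simp add: inj_def)
  moreover have "?h i \<noteq> ?h j" if "i \<noteq> j" for i j using that bij_is_inj[OF bij] by (simp add: inj_eq)
  ultimately show ?thesis using assms(1) unfolding cartan_data_def h by simp
qed

lemma twist_rel_refl: "twist_rel chi chi"
  and twist_rel_trans: "twist_rel chi chi' \<Longrightarrow> twist_rel chi' chi'' \<Longrightarrow> twist_rel chi chi''"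
  by (simp_all add: twist_rel_def)

section \<open>The operations \<open>tau\<close> and twist classes\<close>

lemma s_map_add: "s_map chi i (a + b) = s_map chi i a + s_map chi i b"
  by (simp add: s_map_def lookup_add single_add distrib_right sum.distrib sum_subtractf algebra_simps)

lemma s_map_alpha: "s_map chi i (\<alpha> j) = \<alpha> j - Poly_Mapping.single i (c_entry chi i j)"
proof -
  have "s_map chi i (\<alpha> j) = (\<Sum>k\<in>UNIV. if k = j then \<alpha> j - Poly_Mapping.single i (c_entry chi i j) else 0)"
    unfolding s_map_def by (rule sum.cong) (auto simp: alpha_def lookup_single when_def)
  then show ?thesis by simp
qed

lemma bihom_tau: "bihom chi \<Longrightarrow> bihom (tau i chi)"
  by (simp add: bihom_def tau_def s_map_add)

context bicharacter
begin

lemma chi_single: "chi (Poly_Mapping.single i c) b = chi (\<alpha> i) b powi c"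
  and chi_single_right: "chi b (Poly_Mapping.single i c) = chi b (\<alpha> i) powi c"
proof -
  have *: "chi (Poly_Mapping.single i (int n)) b = chi (\<alpha> i) b ^ n \<and> chi b (Poly_Mapping.single i (int n)) = chi b (\<alpha> i) ^ n" for n
    by (induction n) (simp_all add: single_add chi_add_left chi_add_right alpha_def)
  have "chi (Poly_Mapping.single i c) b = chi (\<alpha> i) b powi c \<and> chi b (Poly_Mapping.single i c) = chi b (\<alpha> i) powi c"
  proof (cases "0 \<le> c")
    case True
    then show ?thesis using *[of "nat c"] by (simp add: power_int_def)
  next
    case False
    then have "Poly_Mapping.single i c = - Poly_Mapping.single i (int (nat (- c)))" by (simp add: single_uminus)
    with False show ?thesis
      using *[of "nat (- c)"] by (simp add: chi_minus_left chi_minus_right power_int_def power_inverse)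
  qed
  then show "chi (Poly_Mapping.single i c) b = chi (\<alpha> i) b powi c"
    "chi b (Poly_Mapping.single i c) = chi b (\<alpha> i) powi c" by simp_all
qed

lemma tau_alpha:
  "tau i chi (\<alpha> j) (\<alpha> k) = chi (\<alpha> j) (\<alpha> k) * chi (\<alpha> j) (\<alpha> i) powi - c_entry chi i k
    * (chi (\<alpha> i) (\<alpha> k) powi - c_entry chi i j * chi (\<alpha> i) (\<alpha> i) powi (c_entry chi i j * c_entry chi i k))"
proof -
  have "tau i chi (\<alpha> j) (\<alpha> k) =
      chi (\<alpha> j + Poly_Mapping.single i (- c_entry chi i j)) (\<alpha> k + Poly_Mapping.single i (- c_entry chi i k))"
    by (simp add: tau_def s_map_alpha single_uminus)
  then show ?thesis
    by (simp only: chi_add_left chi_add_right chi_single chi_single_right)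
      (simp add: power_int_mult_distrib mult_ac flip: power_int_mult)
qed

lemma tau_diag: "tau i chi (\<alpha> i) (\<alpha> i) = chi (\<alpha> i) (\<alpha> i)"
  by (simp add: tau_alpha c_entry_def flip: power_int_add power_int_add_1) (simp add: power_int_minus field_simps flip: power_int_add)

text \<open>No \<open>q\<close>-factorial vanishes, so \<open>c_set\<close> ends exactly at the
  first \<open>m\<close> for which \<open>q_ii ^ m * (q_ij q_ji) = 1\<close>.\<close>

lemma c_entry_power:
  assumes q: "\<not> root_of_unity (chi (\<alpha> i) (\<alpha> i))" and fin: "c_finite chi i j"
  shows "chi (\<alpha> i) (\<alpha> j) * chi (\<alpha> j) (\<alpha> i) = chi (\<alpha> i) (\<alpha> i) powi c_entry chi i j"
proof (cases "i = j")
  case True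
  then show ?thesis by (simp add: c_entry_def power_int_numeral power2_eq_square)
next
  case False
  let ?q = "chi (\<alpha> i) (\<alpha> i)" and ?p = "chi (\<alpha> i) (\<alpha> j) * chi (\<alpha> j) (\<alpha> i)"
  have "qfact m ?q \<noteq> 0" for m
  proof -
    have "qnum k ?q \<noteq> 0" if "k \<in> {1..m}" for k
      using that qnum_nz[OF q, of "k - 1"] by simp
    then show ?thesis unfolding qfact_def by simp
  qed
  then have c: "c_set chi i j = {m. \<forall>k\<in>{1..m}. ?q ^ (k - 1) * ?p \<noteq> 1}"
    by (simp add: c_set_def qpoch_def)
  have "c_set chi i j \<noteq> UNIV" using fin False by (simp add: c_finite_def)
  then obtain k where k: "1 \<le> k" "?q ^ (k - 1) * ?p = 1" unfolding c by auto
  have "c_set chi i j \<subseteq> {..<k}" using k unfolding c by (auto simp: not_less)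
  then have f: "finite (c_set chi i j)" using finite_subset by blast
  moreover have "0 \<in> c_set chi i j" unfolding c by simp
  ultimately have M: "Max (c_set chi i j) \<in> c_set chi i j" using Max_in by blast
  let ?m = "Max (c_set chi i j)"
  have "Suc ?m \<notin> c_set chi i j" using Max_ge[OF f, of "Suc ?m"] by auto
  then obtain l where l: "l \<in> {1..Suc ?m}" "?q ^ (l - 1) * ?p = 1" unfolding c by blast
  \<comment> \<open>A smaller \<open>l\<close> would exclude the maximum itself from the
    set.\<close>
  then have "l = Suc ?m" using M unfolding c by (metis (mono_tags, lifting) atLeastAtMost_iff le_Suc_eq mem_Collect_eq)
  with l have "?q ^ ?m * ?p = 1" by simp
  then show ?thesis using False by (simp add: c_entry_def power_int_minus field_simps)
qed

text \<open>As \<open>q_ij q_ji\<close> is a power of \<open>q_ii\<close>, the extra factors in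
  \<open>tau_alpha\<close> combine into powers of \<open>q_ii\<close> with exponents
  \<open>- c_ij c_ij + c_ij c_ij\<close> on the diagonal and
  \<open>- 2 c_ij c_ik + 2 c_ij c_ik\<close> for the products.\<close>

lemma tau_twist:
  assumes q: "\<not> root_of_unity (chi (\<alpha> i) (\<alpha> i))" and d: "tau_defined i chi"
  shows "twist_rel chi (tau i chi)"
proof -
  let ?q = "chi (\<alpha> i) (\<alpha> i)" and ?c = "c_entry chi i"
  have p: "chi (\<alpha> i) (\<alpha> j) * chi (\<alpha> j) (\<alpha> i) = ?q powi ?c j" for j
    using c_entry_power[OF q] d by (simp add: tau_defined_def)
  have p': "chi (\<alpha> i) (\<alpha> j) powi m * chi (\<alpha> j) (\<alpha> i) powi m = ?q powi (?c j * m)" for j m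
    by (simp add: p power_int_mult flip: power_int_mult_distrib)
  have "tau i chi (\<alpha> j) (\<alpha> j) = chi (\<alpha> j) (\<alpha> j)" for j
  proof -
    have "tau i chi (\<alpha> j) (\<alpha> j) = chi (\<alpha> j) (\<alpha> j) *
        ((chi (\<alpha> i) (\<alpha> j) powi - ?c j * chi (\<alpha> j) (\<alpha> i) powi - ?c j) * ?q powi (?c j * ?c j))"
      by (simp only: tau_alpha mult_ac)
    also have "\<dots> = chi (\<alpha> j) (\<alpha> j)"
      unfolding p'[of j] by (simp flip: power_int_add)
    finally show ?thesis .
  qed
  moreover have "tau i chi (\<alpha> j) (\<alpha> k) * tau i chi (\<alpha> k) (\<alpha> j) = chi (\<alpha> j) (\<alpha> k) * chi (\<alpha> k) (\<alpha> j)" for j k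
  proof -
    have "tau i chi (\<alpha> j) (\<alpha> k) * tau i chi (\<alpha> k) (\<alpha> j) = chi (\<alpha> j) (\<alpha> k) * chi (\<alpha> k) (\<alpha> j) *
      ((chi (\<alpha> i) (\<alpha> j) powi - ?c k * chi (\<alpha> j) (\<alpha> i) powi - ?c k) *
       (chi (\<alpha> i) (\<alpha> k) powi - ?c j * chi (\<alpha> k) (\<alpha> i) powi - ?c j) *
       (?q powi (?c j * ?c k) * ?q powi (?c j * ?c k)))"
      by (simp only: tau_alpha mult_ac)
    also have "\<dots> = chi (\<alpha> j) (\<alpha> k) * chi (\<alpha> k) (\<alpha> j)"
      unfolding p'[of j "- ?c k"] p'[of k "- ?c j"] by (simp add: mult.commute flip: power_int_add)
    finally show ?thesis .
  qed
  ultimately show ?thesis by (simp add: twist_rel_def)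
qed

end

text \<open>The hypothesis concerns the end of the chain, so the induction carries it as a premise.
  \<open>tau_diag\<close> returns it to the previous member for the index \<open>i\<close>, which
  allows \<open>tau_twist\<close>, and the twist returns it for all indices.\<close>

lemma weyl_rel_twist:
  assumes "weyl_rel chi chi'" "bihom chi" "\<And>i. \<not> root_of_unity (chi' (\<alpha> i) (\<alpha> i))"
  shows "twist_rel chi chi'"
proof -
  have "bihom chi' \<and> ((\<forall>i. \<not> root_of_unity (chi' (\<alpha> i) (\<alpha> i))) \<longrightarrow> twist_rel chi chi')"
    using assms(1)
  proof induction
    case refl
    then show ?case using assms(2) by (simp add: twist_rel_refl)
  next
    case (step chi' i)
    then interpret bicharacter chi' by unfold_locales simp
    show ?case
    proof (intro conjI impI)
      show "bihom (tau i chi')" using step.IH by (simp add: bihom_tau)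
      assume nr: "\<forall>j. \<not> root_of_unity (tau i chi' (\<alpha> j) (\<alpha> j))"
      then have "\<not> root_of_unity (chi' (\<alpha> i) (\<alpha> i))" using tau_diag by metis
      then have t: "twist_rel chi' (tau i chi')" using step.hyps(2) by (rule tau_twist)
      then have "\<forall>j. \<not> root_of_unity (chi' (\<alpha> j) (\<alpha> j))" using nr by (simp add: twist_rel_def)
      then show "twist_rel chi (tau i chi')" using step.IH t twist_rel_trans by blast
    qed
  qed
  then show ?thesis using assms(3) by simp
qed

section \<open>From root systems to Cartan data\<close>

lemma index_of_inject: "index_of i = index_of j \<longleftrightarrow> i = j" for i j :: "'n::{finite,linorder}"
proof -
  have "index_of i < index_of j" if "i < j" for i j :: 'n
    unfolding index_of_def
  proof (rule psubset_card_mono)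
    have "j \<in> {k. k \<le> j}" "j \<notin> {k. k \<le> i}" "{k. k \<le> i} \<subseteq> {k. k \<le> j}" using that by auto
    then show "{k. k \<le> i} \<subset> {k. k \<le> j}" by blast
  qed simp
  then show ?thesis by (metis less_irrefl neqE)
qed

lemma cartan_integer_nonpos: "k \<noteq> l \<Longrightarrow> cartan_integer T N k l \<le> 0"
  by (simp add: cartan_integer_def)

text \<open>Makes the diagonal exponents positive integers: the floors are exact, and such powers of
  \<open>q\<close> are again not roots of unity.\<close>

lemma root_norms_nat: "x \<in> root_norms T \<Longrightarrow> \<exists>n>0. x = real n"
proof -
  have "\<exists>n>0. (1::real) = real n" "\<exists>n>0. (2::real) = real n" "\<exists>n>0. (4::real) = real n" "\<exists>n>0. (6::real) = real n"
    by (intro exI[of _ 1], simp, intro exI[of _ 2], simp, intro exI[of _ 4], simp, intro exI[of _ 6], simp)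
  then show "x \<in> root_norms T \<Longrightarrow> \<exists>n>0. x = real n" by (cases T) auto
qed

lemma cartan_type_data:
  fixes chi :: "('k::field, 'n::{finite,linorder}) bichar"
  assumes "cartan_type chi"
  shows "\<exists>s a. cartan_data chi s a"
proof -
  obtain q T R s where q: "q \<noteq> 0" "\<not> root_of_unity q" and R: "normalized_root_system T R s"
    and diag: "\<And>i. chi (\<alpha> i) (\<alpha> i) = q powi \<lfloor>inner (s i) (s i)\<rfloor>"
    and off: "\<And>i j. i \<noteq> j \<Longrightarrow> chi (\<alpha> i) (\<alpha> j) * chi (\<alpha> j) (\<alpha> i) = q powi \<lfloor>2 * inner (s i) (s j)\<rfloor>"
    using assms unfolding cartan_type_def by blast
  have s: "inj s" "independent (range s)" "range s \<subseteq> R"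
    using R unfolding normalized_root_system_def simple_roots_def by auto
  \<comment> \<open>The indices are swapped: \<open>cartan_integer T N k l\<close> is normalized by
    the second root, \<open>a i j\<close> by the first.\<close>
  define a where "a = (\<lambda>(i :: 'n) (j :: 'n). cartan_integer T CARD('n) (index_of j) (index_of i))"
  have "\<exists>n>0. inner (s i) (s i) = real n" for i
    using R s(3) root_norms_nat[of "inner (s i) (s i)" T] unfolding normalized_root_system_def by blast
  then obtain d where d: "\<And>i. 0 < d i" "\<And>i. inner (s i) (s i) = real (d i)" by metis
  have a: "2 * inner (s i) (s j) = of_int (a i j) * inner (s i) (s i)" for i j
  proof -
    have "coroot_pairing (s j) (s i) = of_int (a i j)"
      using R unfolding normalized_root_system_def a_def by blast
    then show ?thesis using d(1)[of i] d(2)[of i] by (simp add: coroot_pairing_def inner_commute field_simps)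
  qed
  have qd: "chi (\<alpha> i) (\<alpha> i) = q ^ d i" for i by (simp add: diag d)
  have "\<not> root_of_unity (q ^ d i)" for i
    using q(2) d(1)[of i] unfolding root_of_unity_def by (metis power_mult nat_0_less_mult_iff)
  moreover have "chi (\<alpha> i) (\<alpha> j) * chi (\<alpha> j) (\<alpha> i) = (q ^ d i) powi a i j" for i j
  proof (cases "i = j")
    case True
    have "a i i = 2" using a[of i i] d[of i] by simp
    then show ?thesis using True qd by (simp add: power_int_numeral power2_eq_square)
  next
    case False
    have "2 * inner (s i) (s j) = of_int (int (d i) * a i j)" by (simp add: a d)
    then have "\<lfloor>2 * inner (s i) (s j)\<rfloor> = int (d i) * a i j" by (metis floor_of_int)
    then show ?thesis using off[OF False] by (simp add: power_int_mult)
  qed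
  moreover have "a i j \<le> 0" if "i \<noteq> j" for i j
    using that cartan_integer_nonpos index_of_inject unfolding a_def by metis
  ultimately have "cartan_data chi s a"
    using s a qd unfolding cartan_data_def by simp
  then show ?thesis by blast
qed

theorem theorem7p2:
  fixes chi :: "('k::field_char_0, 'n::{finite,linorder}) bichar"
    and \<Lambda> :: "('k, 'n) U_elem \<Rightarrow> 'k"
  assumes "CARD('n) \<ge> 2"
    and "bihom chi"
    and "\<exists>chi'. bihom chi' \<and> cartan_type chi' \<and> approx_rel chi chi'"
    and "\<Lambda> \<in> Ch chi"
  shows "finite_dimensional chi (irr chi \<Lambda>) \<longleftrightarrow>
    (\<forall>i. \<exists>r::nat. \<Lambda> (U_K chi (\<alpha> i) \<otimes>\<^bsub>U chi\<^esub> U_L chi (- \<alpha> i)) = chi (\<alpha> i) (\<alpha> i) ^ r)"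
proof -
  interpret character chi \<Lambda>
    by unfold_locales (use assms in auto)
  obtain chi' where c: "cartan_type chi'" "approx_rel chi chi'" using assms(3) by blast
  obtain chi1 chi2 g where g: "bij g" and chi1: "weyl_rel chi chi1" "twist_rel chi1 chi2"
    and chi': "\<And>i j. chi' (\<alpha> i) (\<alpha> j) = chi2 (\<alpha> (g i)) (\<alpha> (g j))"
    using c(2) unfolding approx_rel_def by blast
  from c(1) obtain s a where "cartan_data chi2 s a"
    using cartan_type_data cartan_data_permute[of chi' _ _ g chi2, OF _ g chi'] by blast
  then have 1: "cartan_data chi1 s a" by (rule cartan_data_twist[OF chi1(2)])
  then have "twist_rel chi chi1"
    by (intro weyl_rel_twist[OF chi1(1) assms(2)]) (simp add: cartan_data_def)
  then have data: "cartan_data chi s a" using 1 by (rule cartan_data_twist)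
  \<comment> \<open>Multiplying by \<open>lL (\<alpha> i)\<close> turns the condition on
    \<open>\<Lambda>\<close> into the relation between \<open>lK\<close> and \<open>lL\<close> in
    which both directions are proved.\<close>
  have lL: "lL (- \<alpha> i) * lL (\<alpha> i) = 1" for i
    using lL_add[of "- \<alpha> i" "\<alpha> i"] lL_0 by simp
  have iff: "\<Lambda> (U_K chi (\<alpha> i) \<otimes>\<^bsub>U chi\<^esub> U_L chi (- \<alpha> i)) = chi (\<alpha> i) (\<alpha> i) ^ r \<longleftrightarrow>
      lK (\<alpha> i) = chi (\<alpha> i) (\<alpha> i) ^ r * lL (\<alpha> i)" for i r
  proof -
    have "x * lL (- \<alpha> i) = y \<longleftrightarrow> x = y * lL (\<alpha> i)" for x y
    proof
      assume "x * lL (- \<alpha> i) = y"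
      then have "y * lL (\<alpha> i) = x * (lL (- \<alpha> i) * lL (\<alpha> i))" by (simp only: mult.assoc[symmetric])
      then show "x = y * lL (\<alpha> i)" by (simp only: lL mult_1_right)
    next
      assume "x = y * lL (\<alpha> i)"
      then have "x * lL (- \<alpha> i) = y * (lL (- \<alpha> i) * lL (\<alpha> i))" by (simp only: mult_ac)
      then show "x * lL (- \<alpha> i) = y" by (simp only: lL mult_1_right)
    qed
    then show ?thesis unfolding \<Lambda>_KL .
  qed
  show ?thesis
    unfolding finite_dimensional_irr_iff iff
  proof
    assume "\<exists>B. finite B \<and> FA.span (B \<union> rad) = UNIV"
    then show "\<forall>i. \<exists>r. lK (\<alpha> i) = chi (\<alpha> i) (\<alpha> i) ^ r * lL (\<alpha> i)"
      using integrality data unfolding cartan_data_def by blast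
  next
    assume "\<forall>i. \<exists>r. lK (\<alpha> i) = chi (\<alpha> i) (\<alpha> i) ^ r * lL (\<alpha> i)"
    then obtain r where r: "\<And>i. lK (\<alpha> i) = chi (\<alpha> i) (\<alpha> i) ^ r i * lL (\<alpha> i)" by metis
    interpret integral_weight chi lK lL s a r
      by unfold_locales (use data r in \<open>simp_all add: cartan_data_def\<close>)
    show "\<exists>B. finite B \<and> FA.span (B \<union> rad) = UNIV" by (rule finite_codim)
  qed
qed

end
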